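(* Let $\mathscr{H}_{jk,p}^{st}$ be the two-dimensional Yetter-Drinfeld module over $A_{N\,2n}^{\mu\lambda}$ defined in the context, with $1\le s\le N$, $0\le t\le n-1$, $0\le k\le N-1$, $p\in\{0,1\}$, and $\frac j2\in\{1,\dots,n-1\}$ if $\lambda=1$, $\frac{j+1}{2}\in\{1,\dots,n\}$ if $\lambda=-1$. Then $\mathfrak{B}(\mathscr{H}_{jk,p}^{st})$ is of type $V_{abe}$ with $$ae=\bar\mu^{2s+2t+1}\omega^{4kn(4t+4s+2)+jN(4t+2)},\qquad b=(-1)^p\bar\mu^{s+t+\frac12}\omega^{4kn(2t+2s+1)+jN(-1-2t)}.$$
   Context: $\Bbbk$ is an algebraically closed field of characteristic $0$; $N,n\ge1$ are integers and $\mu,\lambda\in\{1,-1\}$. The Suzuki algebra $A=A_{N\,2n}^{\mu\lambda}$ is the Hopf algebra over $\Bbbk$ generated by $x_{11},x_{12},x_{21},x_{22}$ with relations $x_{11}^2=x_{22}^2$, $x_{12}^2=x_{21}^2$, $\chi_{21}^{2n}=\lambda\chi_{12}^{2n}$, $\chi_{11}^{2n}=\chi_{22}^{2n}$, $x_{11}^{2N}+\mu x_{12}^{2N}=1$, and $x_{ij}x_{kl}=0$ whenever $i+j+k+l$ is odd. Here $\chi_{11}^m=x_{11}x_{22}x_{11}\cdots$, $\chi_{22}^m=x_{22}x_{11}x_{22}\cdots$, $\chi_{12}^m=x_{12}x_{21}x_{12}\cdots$, $\chi_{21}^m=x_{21}x_{12}x_{21}\cdots$ are alternating products with $m$ factors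 ($\chi^0=1$). $\Delta(x_{ij})=x_{i1}\otimes x_{1j}+x_{i2}\otimes x_{2j}$, $\varepsilon(x_{ij})=\delta_{ij}$, $S(x_{ij})=x_{ji}^{4N-1}$. Fix a primitive $8nN$-th root of unity $\omega$. Put $\bar\mu=1$ if $\mu=1$ and $\bar\mu=\omega^{4n}$ if $\mu=-1$; fix a square root $\sqrt{\bar\mu}$ and read $\bar\mu^{m+\frac12}$ as $\bar\mu^m\sqrt{\bar\mu}$. $V_{jk}'=\Bbbk v_1'\oplus\Bbbk v_2'$ is the left $A$-module with $x_{11},x_{22}$ acting by $0$, $x_{21}v_1'=\omega^{2jN}v_2'$, $x_{21}v_2'=\bar\mu\omega^{2(4kn-jN)}v_1'$, $x_{12}v_1'=v_2'$, $x_{12}v_2'=\bar\mu\omega^{8kn}v_1'$. For a left $A$-module $V$, $V\boxtimes A$ is the vector space $V\otimes A$ (elements $\ell\boxtimes g$) with the left-left Yetter-Drinfeld structure $h\cdot(\ell\boxtimes g)=(h_{(2)}\cdot\ell)\boxtimes h_{(1)}gS(h_{(3)})$, $\rho(\ell\boxtimes g)=g_{(1)}\otimes(\ell\boxtimes g_{(2)})$. $\mathscr{H}_{jk,p}^{st}=\Bbbk w_1\oplus\Bbbk w_2\subset V_{jk}'\boxtimes A$ is the Yetter-Drinfeld submodule with $w_1=v_1'\boxtimes x_{11}^{2s}\chi_{22}^{2t+1}+\frac{(-1)^p\omega^{jN-4kn}}{\sqrt{\bar\mu}}v_2'\boxtimes x_{12}^{2s}\chi_{21}^{2t+1}$, $w_2=v_2'\boxtimes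 x_{11}^{2s+1}\chi_{22}^{2t}+(-1)^p\sqrt{\bar\mu}\,\omega^{4kn-jN}v_1'\boxtimes x_{12}^{2s+1}\chi_{21}^{2t}$. The braiding of a Yetter-Drinfeld module $M$ is $c(x\otimes y)=x_{(-1)}\cdot y\otimes x_{(0)}$; $\mathfrak{B}(M)$ is its Nichols algebra. $\mathfrak{B}(M)$ is of type $V_{abe}$ if $(M,c)$ is isomorphic, as braided vector space, to $V_{abe}=\Bbbk v_1\oplus\Bbbk v_2$ with $c(v_1\otimes v_1)=a\,v_2\otimes v_2$, $c(v_1\otimes v_2)=b\,v_1\otimes v_2$, $c(v_2\otimes v_1)=b\,v_2\otimes v_1$, $c(v_2\otimes v_2)=e\,v_1\otimes v_1$, for some $a,b,e\in\Bbbk^\times$. (Since $V_{abe}\cong V_{ae\,b\,1}$, only $ae$ and $b$ matter up to isomorphism.) *)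

theory Defs
  imports
    "HOL-Algebra.Algebra"
    "HOL-Algebra.Algebraic_Closure_Type"
    "HOL-Library.Poly_Mapping"
begin

section \<open>Vector spaces, quotients and tensor products\<close>

text \<open>
  A vector space over the field \<^typ>\<open>'k\<close> is a record of type \<^typ>\<open>('k, 'v) module\<close> from
  HOL-Algebra; the fields \<^const>\<open>monoid.mult\<close> and \<^const>\<open>monoid.one\<close> carry the algebra structure if there
  is one and are meaningless otherwise.  The scalars form the ring
  \<^const>\<open>ring_of_type_algebra\<close>.
\<close>

definition free_mod :: "'x set \<Rightarrow> ('k::field, 'x \<Rightarrow>\<^sub>0 'k) module" where
  "free_mod S = \<lparr>carrier = {f. Poly_Mapping.keys f \<subseteq> S}, monoid.mult = undefined,
     monoid.one = undefined, ring.zero = 0, ring.add = (+), module.smult = (\<lambda>c. Poly_Mapping.map ((*) c))\<rparr>"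

definition lin_ext :: "('k::field, 'u, 'm) module_scheme \<Rightarrow> ('x \<Rightarrow> 'u) \<Rightarrow> ('x \<Rightarrow>\<^sub>0 'k) \<Rightarrow> 'u" where
  "lin_ext U \<phi> f =
     (\<Oplus>\<^bsub>U\<^esub>x\<in>Poly_Mapping.keys f. Poly_Mapping.lookup f x \<odot>\<^bsub>U\<^esub> \<phi> x)"

definition gen_submodule ::
    "('k::field, 'v, 'm) module_scheme \<Rightarrow> 'v set \<Rightarrow> 'v set" where
  "gen_submodule M S =
     \<Inter>{U. submodule U (ring_of_type_algebra :: 'k ring) M \<and> S \<subseteq> U}"

text \<open>
  The quotient of an algebra by an ideal; if only the linear structure of the arguments is
  meaningful, the same record is the quotient of a vector space by a subspace.
\<close>

definition quot_mod ::
    "('k::field, 'v, 'm) module_scheme \<Rightarrow> 'v set \<Rightarrow> ('k, 'v set) module" where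
  "quot_mod M U = \<lparr>carrier = carrier (M Quot U),
     monoid.mult = monoid.mult (M Quot U), monoid.one = \<one>\<^bsub>M Quot U\<^esub>,
     ring.zero = \<zero>\<^bsub>M Quot U\<^esub>, ring.add = add (M Quot U),
     module.smult = (\<lambda>c C. \<Union>x\<in>C. U +>\<^bsub>M\<^esub> (c \<odot>\<^bsub>M\<^esub> x))\<rparr>"

definition formal_tensors ::
    "('k::field, 'v, 'm) module_scheme \<Rightarrow> ('k, 'w, 'n) module_scheme
      \<Rightarrow> ('k, 'v \<times> 'w \<Rightarrow>\<^sub>0 'k) module" where
  "formal_tensors V W = (free_mod (carrier V \<times> carrier W))
     \<lparr>monoid.mult := (\<lambda>f g. \<Sum>(a, b)\<in>Poly_Mapping.keys f. \<Sum>(a', b')\<in>Poly_Mapping.keys g.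
         Poly_Mapping.single (a \<otimes>\<^bsub>V\<^esub> a', b \<otimes>\<^bsub>W\<^esub> b')
           (Poly_Mapping.lookup f (a, b) * Poly_Mapping.lookup g (a', b'))),
      one := Poly_Mapping.single (\<one>\<^bsub>V\<^esub>, \<one>\<^bsub>W\<^esub>) 1\<rparr>"

definition tensor_relators ::
    "('k::field, 'v, 'm) module_scheme \<Rightarrow> ('k, 'w, 'n) module_scheme
      \<Rightarrow> ('v \<times> 'w \<Rightarrow>\<^sub>0 'k) set" where
  "tensor_relators V W =
     {Poly_Mapping.single (v \<oplus>\<^bsub>V\<^esub> v', w) 1 - Poly_Mapping.single (v, w) 1
        - Poly_Mapping.single (v', w) 1
      | v v' w. v \<in> carrier V \<and> v' \<in> carrier V \<and> w \<in> carrier W}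
   \<union> {Poly_Mapping.single (v, w \<oplus>\<^bsub>W\<^esub> w') 1 - Poly_Mapping.single (v, w) 1
        - Poly_Mapping.single (v, w') 1
      | v w w'. v \<in> carrier V \<and> w \<in> carrier W \<and> w' \<in> carrier W}
   \<union> {Poly_Mapping.single (c \<odot>\<^bsub>V\<^esub> v, w) 1 - Poly_Mapping.single (v, w) c
      | c v w. v \<in> carrier V \<and> w \<in> carrier W}
   \<union> {Poly_Mapping.single (v, c \<odot>\<^bsub>W\<^esub> w) 1 - Poly_Mapping.single (v, w) c
      | c v w. v \<in> carrier V \<and> w \<in> carrier W}"

definition tensor_null ::
    "('k::field, 'v, 'm) module_scheme \<Rightarrow> ('k, 'w, 'n) module_scheme
      \<Rightarrow> ('v \<times> 'w \<Rightarrow>\<^sub>0 'k) set" where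
  "tensor_null V W = gen_submodule (formal_tensors V W) (tensor_relators V W)"

text \<open>
  The tensor product over \<^typ>\<open>'k\<close>: formal sums of pairs modulo bilinearity.  For algebras
  \<open>V\<close> and \<open>W\<close> the multiplication is \<open>(a \<otimes> b) (a' \<otimes> b') = a a' \<otimes> b b'\<close>.
\<close>

definition tensor ::
    "('k::field, 'v, 'm) module_scheme \<Rightarrow> ('k, 'w, 'n) module_scheme
      \<Rightarrow> ('k, ('v \<times> 'w \<Rightarrow>\<^sub>0 'k) set) module" where
  "tensor V W = quot_mod (formal_tensors V W) (tensor_null V W)"

definition pure_tensor ::
    "('k::field, 'v, 'm) module_scheme \<Rightarrow> ('k, 'w, 'n) module_scheme
      \<Rightarrow> 'v \<Rightarrow> 'w \<Rightarrow> ('v \<times> 'w \<Rightarrow>\<^sub>0 'k) set" where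
  "pure_tensor V W v w = tensor_null V W +>\<^bsub>formal_tensors V W\<^esub> Poly_Mapping.single (v, w) 1"

text \<open>
  The linear map with values in \<open>U\<close> that a bilinear map \<open>B\<close> induces on a tensor product, by
  \<open>\<Sum> v \<otimes> w \<mapsto> \<Sum> B v w\<close>.  The image of a coset of formal sums is a singleton whenever \<open>B\<close> is
  bilinear.  This is also how Sweedler notation is read below.
\<close>

definition tensor_lift ::
    "('k::field, 'u, 'm) module_scheme \<Rightarrow> ('v \<Rightarrow> 'w \<Rightarrow> 'u) \<Rightarrow> ('v \<times> 'w \<Rightarrow>\<^sub>0 'k) set \<Rightarrow> 'u" where
  "tensor_lift U B T = the_elem (lin_ext U (\<lambda>(v, w). B v w) ` T)"

definition lin_iso ::
    "('k::field, 'v, 'm) module_scheme \<Rightarrow> ('k, 'w, 'n) module_scheme \<Rightarrow> ('v \<Rightarrow> 'w) set" where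
  "lin_iso V W = {\<phi> \<in> iso (add_monoid V) (add_monoid W).
     \<forall>c. \<forall>v\<in>carrier V. \<phi> (c \<odot>\<^bsub>V\<^esub> v) = c \<odot>\<^bsub>W\<^esub> \<phi> v}"


section \<open>Hopf algebras, Yetter-Drinfeld modules, braided vector spaces\<close>

text \<open>The following records only collect the structure maps.\<close>

record (overloaded) ('k::field, 'a) hopf = "('k, 'a) module" +
  comult :: "'a \<Rightarrow> ('a \<times> 'a \<Rightarrow>\<^sub>0 'k) set"
  counit :: "'a \<Rightarrow> 'k"
  antipode :: "'a \<Rightarrow> 'a"

record ('k, 'a, 'v) lmod = "('k, 'v) module" +
  act :: "'a \<Rightarrow> 'v \<Rightarrow> 'v"

record (overloaded) ('k::field, 'a, 'v) yd = "('k, 'a, 'v) lmod" +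
  coact :: "'v \<Rightarrow> ('a \<times> 'v \<Rightarrow>\<^sub>0 'k) set"

record (overloaded) ('k::field, 'v) braided = "('k, 'v) module" +
  braid :: "('v \<times> 'v \<Rightarrow>\<^sub>0 'k) set \<Rightarrow> ('v \<times> 'v \<Rightarrow>\<^sub>0 'k) set"

text \<open>
  \<open>V \<boxtimes> A\<close>, with \<open>h \<cdot> (\<ell> \<boxtimes> g) = (h\<^sub>2 \<cdot> \<ell>) \<boxtimes> h\<^sub>1 g S(h\<^sub>3)\<close> and \<open>\<rho>(\<ell> \<boxtimes> g) = g\<^sub>1 \<otimes> (\<ell> \<boxtimes> g\<^sub>2)\<close>.  The iterated
  coproduct is read as \<open>h\<^sub>1 \<otimes> h\<^sub>2 \<otimes> h\<^sub>3 = (\<Delta> \<otimes> id)(\<Delta> h)\<close>; below, \<open>h12\<close> is the left leg of \<open>\<Delta> h\<close>.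
\<close>

definition boxtimes ::
    "('k::field, 'a, 'v, 'm) lmod_scheme \<Rightarrow> ('k, 'a, 'n) hopf_scheme
      \<Rightarrow> ('k, 'a, ('v \<times> 'a \<Rightarrow>\<^sub>0 'k) set) yd" where
  "boxtimes V A = (let T = tensor V A in
     module.extend T \<lparr>act = (\<lambda>h. tensor_lift T (\<lambda>l g.
        tensor_lift T (\<lambda>h12 h3.
          tensor_lift T (\<lambda>h1 h2.
              pure_tensor V A (act V h2 l) (h1 \<otimes>\<^bsub>A\<^esub> g \<otimes>\<^bsub>A\<^esub> antipode A h3))
            (comult A h12))
          (comult A h))),
      coact = tensor_lift (tensor A T) (\<lambda>l g.
        tensor_lift (tensor A T) (\<lambda>g1 g2. pure_tensor A T g1 (pure_tensor V A l g2)) (comult A g))\<rparr>)"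

text \<open>
  The Yetter-Drinfeld submodule of \<open>M\<close> on a stable subspace \<open>U\<close>.  As \<open>A \<otimes> U\<close> is not literally a
  subset of \<open>A \<otimes> M\<close>, the coaction is transported back along the canonical injection.
\<close>

definition yd_sub ::
    "('k::field, 'a, 'n) hopf_scheme \<Rightarrow> ('k, 'a, 'v, 'm) yd_scheme \<Rightarrow> 'v set
      \<Rightarrow> ('k, 'a, 'v, 'm) yd_scheme" where
  "yd_sub A M U = M\<lparr>carrier := U,
     coact := (\<lambda>u. THE t. t \<in> carrier (tensor A (M\<lparr>carrier := U\<rparr>)) \<and>
       tensor_lift (tensor A M) (pure_tensor A M) t = coact M u)\<rparr>"

text \<open>\<open>c(x \<otimes> y) = x\<^sub>-\<^sub>1 \<cdot> y \<otimes> x\<^sub>0\<close>\<close>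

definition yd_braided :: "('k::field, 'a, 'v, 'm) yd_scheme \<Rightarrow> ('k, 'v) braided" where
  "yd_braided M =
     module.extend (module.truncate M) \<lparr>braid = tensor_lift (tensor M M) (\<lambda>x y.
        tensor_lift (tensor M M) (\<lambda>a x0. pure_tensor M M (act M a y) x0) (coact M x))\<rparr>"

definition braided_isomorphic ::
    "('k::field, 'v, 'm) braided_scheme \<Rightarrow> ('k, 'w, 'n) braided_scheme \<Rightarrow> bool" where
  "braided_isomorphic V W \<longleftrightarrow> (\<exists>\<phi>\<in>lin_iso V W.
     let \<phi>\<phi> = tensor_lift (tensor W W) (\<lambda>x y. pure_tensor W W (\<phi> x) (\<phi> y))
     in \<forall>t\<in>carrier (tensor V V). \<phi>\<phi> (braid V t) = braid W (\<phi>\<phi> t))"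

datatype idx = I1 | I2

abbreviation basis :: "idx \<Rightarrow> (idx \<Rightarrow>\<^sub>0 'k::field)" where
  "basis i \<equiv> Poly_Mapping.single i 1"

definition V_abe :: "'k::field \<Rightarrow> 'k \<Rightarrow> 'k \<Rightarrow> ('k, idx \<Rightarrow>\<^sub>0 'k) braided" where
  "V_abe a b e = (let V = free_mod UNIV; T = tensor V V;
       c = (\<lambda>i j. case (i, j) of
              (I1, I1) \<Rightarrow> a \<odot>\<^bsub>T\<^esub> pure_tensor V V (basis I2) (basis I2)
            | (I1, I2) \<Rightarrow> b \<odot>\<^bsub>T\<^esub> pure_tensor V V (basis I1) (basis I2)
            | (I2, I1) \<Rightarrow> b \<odot>\<^bsub>T\<^esub> pure_tensor V V (basis I2) (basis I1)
            | (I2, I2) \<Rightarrow> e \<odot>\<^bsub>T\<^esub> pure_tensor V V (basis I1) (basis I1))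
     in module.extend V \<lparr>braid = tensor_lift T (\<lambda>x y. lin_ext T (\<lambda>i. lin_ext T (c i) y) x)\<rparr>)"

text \<open>
  The Nichols algebra of \<open>M\<close> is of type \<open>V\<^sub>a\<^sub>b\<^sub>e\<close>.  By definition this is a property of the braided
  vector space underlying \<open>M\<close>.
\<close>

definition nichols_of_type_V ::
    "('k::field, 'a, 'v, 'm) yd_scheme \<Rightarrow> 'k \<Rightarrow> 'k \<Rightarrow> 'k \<Rightarrow> bool" where
  "nichols_of_type_V M a b e \<longleftrightarrow> a \<noteq> 0 \<and> b \<noteq> 0 \<and> e \<noteq> 0 \<and>
     braided_isomorphic (yd_braided M) (V_abe a b e)"


section \<open>The Suzuki algebra\<close>

datatype word = Word (letters: "(idx \<times> idx) list")

instantiation word :: monoid_add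
begin
definition "0 = Word []"
definition "u + v = Word (letters u @ letters v)"
instance by standard (simp_all add: zero_word_def plus_word_def)
end

text \<open>The free algebra on the four letters \<open>x\<^sub>i\<^sub>j\<close>, as the monoid algebra of the words.\<close>

definition free_alg :: "('k::field, word \<Rightarrow>\<^sub>0 'k) module" where
  "free_alg = (free_mod UNIV)\<lparr>monoid.mult := (*), one := 1\<rparr>"

definition letter :: "idx \<Rightarrow> idx \<Rightarrow> (word \<Rightarrow>\<^sub>0 'k::field)" where
  "letter i j = Poly_Mapping.single (Word [(i, j)]) 1"

text \<open>The algebra homomorphism from the free algebra to \<open>R\<close> with \<open>x\<^sub>i\<^sub>j \<mapsto> gen i j\<close>.\<close>

definition alg_ext ::
    "('k::field, 'a, 'm) module_scheme \<Rightarrow> (idx \<Rightarrow> idx \<Rightarrow> 'a) \<Rightarrow> (word \<Rightarrow>\<^sub>0 'k) \<Rightarrow> 'a" where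
  "alg_ext R gen =
     lin_ext R (\<lambda>w. foldr (\<lambda>(i, j) r. gen i j \<otimes>\<^bsub>R\<^esub> r) (letters w) \<one>\<^bsub>R\<^esub>)"

fun idx_num :: "idx \<Rightarrow> nat" where "idx_num I1 = 1" | "idx_num I2 = 2"

fun other :: "idx \<Rightarrow> idx" where "other I1 = I2" | "other I2 = I1"

text \<open>The alternating products \<open>\<chi>\<^sub>i\<^sub>j\<^sup>m\<close> with \<open>m\<close> factors, starting with \<open>x\<^sub>i\<^sub>j\<close>.\<close>

fun chi :: "('a, 'm) monoid_scheme \<Rightarrow> (idx \<Rightarrow> idx \<Rightarrow> 'a) \<Rightarrow> idx \<Rightarrow> idx \<Rightarrow> nat \<Rightarrow> 'a" where
  "chi R gen i j 0 = \<one>\<^bsub>R\<^esub>"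
| "chi R gen i j (Suc m) = gen i j \<otimes>\<^bsub>R\<^esub> chi R gen (other i) (other j) m"

definition suzuki_relators ::
    "nat \<Rightarrow> nat \<Rightarrow> 'k::field \<Rightarrow> 'k \<Rightarrow> (word \<Rightarrow>\<^sub>0 'k) set" where
  "suzuki_relators N n mu lam = (let F = free_alg; x = letter in
     {x I1 I1 [^]\<^bsub>F\<^esub> (2::nat) \<ominus>\<^bsub>F\<^esub> x I2 I2 [^]\<^bsub>F\<^esub> (2::nat),
      x I1 I2 [^]\<^bsub>F\<^esub> (2::nat) \<ominus>\<^bsub>F\<^esub> x I2 I1 [^]\<^bsub>F\<^esub> (2::nat),
      chi F x I2 I1 (2 * n) \<ominus>\<^bsub>F\<^esub> lam \<odot>\<^bsub>F\<^esub> chi F x I1 I2 (2 * n),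
      chi F x I1 I1 (2 * n) \<ominus>\<^bsub>F\<^esub> chi F x I2 I2 (2 * n),
      (x I1 I1 [^]\<^bsub>F\<^esub> (2 * N) \<oplus>\<^bsub>F\<^esub> mu \<odot>\<^bsub>F\<^esub> x I1 I2 [^]\<^bsub>F\<^esub> (2 * N)) \<ominus>\<^bsub>F\<^esub> \<one>\<^bsub>F\<^esub>}
     \<union> {x i j \<otimes>\<^bsub>F\<^esub> x k l | i j k l. odd (idx_num i + idx_num j + idx_num k + idx_num l)})"

definition suzuki_ideal ::
    "nat \<Rightarrow> nat \<Rightarrow> 'k::field \<Rightarrow> 'k \<Rightarrow> (word \<Rightarrow>\<^sub>0 'k) set" where
  "suzuki_ideal N n mu lam = genideal free_alg (suzuki_relators N n mu lam)"

definition suzuki_alg ::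
    "nat \<Rightarrow> nat \<Rightarrow> 'k::field \<Rightarrow> 'k \<Rightarrow> ('k, (word \<Rightarrow>\<^sub>0 'k) set) module" where
  "suzuki_alg N n mu lam = quot_mod free_alg (suzuki_ideal N n mu lam)"

definition suzuki_x ::
    "nat \<Rightarrow> nat \<Rightarrow> 'k::field \<Rightarrow> 'k \<Rightarrow> idx \<Rightarrow> idx \<Rightarrow> (word \<Rightarrow>\<^sub>0 'k) set" where
  "suzuki_x N n mu lam i j = suzuki_ideal N n mu lam +>\<^bsub>free_alg\<^esub> letter i j"

definition scalar_alg :: "('k::field, 'k) module" where
  "scalar_alg = \<lparr>carrier = UNIV, monoid.mult = (*), monoid.one = 1, ring.zero = 0,
     ring.add = (+), module.smult = (*)\<rparr>"

text \<open>
  The comultiplication and the counit are the algebra homomorphisms, and the antipode is the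
  algebra antihomomorphism, with the prescribed values on generators.
\<close>

definition suzuki ::
    "nat \<Rightarrow> nat \<Rightarrow> 'k::field \<Rightarrow> 'k \<Rightarrow> ('k, (word \<Rightarrow>\<^sub>0 'k) set) hopf" where
  "suzuki N n mu lam = (let A = suzuki_alg N n mu lam; x = suzuki_x N n mu lam; T = tensor A A in
     module.extend A \<lparr>comult = (\<lambda>h. the_elem (alg_ext T (\<lambda>i j.
        pure_tensor A A (x i I1) (x I1 j) \<oplus>\<^bsub>T\<^esub> pure_tensor A A (x i I2) (x I2 j)) ` h)),
      counit = (\<lambda>h. the_elem (alg_ext scalar_alg (\<lambda>i j. if i = j then 1 else 0) ` h)),
      antipode = (\<lambda>h. the_elem (alg_ext (A\<lparr>monoid.mult := (\<lambda>a b. b \<otimes>\<^bsub>A\<^esub> a)\<rparr>)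
        (\<lambda>i j. x j i [^]\<^bsub>A\<^esub> (4 * N - 1)) ` h))\<rparr>)"


section \<open>The modules under consideration\<close>

definition primitive_root :: "nat \<Rightarrow> 'k::field \<Rightarrow> bool" where
  "primitive_root m w \<longleftrightarrow> 0 < m \<and> w ^ m = 1 \<and> (\<forall>l. 0 < l \<and> l < m \<longrightarrow> w ^ l \<noteq> 1)"

definition mubar :: "nat \<Rightarrow> 'k::field \<Rightarrow> 'k \<Rightarrow> 'k" where
  "mubar n mu \<omega> = (if mu = 1 then 1 else \<omega> ^ (4 * n))"

fun V'_gen ::
    "nat \<Rightarrow> nat \<Rightarrow> 'k::field \<Rightarrow> 'k \<Rightarrow> nat \<Rightarrow> nat \<Rightarrow> idx \<Rightarrow> idx \<Rightarrow> idx \<Rightarrow> (idx \<Rightarrow>\<^sub>0 'k)" where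
  "V'_gen N n mu \<omega> j k I1 I1 _ = 0"
| "V'_gen N n mu \<omega> j k I2 I2 _ = 0"
| "V'_gen N n mu \<omega> j k I2 I1 I1 = Poly_Mapping.single I2 (\<omega> ^ (2 * j * N))"
| "V'_gen N n mu \<omega> j k I2 I1 I2 =
     Poly_Mapping.single I1 (mubar n mu \<omega> * \<omega> powi (2 * (4 * int k * int n - int j * int N)))"
| "V'_gen N n mu \<omega> j k I1 I2 I1 = Poly_Mapping.single I2 1"
| "V'_gen N n mu \<omega> j k I1 I2 I2 = Poly_Mapping.single I1 (mubar n mu \<omega> * \<omega> ^ (8 * k * n))"

text \<open>
  \<open>V'\<^sub>j\<^sub>k\<close>; the action of an element of the Suzuki algebra, a coset of linear combinations of
  words, is obtained by letting the letters of a word act successively.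
\<close>

definition V'_module ::
    "nat \<Rightarrow> nat \<Rightarrow> 'k::field \<Rightarrow> 'k \<Rightarrow> nat \<Rightarrow> nat
      \<Rightarrow> ('k, (word \<Rightarrow>\<^sub>0 'k) set, idx \<Rightarrow>\<^sub>0 'k) lmod" where
  "V'_module N n mu \<omega> j k = (let V = free_mod UNIV in
     module.extend V \<lparr>act = (\<lambda>h v. the_elem (lin_ext V (\<lambda>w.
        foldr (\<lambda>(i, l). lin_ext V (V'_gen N n mu \<omega> j k i l)) (letters w) v) ` h))\<rparr>)"

definition H_w1 ::
    "nat \<Rightarrow> nat \<Rightarrow> 'k::field \<Rightarrow> 'k \<Rightarrow> 'k \<Rightarrow> 'k \<Rightarrow> nat \<Rightarrow> nat \<Rightarrow> nat \<Rightarrow> nat \<Rightarrow> nat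
      \<Rightarrow> ((idx \<Rightarrow>\<^sub>0 'k) \<times> (word \<Rightarrow>\<^sub>0 'k) set \<Rightarrow>\<^sub>0 'k) set" where
  "H_w1 N n mu lam \<omega> r j k p s t = (let A = suzuki N n mu lam; x = suzuki_x N n mu lam;
       V = V'_module N n mu \<omega> j k; M = boxtimes V A in
     pure_tensor V A (basis I1) (x I1 I1 [^]\<^bsub>A\<^esub> (2 * s) \<otimes>\<^bsub>A\<^esub> chi A x I2 I2 (2 * t + 1)) \<oplus>\<^bsub>M\<^esub>
     ((-1) ^ p * \<omega> powi (int j * int N - 4 * int k * int n) / r) \<odot>\<^bsub>M\<^esub>
       pure_tensor V A (basis I2) (x I1 I2 [^]\<^bsub>A\<^esub> (2 * s) \<otimes>\<^bsub>A\<^esub> chi A x I2 I1 (2 * t + 1)))"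

definition H_w2 ::
    "nat \<Rightarrow> nat \<Rightarrow> 'k::field \<Rightarrow> 'k \<Rightarrow> 'k \<Rightarrow> 'k \<Rightarrow> nat \<Rightarrow> nat \<Rightarrow> nat \<Rightarrow> nat \<Rightarrow> nat
      \<Rightarrow> ((idx \<Rightarrow>\<^sub>0 'k) \<times> (word \<Rightarrow>\<^sub>0 'k) set \<Rightarrow>\<^sub>0 'k) set" where
  "H_w2 N n mu lam \<omega> r j k p s t = (let A = suzuki N n mu lam; x = suzuki_x N n mu lam;
       V = V'_module N n mu \<omega> j k; M = boxtimes V A in
     pure_tensor V A (basis I2) (x I1 I1 [^]\<^bsub>A\<^esub> (2 * s + 1) \<otimes>\<^bsub>A\<^esub> chi A x I2 I2 (2 * t)) \<oplus>\<^bsub>M\<^esub>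
     ((-1) ^ p * r * \<omega> powi (4 * int k * int n - int j * int N)) \<odot>\<^bsub>M\<^esub>
       pure_tensor V A (basis I1) (x I1 I2 [^]\<^bsub>A\<^esub> (2 * s + 1) \<otimes>\<^bsub>A\<^esub> chi A x I2 I1 (2 * t)))"

text \<open>The argument \<open>r\<close> is the chosen square root of \<^const>\<open>mubar\<close>.\<close>

definition H_module ::
    "nat \<Rightarrow> nat \<Rightarrow> 'k::field \<Rightarrow> 'k \<Rightarrow> 'k \<Rightarrow> 'k \<Rightarrow> nat \<Rightarrow> nat \<Rightarrow> nat \<Rightarrow> nat \<Rightarrow> nat
      \<Rightarrow> ('k, (word \<Rightarrow>\<^sub>0 'k) set, ((idx \<Rightarrow>\<^sub>0 'k) \<times> (word \<Rightarrow>\<^sub>0 'k) set \<Rightarrow>\<^sub>0 'k) set) yd" where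
  "H_module N n mu lam \<omega> r j k p s t = (let A = suzuki N n mu lam;
       M = boxtimes (V'_module N n mu \<omega> j k) A in
     yd_sub A M {\<alpha> \<odot>\<^bsub>M\<^esub> H_w1 N n mu lam \<omega> r j k p s t \<oplus>\<^bsub>M\<^esub> \<beta> \<odot>\<^bsub>M\<^esub> H_w2 N n mu lam \<omega> r j k p s t
       | \<alpha> \<beta>. True})"

end

theory Submission
  imports Defs
begin

text \<open>
  Put \<open>g\<^sub>i\<^sub>j = x\<^sub>i\<^sub>j\<^bsup>2s\<^esup> \<chi>\<^sub>i\<^sub>j\<^bsup>2t+1\<^esup>\<close>.  These four elements satisfy \<open>\<Delta> g\<^sub>i\<^sub>j = \<Sum>\<^sub>a g\<^sub>i\<^sub>a \<otimes> g\<^sub>a\<^sub>j\<close>, and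
  \<open>w\<^sub>1 = v\<^sub>1 \<boxtimes> g\<^sub>2\<^sub>2 + c v\<^sub>2 \<boxtimes> g\<^sub>2\<^sub>1\<close>, \<open>w\<^sub>2 = v\<^sub>2 \<boxtimes> g\<^sub>1\<^sub>1 + d v\<^sub>1 \<boxtimes> g\<^sub>1\<^sub>2\<close> with \<open>c d = 1\<close>, whence
  \<open>\<rho>(w\<^sub>1) = g\<^sub>2\<^sub>2 \<otimes> w\<^sub>1 + c g\<^sub>2\<^sub>1 \<otimes> w\<^sub>2\<close> and \<open>\<rho>(w\<^sub>2) = g\<^sub>1\<^sub>1 \<otimes> w\<^sub>2 + d g\<^sub>1\<^sub>2 \<otimes> w\<^sub>1\<close>.  On the plane
  spanned by \<open>w\<^sub>1, w\<^sub>2\<close> the generators \<open>x\<^sub>1\<^sub>1, x\<^sub>2\<^sub>2\<close> act by zero, hence so do \<open>g\<^sub>1\<^sub>1, g\<^sub>2\<^sub>2\<close>, while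
  \<open>x\<^sub>1\<^sub>2, x\<^sub>2\<^sub>1\<close> interchange the two lines up to scalars.  So the braiding has the shape of
  \<open>V\<^sub>a\<^sub>b\<^sub>e\<close>, and \<open>a, b, e\<close> are read off from the action of \<open>g\<^sub>1\<^sub>2, g\<^sub>2\<^sub>1\<close>.  The counit maps
  \<open>V \<boxtimes> A\<close> to \<open>V\<close> and \<open>w\<^sub>i\<close> to \<open>v\<^sub>i\<close>; this gives the independence of \<open>w\<^sub>1, w\<^sub>2\<close> and a retraction onto
  their span.
\<close>

section \<open>Vector spaces and quotients\<close>

locale vspace = abelian_group V for V :: "('k::field, 'v, 'm) module_scheme" (structure) +
  assumes smult_closed [simp, intro]: "v \<in> carrier V \<Longrightarrow> c \<odot> v \<in> carrier V"
    and smult_add_left: "v \<in> carrier V \<Longrightarrow> (c + d) \<odot> v = c \<odot> v \<oplus> d \<odot> v"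
    and smult_add_right: "v \<in> carrier V \<Longrightarrow> w \<in> carrier V \<Longrightarrow> c \<odot> (v \<oplus> w) = c \<odot> v \<oplus> c \<odot> w"
    and smult_smult: "v \<in> carrier V \<Longrightarrow> c \<odot> (d \<odot> v) = (c * d) \<odot> v"
    and smult_one [simp]: "v \<in> carrier V \<Longrightarrow> 1 \<odot> v = v"
begin

lemma smult_zero_left [simp]: "v \<in> carrier V \<Longrightarrow> 0 \<odot> v = \<zero>"
  using smult_add_left[of v 0 0] by (metis add.r_cancel_one' smult_closed add_0)

lemma smult_zero_right [simp]: "c \<odot> \<zero> = \<zero>"
  using smult_add_right[of \<zero> \<zero> c] by (metis add.r_cancel_one' l_zero smult_closed zero_closed)

lemma smult_minus_one: "v \<in> carrier V \<Longrightarrow> (-1) \<odot> v = \<ominus> v"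
  using smult_add_left[of v "-1" 1] by (simp add: minus_equality)

end

abbreviation vsubspace where
  "vsubspace U V \<equiv> submodule U (ring_of_type_algebra :: 'k::field ring) (V :: ('k, 'v, 'm) module_scheme)"

context vspace
begin

lemma subspaceI:
  assumes "U \<subseteq> carrier V" "\<zero> \<in> U" "\<And>x y. x \<in> U \<Longrightarrow> y \<in> U \<Longrightarrow> x \<oplus> y \<in> U"
    and "\<And>c x. x \<in> U \<Longrightarrow> c \<odot> x \<in> U"
  shows "vsubspace U V"
proof -
  have inv: "\<ominus> x \<in> U" if "x \<in> U" for x
    using assms(1) assms(4)[OF that, of "-1"] that by (auto simp: smult_minus_one)
  show ?thesis
    using assms inv by unfold_locales (auto simp: a_inv_def)
qed

lemma subspace_vspace:
  assumes "vsubspace U V"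
  shows "vspace (V\<lparr>carrier := U\<rparr>)"
proof -
  interpret U: submodule U "ring_of_type_algebra :: 'k ring" V by fact
  have sub: "U \<subseteq> carrier V" using U.subset by simp
  have add: "x \<oplus> y \<in> U" if "x \<in> U" "y \<in> U" for x y using U.m_closed[of x y] that by simp
  have zero: "\<zero> \<in> U" using U.one_closed by simp
  have smult: "c \<odot> x \<in> U" if "x \<in> U" for c x
    using U.smult_closed[of c x] that by (simp add: ring_of_type_algebra_def)
  have grp: "abelian_group (V\<lparr>carrier := U\<rparr>)"
  proof (rule abelian_groupI)
    fix x assume "x \<in> carrier (V\<lparr>carrier := U\<rparr>)"
    hence x: "x \<in> U" by simp
    have xV: "x \<in> carrier V" using x sub by auto
    have "\<ominus> x \<in> U" using smult[OF x, of "-1"] by (simp add: smult_minus_one xV)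
    moreover have "\<ominus> x \<oplus> x = \<zero>" using xV by (rule l_neg)
    ultimately show "\<exists>y\<in>carrier (V\<lparr>carrier := U\<rparr>). y \<oplus>\<^bsub>V\<lparr>carrier := U\<rparr>\<^esub> x = \<zero>\<^bsub>V\<lparr>carrier := U\<rparr>\<^esub>"
      by auto
  qed (simp_all add: add zero subsetD[OF sub] a_ac)
  show ?thesis
    by (intro vspace.intro grp vspace_axioms.intro)
       (simp_all add: smult subsetD[OF sub] smult_add_left smult_add_right smult_smult)
qed

end

lemma vspace_cong:
  assumes "vspace V" "carrier W = carrier V" "\<zero>\<^bsub>W\<^esub> = \<zero>\<^bsub>V\<^esub>" "(\<oplus>\<^bsub>W\<^esub>) = (\<oplus>\<^bsub>V\<^esub>)" "(\<odot>\<^bsub>W\<^esub>) = (\<odot>\<^bsub>V\<^esub>)"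
  shows "vspace W"
proof -
  interpret V: vspace V by fact
  have "abelian_group W"
  proof (rule abelian_groupI)
    fix v assume "v \<in> carrier W"
    thus "\<exists>y\<in>carrier W. y \<oplus>\<^bsub>W\<^esub> v = \<zero>\<^bsub>W\<^esub>"
      using assms(2-) V.l_neg[of v] by (intro bexI[of _ "\<ominus>\<^bsub>V\<^esub> v"]) simp_all
  qed (simp_all add: assms(2-) V.a_ac)
  thus ?thesis
    by (intro vspace.intro vspace_axioms.intro)
       (simp_all add: assms(2-) V.smult_add_left V.smult_add_right V.smult_smult)
qed

definition linear_on ::
    "('k::field, 'v, 'm) module_scheme \<Rightarrow> ('k, 'w, 'n) module_scheme \<Rightarrow> ('v \<Rightarrow> 'w) \<Rightarrow> bool" where
  "linear_on V W F \<longleftrightarrow> F \<in> carrier V \<rightarrow> carrier W \<and>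
     (\<forall>x\<in>carrier V. \<forall>y\<in>carrier V. F (x \<oplus>\<^bsub>V\<^esub> y) = F x \<oplus>\<^bsub>W\<^esub> F y) \<and>
     (\<forall>c. \<forall>x\<in>carrier V. F (c \<odot>\<^bsub>V\<^esub> x) = c \<odot>\<^bsub>W\<^esub> F x)"

definition bilinear_on ::
    "('k::field, 'v, 'm) module_scheme \<Rightarrow> ('k, 'w, 'n) module_scheme \<Rightarrow> ('k, 'u, 'l) module_scheme
      \<Rightarrow> ('v \<Rightarrow> 'w \<Rightarrow> 'u) \<Rightarrow> bool" where
  "bilinear_on V W U B \<longleftrightarrow> (\<forall>x\<in>carrier V. linear_on W U (B x)) \<and>
     (\<forall>y\<in>carrier W. linear_on V U (\<lambda>x. B x y))"

lemma linear_onI: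
  assumes "\<And>x. x \<in> carrier V \<Longrightarrow> F x \<in> carrier W"
    and "\<And>x y. x \<in> carrier V \<Longrightarrow> y \<in> carrier V \<Longrightarrow> F (x \<oplus>\<^bsub>V\<^esub> y) = F x \<oplus>\<^bsub>W\<^esub> F y"
    and "\<And>c x. x \<in> carrier V \<Longrightarrow> F (c \<odot>\<^bsub>V\<^esub> x) = c \<odot>\<^bsub>W\<^esub> F x"
  shows "linear_on V W F"
  using assms by (auto simp: linear_on_def)

lemma
  assumes "linear_on V W F"
  shows linear_on_closed: "x \<in> carrier V \<Longrightarrow> F x \<in> carrier W"
    and linear_on_add: "x \<in> carrier V \<Longrightarrow> y \<in> carrier V \<Longrightarrow> F (x \<oplus>\<^bsub>V\<^esub> y) = F x \<oplus>\<^bsub>W\<^esub> F y"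
    and linear_on_smult: "x \<in> carrier V \<Longrightarrow> F (c \<odot>\<^bsub>V\<^esub> x) = c \<odot>\<^bsub>W\<^esub> F x"
  using assms by (auto simp: linear_on_def)

lemma linear_on_zero:
  assumes "linear_on V W F" "vspace V" "vspace W"
  shows "F \<zero>\<^bsub>V\<^esub> = \<zero>\<^bsub>W\<^esub>"
proof -
  interpret V: vspace V by fact
  interpret W: vspace W by fact
  show ?thesis
    using linear_on_smult[OF assms(1) V.zero_closed, of 0] linear_on_closed[OF assms(1) V.zero_closed] by simp
qed

lemma linear_on_minus:
  assumes "linear_on V W F" "vspace V" "vspace W" "x \<in> carrier V"
  shows "F (\<ominus>\<^bsub>V\<^esub> x) = \<ominus>\<^bsub>W\<^esub> F x"
proof -
  interpret V: vspace V by fact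
  interpret W: vspace W by fact
  show ?thesis
    using linear_on_smult[OF assms(1,4), of "-1"] linear_on_closed[OF assms(1,4)] assms(4)
    by (simp add: V.smult_minus_one W.smult_minus_one)
qed

lemma linear_on_comp:
  "linear_on V W F \<Longrightarrow> linear_on W U G \<Longrightarrow> linear_on V U (\<lambda>x. G (F x))"
  by (auto simp: linear_on_def Pi_iff)

lemma linear_on_addI:
  assumes "linear_on V W F" "linear_on V W G" "vspace W"
  shows "linear_on V W (\<lambda>x. F x \<oplus>\<^bsub>W\<^esub> G x)"
proof -
  interpret W: vspace W by fact
  show ?thesis
    using assms by (auto simp: linear_on_def Pi_iff W.smult_add_right W.a_ac)
qed

lemma linear_on_smultI:
  assumes "linear_on V W F" "vspace W"
  shows "linear_on V W (\<lambda>x. c \<odot>\<^bsub>W\<^esub> F x)"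
proof -
  interpret W: vspace W by fact
  show ?thesis
    using assms by (auto simp: linear_on_def Pi_iff W.smult_add_right W.smult_smult mult.commute)
qed

lemma bilinear_onI:
  assumes "\<And>x. x \<in> carrier V \<Longrightarrow> linear_on W U (B x)"
    and "\<And>y. y \<in> carrier W \<Longrightarrow> linear_on V U (\<lambda>x. B x y)"
  shows "bilinear_on V W U B"
  using assms by (auto simp: bilinear_on_def)

lemma
  assumes "bilinear_on V W U B"
  shows bilinear_on_right: "x \<in> carrier V \<Longrightarrow> linear_on W U (B x)"
    and bilinear_on_left: "y \<in> carrier W \<Longrightarrow> linear_on V U (\<lambda>x. B x y)"
  using assms by (auto simp: bilinear_on_def)

lemma bilinear_on_comp:
  assumes "bilinear_on V W U B" "linear_on V' V F" "linear_on W' W G"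
  shows "bilinear_on V' W' U (\<lambda>x y. B (F x) (G y))"
  by (intro bilinear_onI linear_on_comp[OF assms(3)] linear_on_comp[OF assms(2)]
      bilinear_on_right[OF assms(1)] bilinear_on_left[OF assms(1)] linear_on_closed[OF assms(2)]
      linear_on_closed[OF assms(3)])

lemma bilinear_on_linear_comp:
  assumes "bilinear_on V W U B" "linear_on U Z G"
  shows "bilinear_on V W Z (\<lambda>x y. G (B x y))"
  by (intro bilinear_onI linear_on_comp[OF _ assms(2)] bilinear_on_right[OF assms(1)]
      bilinear_on_left[OF assms(1)])

locale subspace_of = vspace V for U and V :: "('k::field, 'v, 'm) module_scheme" (structure) +
  assumes vsubspace_U: "vsubspace U V"
begin

interpretation U: submodule U "ring_of_type_algebra :: 'k ring" V by (rule vsubspace_U)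

lemma U_sub: "U \<subseteq> carrier V" using U.subset by simp

lemma U_carrier [intro, simp]: "x \<in> U \<Longrightarrow> x \<in> carrier V" using U_sub by auto

lemma U_add: "x \<in> U \<Longrightarrow> y \<in> U \<Longrightarrow> x \<oplus> y \<in> U" using U.m_closed[of x y] by simp

lemma U_zero [simp]: "\<zero> \<in> U" using U.one_closed by simp

lemma U_smult: "x \<in> U \<Longrightarrow> c \<odot> x \<in> U"
  using U.smult_closed[of c x] by (simp add: ring_of_type_algebra_def)

lemma abelian_subgroup_U: "abelian_subgroup U V"
  by (intro abelian_subgroupI3 additive_subgroup.intro U.subgroup_axioms abelian_group_axioms)

sublocale S: abelian_subgroup U V by (rule abelian_subgroup_U)

lemma coset_eq_iff:
  assumes "x \<in> carrier V" "y \<in> carrier V"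
  shows "U +> x = U +> y \<longleftrightarrow> x \<ominus> y \<in> U"
proof
  assume "U +> x = U +> y"
  hence "x \<in> U +> y" using S.a_rcos_self assms(1) by auto
  then obtain u where "u \<in> U" "x = u \<oplus> y" by (auto simp: a_r_coset_def')
  thus "x \<ominus> y \<in> U" using assms
    by (simp add: minus_eq a_assoc r_neg)
next
  assume *: "x \<ominus> y \<in> U"
  have "x = (x \<ominus> y) \<oplus> y" using assms by (simp add: minus_eq a_assoc l_neg)
  hence "x \<in> U +> y" using * by (auto simp: a_r_coset_def')
  thus "U +> x = U +> y" using a_repr_independence[of x U y] assms S.a_subgroup by auto
qed

lemma quot_carrier: "carrier (quot_mod V U) = (\<lambda>x. U +> x) ` carrier V"
  by (auto simp: quot_mod_def FactRing_def A_RCOSETS_def')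

lemma quot_zero: "\<zero>\<^bsub>quot_mod V U\<^esub> = U +> \<zero>"
  by (simp add: quot_mod_def FactRing_def U_sub)

lemma quot_add:
  "x \<in> carrier V \<Longrightarrow> y \<in> carrier V \<Longrightarrow> (U +> x) \<oplus>\<^bsub>quot_mod V U\<^esub> (U +> y) = U +> (x \<oplus> y)"
  by (simp add: quot_mod_def FactRing_def S.a_rcos_sum)

lemma quot_smult:
  assumes "x \<in> carrier V"
  shows "c \<odot>\<^bsub>quot_mod V U\<^esub> (U +> x) = U +> (c \<odot> x)"
proof -
  have *: "U +> (c \<odot> y) = U +> (c \<odot> x)" if "y \<in> U +> x" for y
  proof -
    obtain u where u: "u \<in> U" "y = u \<oplus> x" using \<open>y \<in> U +> x\<close> by (auto simp: a_r_coset_def')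
    have "(c \<odot> y) \<ominus> (c \<odot> x) = c \<odot> u"
      using u assms by (simp add: smult_add_right minus_eq a_assoc r_neg)
    thus ?thesis using u assms by (subst coset_eq_iff) (auto simp: U_smult)
  qed
  have "x \<in> U +> x" using assms S.a_rcos_self by auto
  hence "(\<Union>y\<in>U +> x. U +> (c \<odot> y)) = U +> (c \<odot> x)" using * by blast
  thus ?thesis by (simp add: quot_mod_def)
qed

lemma quot_vspace: "vspace (quot_mod V U)"
proof -
  let ?Q = "quot_mod V U"
  note q = quot_carrier quot_zero quot_add quot_smult
  have grp: "abelian_group ?Q"
  proof (rule abelian_groupI)
    fix x assume "x \<in> carrier ?Q"
    then obtain v where v: "v \<in> carrier V" "x = U +> v" by (auto simp: q)
    show "\<exists>y\<in>carrier ?Q. y \<oplus>\<^bsub>?Q\<^esub> x = \<zero>\<^bsub>?Q\<^esub>"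
      using v by (intro bexI[of _ "U +> (\<ominus> v)"]) (auto simp: q l_neg)
  qed (auto simp: q a_ac)
  show ?thesis
    by (intro vspace.intro grp vspace_axioms.intro)
       (auto simp: q smult_add_left smult_add_right smult_smult)
qed

lemma quot_linear: "linear_on V (quot_mod V U) (\<lambda>x. U +> x)"
  by (rule linear_onI) (auto simp: quot_carrier quot_add quot_smult)

lemma quot_mult:
  assumes bil: "bilinear_on V V V (\<otimes>)"
    and I: "\<And>u x. u \<in> U \<Longrightarrow> x \<in> carrier V \<Longrightarrow> u \<otimes> x \<in> U \<and> x \<otimes> u \<in> U"
    and x: "x \<in> carrier V" and y: "y \<in> carrier V"
  shows "(U +> x) \<otimes>\<^bsub>quot_mod V U\<^esub> (U +> y) = U +> (x \<otimes> y)"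
proof -
  note bl = bilinear_on_left[OF bil] and br = bilinear_on_right[OF bil]
  have cl: "a \<otimes> b \<in> carrier V" if "a \<in> carrier V" "b \<in> carrier V" for a b
    using linear_on_closed[OF br] that by blast
  have *: "U +> (a \<otimes> b) = U +> (x \<otimes> y)" if "a \<in> U +> x" "b \<in> U +> y" for a b
  proof -
    obtain u where u: "u \<in> U" "a = u \<oplus> x" using \<open>a \<in> U +> x\<close> by (auto simp: a_r_coset_def')
    obtain v where v: "v \<in> U" "b = v \<oplus> y" using \<open>b \<in> U +> y\<close> by (auto simp: a_r_coset_def')
    have car: "u \<in> carrier V" "v \<in> carrier V" using u v by auto
    have b: "b \<in> carrier V" using v y by auto
    have "a \<otimes> b = u \<otimes> b \<oplus> x \<otimes> b" using linear_on_add[OF bl[OF b], of u x] car x u by simp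
    also have "x \<otimes> b = x \<otimes> v \<oplus> x \<otimes> y" using linear_on_add[OF br[OF x], of v y] car y v by simp
    finally have e: "a \<otimes> b = (u \<otimes> b \<oplus> x \<otimes> v) \<oplus> x \<otimes> y" using cl b car x y by (simp add: a_assoc)
    have "u \<otimes> b \<oplus> x \<otimes> v \<in> U" using I u v x b U_add by auto
    hence "a \<otimes> b \<in> U +> (x \<otimes> y)" unfolding e by (auto simp: a_r_coset_def')
    thus ?thesis using a_repr_independence[of "a \<otimes> b" U "x \<otimes> y"] cl x y S.a_subgroup by auto
  qed
  have "x \<in> U +> x" "y \<in> U +> y" using x y S.a_rcos_self by auto
  hence "(\<Union>a\<in>U +> x. \<Union>b\<in>U +> y. U +> (a \<otimes> b)) = U +> (x \<otimes> y)" using * by blast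
  thus ?thesis by (simp add: quot_mod_def FactRing_def rcoset_mult_def)
qed

lemma quot_one: "\<one>\<^bsub>quot_mod V U\<^esub> = U +> \<one>"
  by (simp add: quot_mod_def FactRing_def)

text \<open>This is why \<^const>\<open>the_elem\<close> is meaningful in the definitions: a linear map that vanishes on
  \<open>U\<close> is constant on each coset.\<close>

lemma image_coset:
  assumes "linear_on V W F" "vspace W" "\<And>u. u \<in> U \<Longrightarrow> F u = \<zero>\<^bsub>W\<^esub>" "x \<in> carrier V"
  shows "the_elem (F ` (U +> x)) = F x"
proof -
  interpret W: vspace W by fact
  have "F y = F x" if "y \<in> U +> x" for y
  proof -
    obtain u where "u \<in> U" "y = u \<oplus> x" using \<open>y \<in> U +> x\<close> by (auto simp: a_r_coset_def')
    thus ?thesis using assms by (auto simp: linear_on_add linear_on_closed)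
  qed
  moreover have "x \<in> U +> x" using assms S.a_rcos_self by auto
  ultimately have "F ` (U +> x) = {F x}" by blast
  thus ?thesis by simp
qed

end

section \<open>Free vector spaces\<close>

lemma lookup_map_times: "Poly_Mapping.lookup (Poly_Mapping.map ((*) (c::'k::field)) f) x = c * Poly_Mapping.lookup f x"
  by (simp add: map.rep_eq when_def)

lemma keys_map_times: "Poly_Mapping.keys (Poly_Mapping.map ((*) (c::'k::field)) f) \<subseteq> Poly_Mapping.keys f"
  by (auto simp: in_keys_iff lookup_map_times)

lemma free_mod_simps [simp]:
  "carrier (free_mod S) = {f. Poly_Mapping.keys f \<subseteq> S}"
  "\<zero>\<^bsub>free_mod S\<^esub> = 0"
  "f \<oplus>\<^bsub>free_mod S\<^esub> g = f + g"
  "c \<odot>\<^bsub>free_mod S\<^esub> f = Poly_Mapping.map ((*) c) f"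
  by (simp_all add: free_mod_def)

lemma keys_single_subset [simp]: "x \<in> S \<Longrightarrow> Poly_Mapping.keys (Poly_Mapping.single x c) \<subseteq> S"
  by simp

lemma keys_add_subset: "Poly_Mapping.keys f \<subseteq> S \<Longrightarrow> Poly_Mapping.keys g \<subseteq> S \<Longrightarrow> Poly_Mapping.keys (f + g) \<subseteq> S"
  using keys_add[of f g] by blast

lemma keys_diff_subset:
  "Poly_Mapping.keys f \<subseteq> S \<Longrightarrow> Poly_Mapping.keys (g :: 'x \<Rightarrow>\<^sub>0 'k::field) \<subseteq> S \<Longrightarrow> Poly_Mapping.keys (f - g) \<subseteq> S"
proof
  fix x assume "Poly_Mapping.keys f \<subseteq> S" "Poly_Mapping.keys g \<subseteq> S" "x \<in> Poly_Mapping.keys (f - g)"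
  moreover from this(3) have "Poly_Mapping.lookup f x \<noteq> 0 \<or> Poly_Mapping.lookup g x \<noteq> 0"
    by (auto simp: in_keys_iff lookup_minus)
  ultimately show "x \<in> S" by (metis in_keys_iff subsetD)
qed

lemma free_mod_vspace: "vspace (free_mod S)"
proof -
  have "abelian_group (free_mod S :: ('b, 'a \<Rightarrow>\<^sub>0 'b) module)"
  proof (rule abelian_groupI)
    fix f :: "'a \<Rightarrow>\<^sub>0 'b" assume "f \<in> carrier (free_mod S)"
    thus "\<exists>y\<in>carrier (free_mod S). y \<oplus>\<^bsub>free_mod S\<^esub> f = \<zero>\<^bsub>free_mod S\<^esub>"
      by (intro bexI[of _ "- f"]) auto
  qed (auto simp: add_ac keys_add_subset)
  thus ?thesis
    by (intro vspace.intro vspace_axioms.intro)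
       (auto simp: subset_iff in_keys_iff lookup_map_times lookup_add algebra_simps
             intro!: poly_mapping_eqI)
qed

lemma poly_mapping_induct [consumes 1, case_names zero single add]:
  assumes "Poly_Mapping.keys f \<subseteq> S" "P 0"
    and single: "\<And>x c. x \<in> S \<Longrightarrow> P (Poly_Mapping.single x c)"
    and add: "\<And>f g. Poly_Mapping.keys f \<subseteq> S \<Longrightarrow> Poly_Mapping.keys g \<subseteq> S \<Longrightarrow> P f \<Longrightarrow> P g \<Longrightarrow> P (f + g)"
  shows "P f"
  using assms(1)
proof (induction f rule: update_induct)
  case const
  show ?case by fact
next
  case (update f a b)
  have eq: "Poly_Mapping.update a b f = Poly_Mapping.single a b + f"
    using update(1) by (intro poly_mapping_eqI) (auto simp: lookup_update lookup_add lookup_single in_keys_iff when_def)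
  have a: "a \<in> S" "Poly_Mapping.keys f \<subseteq> S"
    using update(1,2,4) by (auto simp: keys_update split: if_splits)
  show ?case unfolding eq by (intro add single update.IH a) (use a in auto)
qed

context vspace
begin

lemma lin_ext_superset:
  assumes "finite T" "Poly_Mapping.keys f \<subseteq> T" "\<phi> \<in> T \<rightarrow> carrier V"
  shows "lin_ext V \<phi> f = (\<Oplus>x\<in>T. Poly_Mapping.lookup f x \<odot> \<phi> x)"
  unfolding lin_ext_def
  using assms by (intro add.finprod_mono_neutral_cong_left) (auto simp: Pi_iff in_keys_iff)

lemma lin_ext_zero [simp]: "lin_ext V \<phi> 0 = \<zero>"
  by (simp add: lin_ext_def)

lemma lin_ext_single [simp]:
  assumes "\<phi> x \<in> carrier V"
  shows "lin_ext V \<phi> (Poly_Mapping.single x c) = c \<odot> \<phi> x"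
  using assms lin_ext_superset[of "{x}" "Poly_Mapping.single x c" \<phi>] by simp

lemma lin_ext_linear:
  fixes S :: "'x set"
  assumes \<phi>: "\<And>x. x \<in> S \<Longrightarrow> \<phi> x \<in> carrier V"
  shows "linear_on (free_mod S) V (lin_ext V \<phi>)"
proof (rule linear_onI)
  fix f :: "'x \<Rightarrow>\<^sub>0 'k" assume "f \<in> carrier (free_mod S)"
  hence f: "Poly_Mapping.keys f \<subseteq> S" by simp
  show "lin_ext V \<phi> f \<in> carrier V"
    unfolding lin_ext_def using f \<phi> by (intro finsum_closed) auto
next
  fix f g :: "'x \<Rightarrow>\<^sub>0 'k" assume "f \<in> carrier (free_mod S)" "g \<in> carrier (free_mod S)"
  hence fg: "Poly_Mapping.keys f \<subseteq> S" "Poly_Mapping.keys g \<subseteq> S" by auto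
  let ?T = "Poly_Mapping.keys f \<union> Poly_Mapping.keys g"
  have \<phi>': "\<phi> \<in> ?T \<rightarrow> carrier V" using fg \<phi> by auto
  have "lin_ext V \<phi> (f + g) = (\<Oplus>x\<in>?T. Poly_Mapping.lookup (f + g) x \<odot> \<phi> x)"
    by (rule lin_ext_superset[OF _ keys_add \<phi>']) simp
  also have "\<dots> = (\<Oplus>x\<in>?T. Poly_Mapping.lookup f x \<odot> \<phi> x \<oplus> Poly_Mapping.lookup g x \<odot> \<phi> x)"
    using \<phi>' by (intro finsum_cong') (auto simp: lookup_add smult_add_left Pi_iff)
  also have "\<dots> = (\<Oplus>x\<in>?T. Poly_Mapping.lookup f x \<odot> \<phi> x) \<oplus> (\<Oplus>x\<in>?T. Poly_Mapping.lookup g x \<odot> \<phi> x)"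
    using \<phi>' by (intro finsum_addf) (auto simp: Pi_iff)
  also have "\<dots> = lin_ext V \<phi> f \<oplus> lin_ext V \<phi> g"
    using lin_ext_superset[of ?T f \<phi>] lin_ext_superset[of ?T g \<phi>] \<phi>' by simp
  finally show "lin_ext V \<phi> (f \<oplus>\<^bsub>free_mod S\<^esub> g) = lin_ext V \<phi> f \<oplus> lin_ext V \<phi> g" by simp
next
  fix c and f :: "'x \<Rightarrow>\<^sub>0 'k" assume "f \<in> carrier (free_mod S)"
  hence f: "Poly_Mapping.keys f \<subseteq> S" by simp
  let ?T = "Poly_Mapping.keys f"
  have \<phi>': "\<phi> \<in> ?T \<rightarrow> carrier V" using f \<phi> by auto
  have lin: "c \<odot> (\<Oplus>x\<in>A. Poly_Mapping.lookup f x \<odot> \<phi> x) = (\<Oplus>x\<in>A. c \<odot> (Poly_Mapping.lookup f x \<odot> \<phi> x))"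
    if "finite A" "A \<subseteq> ?T" for A
    using that
  proof (induction A)
    case (insert x A)
    have car: "Poly_Mapping.lookup f y \<odot> \<phi> y \<in> carrier V" if "y \<in> ?T" for y
      using \<phi>' that by (auto simp: Pi_iff)
    hence "(\<lambda>y. Poly_Mapping.lookup f y \<odot> \<phi> y) \<in> A \<rightarrow> carrier V" "Poly_Mapping.lookup f x \<odot> \<phi> x \<in> carrier V"
      using insert.prems by auto
    thus ?case using insert
      by (simp add: smult_add_right Pi_iff)
  qed simp
  have "lin_ext V \<phi> (Poly_Mapping.map ((*) c) f) = (\<Oplus>x\<in>?T. Poly_Mapping.lookup (Poly_Mapping.map ((*) c) f) x \<odot> \<phi> x)"
    by (rule lin_ext_superset[OF _ keys_map_times \<phi>']) simp
  also have "\<dots> = (\<Oplus>x\<in>?T. c \<odot> (Poly_Mapping.lookup f x \<odot> \<phi> x))"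
    using \<phi>' by (intro finsum_cong') (auto simp: lookup_map_times smult_smult Pi_iff)
  also have "\<dots> = c \<odot> lin_ext V \<phi> f" unfolding lin_ext_def using lin[of ?T] by simp
  finally show "lin_ext V \<phi> (c \<odot>\<^bsub>free_mod S\<^esub> f) = c \<odot> lin_ext V \<phi> f" by simp
qed

lemma linear_free_unique:
  assumes "linear_on (free_mod S) V F" "linear_on (free_mod S) V G"
    and "\<And>x. x \<in> S \<Longrightarrow> F (Poly_Mapping.single x 1) = G (Poly_Mapping.single x 1)"
    and "Poly_Mapping.keys f \<subseteq> S"
  shows "F f = G f"
  using assms(4)
proof (induction f rule: poly_mapping_induct)
  case zero
  show ?case
    using linear_on_zero[OF assms(1) free_mod_vspace vspace_axioms]
      linear_on_zero[OF assms(2) free_mod_vspace vspace_axioms] by simp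
next
  case (single x c)
  have "Poly_Mapping.single x c = c \<odot>\<^bsub>free_mod S\<^esub> Poly_Mapping.single x 1" by simp
  thus ?case
    using linear_on_smult[OF assms(1), of "Poly_Mapping.single x 1" c] linear_on_smult[OF assms(2), of "Poly_Mapping.single x 1" c]
      assms(3)[OF single] single by simp
next
  case (add f g)
  thus ?case using linear_on_add[OF assms(1), of f g] linear_on_add[OF assms(2), of f g] by simp
qed

end

section \<open>Tensor products\<close>

lemma (in vspace) kernel_vsubspace:
  assumes "linear_on V W F" "vspace W"
  shows "vsubspace {x \<in> carrier V. F x = \<zero>\<^bsub>W\<^esub>} V"
proof -
  interpret W: vspace W by fact
  show ?thesis
    by (rule subspaceI)
       (auto simp: linear_on_add[OF assms(1)] linear_on_smult[OF assms(1)]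
         linear_on_zero[OF assms(1) vspace_axioms assms(2)])
qed

lemma (in vspace) gen_submodule_vsubspace:
  assumes "S \<subseteq> carrier V"
  shows "vsubspace (gen_submodule V S) V"
proof (rule subspaceI)
  have "vsubspace (carrier V) V" by (rule subspaceI) auto
  thus "gen_submodule V S \<subseteq> carrier V" using assms by (auto simp: gen_submodule_def)
next
  have so: "subspace_of U V" if "vsubspace U V" for U
    using that by (intro subspace_of.intro vspace_axioms subspace_of_axioms.intro)
  show "\<zero> \<in> gen_submodule V S"
    unfolding gen_submodule_def using subspace_of.U_zero[OF so] by blast
  show "x \<oplus> y \<in> gen_submodule V S" if "x \<in> gen_submodule V S" "y \<in> gen_submodule V S" for x y
    using that unfolding gen_submodule_def using subspace_of.U_add[OF so] by blast
  show "c \<odot> x \<in> gen_submodule V S" if "x \<in> gen_submodule V S" for c x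
    using that unfolding gen_submodule_def using subspace_of.U_smult[OF so] by blast
qed

lemma gen_submodule_base: "S \<subseteq> gen_submodule V S"
  by (auto simp: gen_submodule_def)

lemma gen_submodule_least: "vsubspace U V \<Longrightarrow> S \<subseteq> U \<Longrightarrow> gen_submodule V S \<subseteq> U"
  by (auto simp: gen_submodule_def)

lemma formal_tensors_simps [simp]:
  "carrier (formal_tensors V W) = {f. Poly_Mapping.keys f \<subseteq> carrier V \<times> carrier W}"
  "\<zero>\<^bsub>formal_tensors V W\<^esub> = 0"
  "f \<oplus>\<^bsub>formal_tensors V W\<^esub> g = f + g"
  "c \<odot>\<^bsub>formal_tensors V W\<^esub> f = Poly_Mapping.map ((*) c) f"
  "\<one>\<^bsub>formal_tensors V W\<^esub> = Poly_Mapping.single (\<one>\<^bsub>V\<^esub>, \<one>\<^bsub>W\<^esub>) 1"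
  by (simp_all add: formal_tensors_def)

lemma linear_on_formal_tensors:
  "linear_on (formal_tensors V W) U F \<longleftrightarrow> linear_on (free_mod (carrier V \<times> carrier W)) U F"
  by (simp add: linear_on_def)

lemma formal_tensors_vspace:
  fixes V :: "('k::field, 'v, 'm) module_scheme" and W :: "('k, 'w, 'n) module_scheme"
  shows "vspace (formal_tensors V W)"
  by (rule vspace_cong[OF free_mod_vspace[of "carrier V \<times> carrier W"]]) (auto simp: fun_eq_iff)

locale vspace_pair = V: vspace V + W: vspace W
  for V :: "('k::field, 'v, 'm) module_scheme" and W :: "('k, 'w, 'n) module_scheme"
begin

abbreviation "F \<equiv> formal_tensors V W"
abbreviation "T \<equiv> tensor V W"
abbreviation "N \<equiv> tensor_null V W"
abbreviation "pt \<equiv> pure_tensor V W"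
abbreviation "VW \<equiv> carrier V \<times> carrier W"
abbreviation "cls f \<equiv> N +>\<^bsub>F\<^esub> f"

sublocale F: vspace F by (rule formal_tensors_vspace)

lemma relators_carrier: "tensor_relators V W \<subseteq> carrier F"
  unfolding tensor_relators_def formal_tensors_simps
  by (intro Un_least subsetI; elim CollectE exE conjE; hypsubst;
      intro CollectI keys_diff_subset keys_single_subset; simp)

sublocale S: subspace_of N F
  unfolding tensor_null_def
  by (intro subspace_of.intro F.vspace_axioms subspace_of_axioms.intro
      F.gen_submodule_vsubspace[OF relators_carrier])

lemma relators_null: "tensor_relators V W \<subseteq> N"
  unfolding tensor_null_def by (rule gen_submodule_base)

lemma null_least:
  assumes "vsubspace U F" "tensor_relators V W \<subseteq> U"
  shows "N \<subseteq> U"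
  unfolding tensor_null_def by (rule gen_submodule_least[OF assms])

lemma tensor_vspace: "vspace T"
  unfolding tensor_def by (rule S.quot_vspace)

sublocale T: vspace T by (rule tensor_vspace)

lemma coset_linear: "linear_on F T cls"
  unfolding tensor_def by (rule S.quot_linear)

lemma tensor_carrier: "carrier T = cls ` carrier F"
  unfolding tensor_def by (rule S.quot_carrier)

lemma coset_eqI:
  "Poly_Mapping.keys f \<subseteq> VW \<Longrightarrow> Poly_Mapping.keys g \<subseteq> VW
    \<Longrightarrow> f - g \<in> N \<Longrightarrow> cls f = cls g"
proof -
  assume *: "Poly_Mapping.keys f \<subseteq> VW" "Poly_Mapping.keys g \<subseteq> VW" "f - g \<in> N"
  have "\<ominus>\<^bsub>F\<^esub> g = - g"
    using * by (intro F.minus_equality) auto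
  thus ?thesis using * by (subst S.coset_eq_iff) (simp_all add: F.minus_eq)
qed

lemma coset_add:
  "Poly_Mapping.keys f \<subseteq> VW \<Longrightarrow> Poly_Mapping.keys g \<subseteq> VW
    \<Longrightarrow> cls (f + g) = (cls f) \<oplus>\<^bsub>T\<^esub> (cls g)"
  using linear_on_add[OF coset_linear, of f g] by simp

lemma coset_single:
  "v \<in> carrier V \<Longrightarrow> w \<in> carrier W \<Longrightarrow> cls (Poly_Mapping.single (v, w) c) = c \<odot>\<^bsub>T\<^esub> pt v w"
  using linear_on_smult[OF coset_linear, of "Poly_Mapping.single (v, w) 1" c]
  by (simp add: pure_tensor_def)

lemma pt_closed [simp, intro]: "v \<in> carrier V \<Longrightarrow> w \<in> carrier W \<Longrightarrow> pt v w \<in> carrier T"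
  by (auto simp: pure_tensor_def tensor_carrier)

lemma pt_bilinear: "bilinear_on V W T pt"
proof (intro bilinear_onI linear_onI)
  fix v w w' assume *: "v \<in> carrier V" "w \<in> carrier W" "w' \<in> carrier W"
  have "Poly_Mapping.single (v, w \<oplus>\<^bsub>W\<^esub> w') 1 - Poly_Mapping.single (v, w) 1 - Poly_Mapping.single (v, w') 1 \<in> N"
    using * by (intro subsetD[OF relators_null]) (auto simp: tensor_relators_def)
  hence "cls (Poly_Mapping.single (v, w \<oplus>\<^bsub>W\<^esub> w') 1) = cls (Poly_Mapping.single (v, w) 1 + Poly_Mapping.single (v, w') 1)"
    using * by (intro coset_eqI keys_add_subset) (auto simp: algebra_simps)
  thus "pt v (w \<oplus>\<^bsub>W\<^esub> w') = pt v w \<oplus>\<^bsub>T\<^esub> pt v w'"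
    using * by (simp add: pure_tensor_def coset_add)
next
  fix w v v' assume *: "w \<in> carrier W" "v \<in> carrier V" "v' \<in> carrier V"
  have "Poly_Mapping.single (v \<oplus>\<^bsub>V\<^esub> v', w) 1 - Poly_Mapping.single (v, w) 1 - Poly_Mapping.single (v', w) 1 \<in> N"
    using * by (intro subsetD[OF relators_null]) (auto simp: tensor_relators_def)
  hence "cls (Poly_Mapping.single (v \<oplus>\<^bsub>V\<^esub> v', w) 1) = cls (Poly_Mapping.single (v, w) 1 + Poly_Mapping.single (v', w) 1)"
    using * by (intro coset_eqI keys_add_subset) (auto simp: algebra_simps)
  thus "pt (v \<oplus>\<^bsub>V\<^esub> v') w = pt v w \<oplus>\<^bsub>T\<^esub> pt v' w"
    using * by (simp add: pure_tensor_def coset_add)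
next
  fix v c w assume *: "v \<in> carrier V" "w \<in> carrier W"
  have "Poly_Mapping.single (v, c \<odot>\<^bsub>W\<^esub> w) 1 - Poly_Mapping.single (v, w) c \<in> N"
    using * by (intro subsetD[OF relators_null]) (auto simp: tensor_relators_def)
  hence "cls (Poly_Mapping.single (v, c \<odot>\<^bsub>W\<^esub> w) 1) = cls (Poly_Mapping.single (v, w) c)"
    using * by (intro coset_eqI) auto
  thus "pt v (c \<odot>\<^bsub>W\<^esub> w) = c \<odot>\<^bsub>T\<^esub> pt v w"
    using * by (simp add: coset_single flip: pure_tensor_def)
next
  fix w c v assume *: "w \<in> carrier W" "v \<in> carrier V"
  have "Poly_Mapping.single (c \<odot>\<^bsub>V\<^esub> v, w) 1 - Poly_Mapping.single (v, w) c \<in> N"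
    using * by (intro subsetD[OF relators_null]) (auto simp: tensor_relators_def)
  hence "cls (Poly_Mapping.single (c \<odot>\<^bsub>V\<^esub> v, w) 1) = cls (Poly_Mapping.single (v, w) c)"
    using * by (intro coset_eqI) auto
  thus "pt (c \<odot>\<^bsub>V\<^esub> v) w = c \<odot>\<^bsub>T\<^esub> pt v w"
    using * by (simp add: coset_single flip: pure_tensor_def)
qed auto

lemma pt_add_left: "v \<in> carrier V \<Longrightarrow> v' \<in> carrier V \<Longrightarrow> w \<in> carrier W \<Longrightarrow> pt (v \<oplus>\<^bsub>V\<^esub> v') w = pt v w \<oplus>\<^bsub>T\<^esub> pt v' w"
  and pt_add_right: "v \<in> carrier V \<Longrightarrow> w \<in> carrier W \<Longrightarrow> w' \<in> carrier W \<Longrightarrow> pt v (w \<oplus>\<^bsub>W\<^esub> w') = pt v w \<oplus>\<^bsub>T\<^esub> pt v w'"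
  and pt_smult_left: "v \<in> carrier V \<Longrightarrow> w \<in> carrier W \<Longrightarrow> pt (c \<odot>\<^bsub>V\<^esub> v) w = c \<odot>\<^bsub>T\<^esub> pt v w"
  and pt_smult_right: "v \<in> carrier V \<Longrightarrow> w \<in> carrier W \<Longrightarrow> pt v (c \<odot>\<^bsub>W\<^esub> w) = c \<odot>\<^bsub>T\<^esub> pt v w"
  using linear_on_add[OF bilinear_on_left[OF pt_bilinear]] linear_on_smult[OF bilinear_on_left[OF pt_bilinear]]
    linear_on_add[OF bilinear_on_right[OF pt_bilinear]] linear_on_smult[OF bilinear_on_right[OF pt_bilinear]]
  by auto

lemma pt_zero_left [simp]: "w \<in> carrier W \<Longrightarrow> pt \<zero>\<^bsub>V\<^esub> w = \<zero>\<^bsub>T\<^esub>"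
  using pt_smult_left[of "\<zero>\<^bsub>V\<^esub>" w 0] by simp

lemma pt_zero_right [simp]: "v \<in> carrier V \<Longrightarrow> pt v \<zero>\<^bsub>W\<^esub> = \<zero>\<^bsub>T\<^esub>"
  using pt_smult_right[of v "\<zero>\<^bsub>W\<^esub>" 0] by simp

lemma tensor_induct [consumes 1, case_names pure add]:
  assumes t: "t \<in> carrier T"
    and pure: "\<And>v w. v \<in> carrier V \<Longrightarrow> w \<in> carrier W \<Longrightarrow> P (pt v w)"
    and add: "\<And>t t'. t \<in> carrier T \<Longrightarrow> t' \<in> carrier T \<Longrightarrow> P t \<Longrightarrow> P t' \<Longrightarrow> P (t \<oplus>\<^bsub>T\<^esub> t')"
  shows "P t"
proof -
  obtain f where f: "t = cls f" "Poly_Mapping.keys f \<subseteq> VW"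
    using t by (auto simp: tensor_carrier)
  have "P (cls f)"
    using f(2)
  proof (induction f rule: poly_mapping_induct)
    case zero
    have "cls 0 = pt \<zero>\<^bsub>V\<^esub> \<zero>\<^bsub>W\<^esub>"
      using linear_on_zero[OF coset_linear F.vspace_axioms T.vspace_axioms] by simp
    thus ?case using pure[of "\<zero>\<^bsub>V\<^esub>" "\<zero>\<^bsub>W\<^esub>"] by simp
  next
    case (single x c)
    obtain v w where x: "x = (v, w)" "v \<in> carrier V" "w \<in> carrier W" using single by auto
    show ?case using x pure[of "c \<odot>\<^bsub>V\<^esub> v" w] by (simp add: coset_single pt_smult_left)
  next
    case (add f g)
    thus ?case using assms(3)[of "cls f" "cls g"] by (simp add: coset_add tensor_carrier)
  qed
  thus ?thesis by (simp add: f)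
qed

lemma tensor_linear_unique:
  assumes "linear_on T U G" "linear_on T U H"
    and "\<And>v w. v \<in> carrier V \<Longrightarrow> w \<in> carrier W \<Longrightarrow> G (pt v w) = H (pt v w)"
    and "t \<in> carrier T"
  shows "G t = H t"
  using assms(4)
proof (induction t rule: tensor_induct)
  case (add t t')
  thus ?case by (simp add: linear_on_add[OF assms(1)] linear_on_add[OF assms(2)])
qed (rule assms(3))

context
  fixes U :: "('k, 'u, 'l) module_scheme" and B
  assumes U: "vspace U" and B: "bilinear_on V W U B"
begin

interpretation U: vspace U by (rule U)

lemma B_closed: "v \<in> carrier V \<Longrightarrow> w \<in> carrier W \<Longrightarrow> B v w \<in> carrier U"
  using linear_on_closed[OF bilinear_on_right[OF B]] .

lemma lin_ext_B: "linear_on F U (lin_ext U (\<lambda>(v, w). B v w))"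
  unfolding linear_on_formal_tensors by (rule U.lin_ext_linear) (auto simp: B_closed)

lemma lin_ext_B_diff:
  assumes "Poly_Mapping.keys f \<subseteq> VW" "Poly_Mapping.keys g \<subseteq> VW"
  shows "lin_ext U (\<lambda>(v, w). B v w) (f - g) = lin_ext U (\<lambda>(v, w). B v w) f \<ominus>\<^bsub>U\<^esub> lin_ext U (\<lambda>(v, w). B v w) g"
proof -
  have "\<ominus>\<^bsub>F\<^esub> g = - g"
    using assms by (intro F.minus_equality) auto
  thus ?thesis
    using linear_on_add[OF lin_ext_B, of f "- g"] linear_on_minus[OF lin_ext_B F.vspace_axioms U, of g] assms
    by (simp add: U.minus_eq)
qed

lemma lin_ext_null:
  assumes "f \<in> N"
  shows "lin_ext U (\<lambda>(v, w). B v w) f = \<zero>\<^bsub>U\<^esub>"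
proof -
  note lin = lin_ext_B
  let ?K = "{f \<in> carrier F. lin_ext U (\<lambda>(v, w). B v w) f = \<zero>\<^bsub>U\<^esub>}"
  have K: "vsubspace ?K F" by (rule F.kernel_vsubspace[OF lin U])
  have cancel: "x \<oplus>\<^bsub>U\<^esub> y \<ominus>\<^bsub>U\<^esub> x \<ominus>\<^bsub>U\<^esub> y = \<zero>\<^bsub>U\<^esub>" if "x \<in> carrier U" "y \<in> carrier U" for x y
  proof -
    have "x \<oplus>\<^bsub>U\<^esub> y \<ominus>\<^bsub>U\<^esub> x = y" using that by (simp add: U.minus_eq U.a_comm[of x y] U.a_assoc U.r_neg)
    thus ?thesis using that by (simp add: U.minus_eq U.r_neg)
  qed
  have "tensor_relators V W \<subseteq> ?K"
    unfolding tensor_relators_def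
    by (intro Un_least subsetI; elim CollectE exE conjE; hypsubst;
        simp add: lin_ext_B_diff keys_diff_subset B_closed U.lin_ext_single
          linear_on_add[OF bilinear_on_left[OF B]] linear_on_smult[OF bilinear_on_left[OF B]]
          linear_on_add[OF bilinear_on_right[OF B]] linear_on_smult[OF bilinear_on_right[OF B]]
          del: keys_single;
        simp add: B_closed cancel[unfolded U.minus_eq] U.minus_eq U.r_neg)
  hence "N \<subseteq> ?K" by (rule null_least[OF K])
  thus ?thesis using assms by auto
qed

lemma tensor_lift_coset:
  "f \<in> carrier F \<Longrightarrow> tensor_lift U B (cls f) = lin_ext U (\<lambda>(v, w). B v w) f"
  unfolding tensor_lift_def by (rule S.image_coset[OF lin_ext_B U lin_ext_null])

lemma tensor_lift_linear: "linear_on T U (tensor_lift U B)"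
proof (rule linear_onI)
  fix x assume "x \<in> carrier T"
  thus "tensor_lift U B x \<in> carrier U"
    using linear_on_closed[OF lin_ext_B] by (auto simp: tensor_carrier tensor_lift_coset)
next
  fix x y assume "x \<in> carrier T" "y \<in> carrier T"
  then obtain f g where "x = cls f" "y = cls g" and fg: "f \<in> carrier F" "g \<in> carrier F"
    by (auto simp: tensor_carrier)
  thus "tensor_lift U B (x \<oplus>\<^bsub>T\<^esub> y) = tensor_lift U B x \<oplus>\<^bsub>U\<^esub> tensor_lift U B y"
    using linear_on_add[OF lin_ext_B fg] F.a_closed[OF fg]
    by (simp add: tensor_lift_coset del: formal_tensors_simps flip: linear_on_add[OF coset_linear fg])
next
  fix c x assume "x \<in> carrier T"
  then obtain f where "x = cls f" and f: "f \<in> carrier F"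
    by (auto simp: tensor_carrier)
  thus "tensor_lift U B (c \<odot>\<^bsub>T\<^esub> x) = c \<odot>\<^bsub>U\<^esub> tensor_lift U B x"
    using linear_on_smult[OF lin_ext_B f, of c] F.smult_closed[OF f, of c]
    by (simp add: tensor_lift_coset del: formal_tensors_simps flip: linear_on_smult[OF coset_linear f])
qed

lemma tensor_lift_pure: "v \<in> carrier V \<Longrightarrow> w \<in> carrier W \<Longrightarrow> tensor_lift U B (pt v w) = B v w"
  by (simp add: pure_tensor_def tensor_lift_coset B_closed)

end

lemma tensor_lift_param_linear:
  assumes "vspace U" "\<And>x. x \<in> carrier Y \<Longrightarrow> bilinear_on V W U (B x)"
    and "\<And>v w. v \<in> carrier V \<Longrightarrow> w \<in> carrier W \<Longrightarrow> linear_on Y U (\<lambda>x. B x v w)"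
    and "vspace Y" and t: "t \<in> carrier T"
  shows "linear_on Y U (\<lambda>x. tensor_lift U (B x) t)"
proof -
  interpret U: vspace U by fact
  interpret Y: vspace Y by fact
  note tl = tensor_lift_linear[OF assms(1,2)] tensor_lift_pure[OF assms(1,2)]
  show ?thesis
  proof (rule linear_onI)
    fix x assume "x \<in> carrier Y"
    thus "tensor_lift U (B x) t \<in> carrier U" using linear_on_closed[OF tl(1)] t by blast
  next
    fix x y assume *: "x \<in> carrier Y" "y \<in> carrier Y"
    hence **: "x \<oplus>\<^bsub>Y\<^esub> y \<in> carrier Y" by simp
    show "tensor_lift U (B (x \<oplus>\<^bsub>Y\<^esub> y)) t = tensor_lift U (B x) t \<oplus>\<^bsub>U\<^esub> tensor_lift U (B y) t"
      by (rule tensor_linear_unique[OF tl(1)[OF **] linear_on_addI[OF tl(1)[OF *(1)] tl(1)[OF *(2)] assms(1)] _ t])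
         (simp add: tl(2) * ** linear_on_add[OF assms(3)])
  next
    fix c x assume *: "x \<in> carrier Y"
    hence **: "c \<odot>\<^bsub>Y\<^esub> x \<in> carrier Y" by simp
    show "tensor_lift U (B (c \<odot>\<^bsub>Y\<^esub> x)) t = c \<odot>\<^bsub>U\<^esub> tensor_lift U (B x) t"
      by (rule tensor_linear_unique[OF tl(1)[OF **] linear_on_smultI[OF tl(1)[OF *] assms(1)] _ t])
         (simp add: tl(2) * ** linear_on_smult[OF assms(3)])
  qed
qed

lemma tensor_lift_comp:
  assumes "vspace U" "vspace Y" "bilinear_on V W U B" "linear_on U Y G" "t \<in> carrier T"
  shows "G (tensor_lift U B t) = tensor_lift Y (\<lambda>v w. G (B v w)) t"
proof -
  note bl = bilinear_on_linear_comp[OF assms(3,4)]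
  show ?thesis
    by (rule tensor_linear_unique[OF linear_on_comp[OF tensor_lift_linear[OF assms(1,3)] assms(4)]
          tensor_lift_linear[OF assms(2) bl] _ assms(5)])
       (simp add: tensor_lift_pure[OF assms(1,3)] tensor_lift_pure[OF assms(2) bl])
qed

lemma tensor_lift_cong:
  assumes "vspace U" "bilinear_on V W U B" "bilinear_on V W U B'"
    and "\<And>v w. v \<in> carrier V \<Longrightarrow> w \<in> carrier W \<Longrightarrow> B v w = B' v w" "t \<in> carrier T"
  shows "tensor_lift U B t = tensor_lift U B' t"
  by (rule tensor_linear_unique[OF tensor_lift_linear[OF assms(1,2)] tensor_lift_linear[OF assms(1,3)] _ assms(5)])
     (simp add: tensor_lift_pure[OF assms(1,2)] tensor_lift_pure[OF assms(1,3)] assms(4))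

end

section \<open>Algebras\<close>

locale kalgebra = ring A + vspace A for A :: "('k::field, 'a, 'm) module_scheme" (structure) +
  assumes smult_mult_left: "x \<in> carrier A \<Longrightarrow> y \<in> carrier A \<Longrightarrow> (c \<odot> x) \<otimes> y = c \<odot> (x \<otimes> y)"
    and smult_mult_right: "x \<in> carrier A \<Longrightarrow> y \<in> carrier A \<Longrightarrow> x \<otimes> (c \<odot> y) = c \<odot> (x \<otimes> y)"
begin

lemma mult_bilinear: "bilinear_on A A A (\<otimes>)"
  by (intro bilinear_onI linear_onI) (auto simp: l_distr r_distr smult_mult_left smult_mult_right)

end

lemma kalgebraI:
  assumes "vspace A" "bilinear_on A A A (monoid.mult A)" "\<one>\<^bsub>A\<^esub> \<in> carrier A"
    and "\<And>x y z. x \<in> carrier A \<Longrightarrow> y \<in> carrier A \<Longrightarrow> z \<in> carrier A \<Longrightarrow>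
      (x \<otimes>\<^bsub>A\<^esub> y) \<otimes>\<^bsub>A\<^esub> z = x \<otimes>\<^bsub>A\<^esub> (y \<otimes>\<^bsub>A\<^esub> z)"
    and "\<And>x. x \<in> carrier A \<Longrightarrow> \<one>\<^bsub>A\<^esub> \<otimes>\<^bsub>A\<^esub> x = x" "\<And>x. x \<in> carrier A \<Longrightarrow> x \<otimes>\<^bsub>A\<^esub> \<one>\<^bsub>A\<^esub> = x"
  shows "kalgebra A"
proof -
  interpret vspace A by fact
  note bl = bilinear_on_left[OF assms(2)] and br = bilinear_on_right[OF assms(2)]
  have "ring A"
    by (intro ringI abelian_group_axioms monoidI)
       (auto simp: assms(3-6) linear_on_closed[OF br] linear_on_add[OF bl] linear_on_add[OF br])
  thus ?thesis
    by (intro kalgebra.intro vspace_axioms kalgebra_axioms.intro)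
       (auto simp: linear_on_smult[OF bl] linear_on_smult[OF br])
qed

lemma map_times_single [simp]:
  "Poly_Mapping.map ((*) (c::'k::field)) (Poly_Mapping.single x d) = Poly_Mapping.single x (c * d)"
  by (intro poly_mapping_eqI) (simp add: lookup_map_times lookup_single when_def)

lemma map_times_sum:
  "Poly_Mapping.map ((*) (c::'k::field)) (sum f S) = (\<Sum>x\<in>S. Poly_Mapping.map ((*) c) (f x))"
  by (intro poly_mapping_eqI) (simp add: lookup_map_times lookup_sum sum_distrib_left)

lemma keys_sum_subset:
  assumes "\<And>x. x \<in> S \<Longrightarrow> Poly_Mapping.keys (f x) \<subseteq> K"
  shows "Poly_Mapping.keys (sum f S) \<subseteq> K"
  using assms by (induction S rule: infinite_finite_induct) (simp_all add: keys_add_subset)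

locale kalgebra_pair = V: kalgebra V + W: kalgebra W
  for V :: "('k::field, 'v, 'm) module_scheme" and W :: "('k, 'w, 'n) module_scheme"
begin

sublocale vspace_pair V W
  by unfold_locales

lemma formal_mult:
  assumes "finite P" "finite Q" "Poly_Mapping.keys f \<subseteq> P" "Poly_Mapping.keys g \<subseteq> Q"
  shows "f \<otimes>\<^bsub>F\<^esub> g = (\<Sum>p\<in>P. \<Sum>q\<in>Q. Poly_Mapping.single (fst p \<otimes>\<^bsub>V\<^esub> fst q, snd p \<otimes>\<^bsub>W\<^esub> snd q)
    (Poly_Mapping.lookup f p * Poly_Mapping.lookup g q))" (is "_ = sum ?h P")
proof -
  have 1: "(\<Sum>q\<in>Poly_Mapping.keys g. Poly_Mapping.single (fst p \<otimes>\<^bsub>V\<^esub> fst q, snd p \<otimes>\<^bsub>W\<^esub> snd q)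
    (Poly_Mapping.lookup f p * Poly_Mapping.lookup g q)) = ?h p" for p
    using assms by (intro sum.mono_neutral_left) (auto simp: in_keys_iff)
  have "f \<otimes>\<^bsub>F\<^esub> g = sum ?h (Poly_Mapping.keys f)"
    by (simp add: formal_tensors_def case_prod_unfold 1)
  also have "\<dots> = sum ?h P"
    using assms by (intro sum.mono_neutral_left) (auto simp: in_keys_iff)
  finally show ?thesis .
qed

lemma formal_mult_single:
  "Poly_Mapping.single (a, b) c \<otimes>\<^bsub>F\<^esub> Poly_Mapping.single (a', b') d
     = Poly_Mapping.single (a \<otimes>\<^bsub>V\<^esub> a', b \<otimes>\<^bsub>W\<^esub> b') (c * d)"
  by (subst formal_mult[of "{(a, b)}" "{(a', b')}"]) auto

lemma formal_mult_bilinear: "bilinear_on F F F (monoid.mult F)"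
proof (intro bilinear_onI linear_onI)
  fix f g assume "f \<in> carrier F" "g \<in> carrier F"
  thus "f \<otimes>\<^bsub>F\<^esub> g \<in> carrier F"
    by (subst formal_mult[OF finite_keys finite_keys order_refl order_refl])
       (fastforce intro!: keys_sum_subset keys_single_subset simp del: keys_single)
  thus "f \<otimes>\<^bsub>F\<^esub> g \<in> carrier F" .
next
  fix f g h :: "'v \<times> 'w \<Rightarrow>\<^sub>0 'k"
  let ?P = "Poly_Mapping.keys f" and ?Q = "Poly_Mapping.keys g \<union> Poly_Mapping.keys h"
  show "f \<otimes>\<^bsub>F\<^esub> (g \<oplus>\<^bsub>F\<^esub> h) = f \<otimes>\<^bsub>F\<^esub> g \<oplus>\<^bsub>F\<^esub> f \<otimes>\<^bsub>F\<^esub> h"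
    using keys_add[of g h]
    by (simp add: formal_mult[of ?P ?Q] lookup_add distrib_left single_add sum.distrib)
  show "(g \<oplus>\<^bsub>F\<^esub> h) \<otimes>\<^bsub>F\<^esub> f = g \<otimes>\<^bsub>F\<^esub> f \<oplus>\<^bsub>F\<^esub> h \<otimes>\<^bsub>F\<^esub> f"
    using keys_add[of g h]
    by (simp add: formal_mult[of ?Q ?P] lookup_add distrib_right single_add sum.distrib)
next
  fix f g :: "'v \<times> 'w \<Rightarrow>\<^sub>0 'k" and c
  let ?P = "Poly_Mapping.keys f" and ?Q = "Poly_Mapping.keys g"
  show "f \<otimes>\<^bsub>F\<^esub> (c \<odot>\<^bsub>F\<^esub> g) = c \<odot>\<^bsub>F\<^esub> (f \<otimes>\<^bsub>F\<^esub> g)"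
    by (simp add: formal_mult[of ?P ?Q] keys_map_times lookup_map_times map_times_sum mult.left_commute)
  show "(c \<odot>\<^bsub>F\<^esub> g) \<otimes>\<^bsub>F\<^esub> f = c \<odot>\<^bsub>F\<^esub> (g \<otimes>\<^bsub>F\<^esub> f)"
    by (simp add: formal_mult[of ?Q ?P] keys_map_times lookup_map_times map_times_sum mult.assoc)
qed

lemma bilinear_right_mult:
  assumes "a \<in> carrier V" "b \<in> carrier W"
  shows "bilinear_on V W T (\<lambda>v w. pt (v \<otimes>\<^bsub>V\<^esub> a) (w \<otimes>\<^bsub>W\<^esub> b))"
  by (intro bilinear_on_comp[OF pt_bilinear] bilinear_on_left[OF V.mult_bilinear]
      bilinear_on_left[OF W.mult_bilinear] assms)

lemma bilinear_left_mult:
  assumes "a \<in> carrier V" "b \<in> carrier W"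
  shows "bilinear_on V W T (\<lambda>v w. pt (a \<otimes>\<^bsub>V\<^esub> v) (b \<otimes>\<^bsub>W\<^esub> w))"
  by (intro bilinear_on_comp[OF pt_bilinear] bilinear_on_right[OF V.mult_bilinear]
      bilinear_on_right[OF W.mult_bilinear] assms)

lemma coset_eq_zero_iff:
  assumes "f \<in> carrier F"
  shows "cls f = \<zero>\<^bsub>T\<^esub> \<longleftrightarrow> f \<in> N"
proof -
  have "\<zero>\<^bsub>T\<^esub> = cls \<zero>\<^bsub>F\<^esub>"
    unfolding tensor_def by (rule S.quot_zero)
  moreover have "f \<ominus>\<^bsub>F\<^esub> \<zero>\<^bsub>F\<^esub> = f"
  proof -
    have "\<ominus>\<^bsub>F\<^esub> \<zero>\<^bsub>F\<^esub> = \<zero>\<^bsub>F\<^esub>"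
      by (rule F.minus_equality) (simp_all del: formal_tensors_simps)
    thus ?thesis unfolding F.minus_eq using assms by (simp only: F.r_zero)
  qed
  ultimately show ?thesis using S.coset_eq_iff[OF assms F.zero_closed] by (simp only:)
qed

lemma null_ideal:
  assumes u: "u \<in> N" and f: "f \<in> carrier F"
  shows "u \<otimes>\<^bsub>F\<^esub> f \<in> N \<and> f \<otimes>\<^bsub>F\<^esub> u \<in> N"
proof -
  note bil = bilinear_on_linear_comp[OF formal_mult_bilinear coset_linear]
  have u': "u \<in> carrier F" using u by (rule S.U_carrier)
  have closed: "u \<otimes>\<^bsub>F\<^esub> f \<in> carrier F" "f \<otimes>\<^bsub>F\<^esub> u \<in> carrier F"
    using linear_on_closed[OF bilinear_on_right[OF formal_mult_bilinear]] u' f by blast+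
  have zero: "linear_on (free_mod (VW)) T (\<lambda>_. \<zero>\<^bsub>T\<^esub>)"
    by (rule linear_onI) auto
  have single_r: "cls (u \<otimes>\<^bsub>F\<^esub> Poly_Mapping.single (a, b) 1) = \<zero>\<^bsub>T\<^esub>"
    and single_l: "cls (Poly_Mapping.single (a, b) 1 \<otimes>\<^bsub>F\<^esub> u) = \<zero>\<^bsub>T\<^esub>"
    if ab: "a \<in> carrier V" "b \<in> carrier W" for a b
  proof -
    have s: "Poly_Mapping.single (a, b) 1 \<in> carrier F" using ab by simp
    note r = bilinear_right_mult[OF ab] and l = bilinear_left_mult[OF ab]
    have cl: "v \<otimes>\<^bsub>V\<^esub> a \<in> carrier V" "w \<otimes>\<^bsub>W\<^esub> b \<in> carrier W" "a \<otimes>\<^bsub>V\<^esub> v \<in> carrier V" "b \<otimes>\<^bsub>W\<^esub> w \<in> carrier W"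
      if "v \<in> carrier V" "w \<in> carrier W" for v w using that ab by auto
    have "cls (u \<otimes>\<^bsub>F\<^esub> Poly_Mapping.single (a, b) 1) = lin_ext T (\<lambda>(v, w). pt (v \<otimes>\<^bsub>V\<^esub> a) (w \<otimes>\<^bsub>W\<^esub> b)) u"
    proof (rule T.linear_free_unique[where S = "VW" and F = "\<lambda>u. cls (u \<otimes>\<^bsub>F\<^esub> Poly_Mapping.single (a, b) 1)"])
      show "linear_on (free_mod (VW)) T (\<lambda>u. cls (u \<otimes>\<^bsub>F\<^esub> Poly_Mapping.single (a, b) 1))"
        using bilinear_on_left[OF bil s] by (simp only: linear_on_formal_tensors)
    qed (use u' lin_ext_B[OF tensor_vspace r] in
        \<open>auto simp: linear_on_formal_tensors formal_mult_single cl coset_single\<close>)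
    also have "\<dots> = \<zero>\<^bsub>T\<^esub>" by (rule lin_ext_null[OF tensor_vspace r u])
    finally show "cls (u \<otimes>\<^bsub>F\<^esub> Poly_Mapping.single (a, b) 1) = \<zero>\<^bsub>T\<^esub>" .
    have "cls (Poly_Mapping.single (a, b) 1 \<otimes>\<^bsub>F\<^esub> u) = lin_ext T (\<lambda>(v, w). pt (a \<otimes>\<^bsub>V\<^esub> v) (b \<otimes>\<^bsub>W\<^esub> w)) u"
    proof (rule T.linear_free_unique[where S = "VW" and F = "\<lambda>u. cls (Poly_Mapping.single (a, b) 1 \<otimes>\<^bsub>F\<^esub> u)"])
      show "linear_on (free_mod (VW)) T (\<lambda>u. cls (Poly_Mapping.single (a, b) 1 \<otimes>\<^bsub>F\<^esub> u))"
        using bilinear_on_right[OF bil s] by (simp only: linear_on_formal_tensors)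
    qed (use u' lin_ext_B[OF tensor_vspace l] in
        \<open>auto simp: linear_on_formal_tensors formal_mult_single cl coset_single\<close>)
    also have "\<dots> = \<zero>\<^bsub>T\<^esub>" by (rule lin_ext_null[OF tensor_vspace l u])
    finally show "cls (Poly_Mapping.single (a, b) 1 \<otimes>\<^bsub>F\<^esub> u) = \<zero>\<^bsub>T\<^esub>" .
  qed
  have "cls (u \<otimes>\<^bsub>F\<^esub> f) = \<zero>\<^bsub>T\<^esub>"
  proof (rule T.linear_free_unique[OF _ zero, where F = "\<lambda>f. cls (u \<otimes>\<^bsub>F\<^esub> f)"])
    show "linear_on (free_mod (VW)) T (\<lambda>f. cls (u \<otimes>\<^bsub>F\<^esub> f))"
      using bilinear_on_right[OF bil u'] by (simp only: linear_on_formal_tensors)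
  qed (use f single_r in auto)
  moreover have "cls (f \<otimes>\<^bsub>F\<^esub> u) = \<zero>\<^bsub>T\<^esub>"
  proof (rule T.linear_free_unique[OF _ zero, where F = "\<lambda>f. cls (f \<otimes>\<^bsub>F\<^esub> u)"])
    show "linear_on (free_mod (VW)) T (\<lambda>f. cls (f \<otimes>\<^bsub>F\<^esub> u))"
      using bilinear_on_left[OF bil u'] by (simp only: linear_on_formal_tensors)
  qed (use f single_l in auto)
  ultimately show ?thesis by (simp only: coset_eq_zero_iff closed)
qed

lemma coset_mult:
  "f \<in> carrier F \<Longrightarrow> g \<in> carrier F \<Longrightarrow> (cls f) \<otimes>\<^bsub>T\<^esub> (cls g) = cls (f \<otimes>\<^bsub>F\<^esub> g)"
  unfolding tensor_def by (rule S.quot_mult[OF formal_mult_bilinear null_ideal])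

lemma pt_mult:
  "a \<in> carrier V \<Longrightarrow> a' \<in> carrier V \<Longrightarrow> b \<in> carrier W \<Longrightarrow> b' \<in> carrier W
    \<Longrightarrow> pt a b \<otimes>\<^bsub>T\<^esub> pt a' b' = pt (a \<otimes>\<^bsub>V\<^esub> a') (b \<otimes>\<^bsub>W\<^esub> b')"
  by (simp add: pure_tensor_def coset_mult formal_mult_single)

lemma tensor_one: "\<one>\<^bsub>T\<^esub> = pt \<one>\<^bsub>V\<^esub> \<one>\<^bsub>W\<^esub>"
  unfolding tensor_def pure_tensor_def by (simp add: S.quot_one)

lemma tensor_mult_bilinear: "bilinear_on T T T (monoid.mult T)"
proof (intro bilinear_onI linear_onI)
  note br = bilinear_on_right[OF formal_mult_bilinear] and bl = bilinear_on_left[OF formal_mult_bilinear]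
  note q = coset_mult linear_on_closed[OF br] linear_on_add[OF br] linear_on_add[OF bl]
    linear_on_smult[OF br] linear_on_smult[OF bl] F.a_closed F.smult_closed
  note flips = linear_on_add[OF coset_linear] linear_on_smult[OF coset_linear]
  fix x y assume "x \<in> carrier T" "y \<in> carrier T"
  then obtain f g where xy: "x = cls f" "y = cls g" and fg: "f \<in> carrier F" "g \<in> carrier F"
    by (auto simp: tensor_carrier)
  show "x \<otimes>\<^bsub>T\<^esub> y \<in> carrier T"
    unfolding xy coset_mult[OF fg] by (rule linear_on_closed[OF coset_linear linear_on_closed[OF br[OF fg(1)] fg(2)]])
  thus "x \<otimes>\<^bsub>T\<^esub> y \<in> carrier T" .
  show "x \<otimes>\<^bsub>T\<^esub> (c \<odot>\<^bsub>T\<^esub> y) = c \<odot>\<^bsub>T\<^esub> (x \<otimes>\<^bsub>T\<^esub> y)" "(c \<odot>\<^bsub>T\<^esub> y) \<otimes>\<^bsub>T\<^esub> x = c \<odot>\<^bsub>T\<^esub> (y \<otimes>\<^bsub>T\<^esub> x)" for c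
    unfolding xy using fg by (simp_all only: q flip: flips)
  fix z assume "z \<in> carrier T"
  then obtain h where z: "z = cls h" and h: "h \<in> carrier F"
    by (auto simp: tensor_carrier)
  show "x \<otimes>\<^bsub>T\<^esub> (y \<oplus>\<^bsub>T\<^esub> z) = x \<otimes>\<^bsub>T\<^esub> y \<oplus>\<^bsub>T\<^esub> x \<otimes>\<^bsub>T\<^esub> z" "(y \<oplus>\<^bsub>T\<^esub> z) \<otimes>\<^bsub>T\<^esub> x = y \<otimes>\<^bsub>T\<^esub> x \<oplus>\<^bsub>T\<^esub> z \<otimes>\<^bsub>T\<^esub> x"
    unfolding xy z using fg h by (simp_all only: q flip: flips)
qed

lemma tensor_kalgebra: "kalgebra T"
proof (rule kalgebraI[OF tensor_vspace tensor_mult_bilinear])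
  note br = bilinear_on_right[OF tensor_mult_bilinear] and bl = bilinear_on_left[OF tensor_mult_bilinear]
  note q = linear_on_closed[OF br] linear_on_add[OF br] linear_on_add[OF bl]
  show "\<one>\<^bsub>T\<^esub> \<in> carrier T" by (simp add: tensor_one)
  fix x assume x: "x \<in> carrier T"
  show "\<one>\<^bsub>T\<^esub> \<otimes>\<^bsub>T\<^esub> x = x" using x
    by (induction x rule: tensor_induct) (simp_all add: tensor_one pt_mult q)
  show "x \<otimes>\<^bsub>T\<^esub> \<one>\<^bsub>T\<^esub> = x" using x
    by (induction x rule: tensor_induct) (simp_all add: tensor_one pt_mult q)
  fix y z assume y: "y \<in> carrier T" and z: "z \<in> carrier T"
  have 1: "(pt a b \<otimes>\<^bsub>T\<^esub> pt c d) \<otimes>\<^bsub>T\<^esub> z = pt a b \<otimes>\<^bsub>T\<^esub> (pt c d \<otimes>\<^bsub>T\<^esub> z)"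
    if "a \<in> carrier V" "b \<in> carrier W" "c \<in> carrier V" "d \<in> carrier W" for a b c d
    using z that by (induction z rule: tensor_induct) (simp_all add: pt_mult q V.m_assoc W.m_assoc)
  have 2: "(pt a b \<otimes>\<^bsub>T\<^esub> y) \<otimes>\<^bsub>T\<^esub> z = pt a b \<otimes>\<^bsub>T\<^esub> (y \<otimes>\<^bsub>T\<^esub> z)"
    if "a \<in> carrier V" "b \<in> carrier W" for a b
    using y that z by (induction y rule: tensor_induct) (simp_all add: q 1)
  show "(x \<otimes>\<^bsub>T\<^esub> y) \<otimes>\<^bsub>T\<^esub> z = x \<otimes>\<^bsub>T\<^esub> (y \<otimes>\<^bsub>T\<^esub> z)"
    using x y z by (induction x rule: tensor_induct) (simp_all add: q 2)
qed

end

section \<open>The Suzuki algebra by generators and relations\<close>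

definition algebra_hom ::
    "('k::field, 'a, 'm) module_scheme \<Rightarrow> ('k, 'b, 'n) module_scheme \<Rightarrow> ('a \<Rightarrow> 'b) \<Rightarrow> bool" where
  "algebra_hom A B h \<longleftrightarrow> linear_on A B h \<and> h \<one>\<^bsub>A\<^esub> = \<one>\<^bsub>B\<^esub> \<and>
     (\<forall>x\<in>carrier A. \<forall>y\<in>carrier A. h (x \<otimes>\<^bsub>A\<^esub> y) = h x \<otimes>\<^bsub>B\<^esub> h y)"

lemma
  assumes "algebra_hom A B h"
  shows algebra_hom_linear: "linear_on A B h"
    and algebra_hom_one: "h \<one>\<^bsub>A\<^esub> = \<one>\<^bsub>B\<^esub>"
    and algebra_hom_mult: "x \<in> carrier A \<Longrightarrow> y \<in> carrier A \<Longrightarrow> h (x \<otimes>\<^bsub>A\<^esub> y) = h x \<otimes>\<^bsub>B\<^esub> h y"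
  using assms by (auto simp: algebra_hom_def)

lemma (in kalgebra) chi_closed [simp, intro]:
  "(\<And>i j. x i j \<in> carrier A) \<Longrightarrow> chi A x i j m \<in> carrier A"
  by (induction m arbitrary: i j) auto

lemma algebra_hom_chi:
  assumes "algebra_hom A B h" "kalgebra A" "\<And>i j. x i j \<in> carrier A"
  shows "h (chi A x i j m) = chi B (\<lambda>i j. h (x i j)) i j m"
proof -
  interpret kalgebra A by fact
  show ?thesis
    by (induction m arbitrary: i j) (auto simp: algebra_hom_one[OF assms(1)] algebra_hom_mult[OF assms(1)] assms(3))
qed

lemma algebra_hom_pow:
  assumes "algebra_hom A B h" "kalgebra A" "x \<in> carrier A"
  shows "h (x [^]\<^bsub>A\<^esub> (m::nat)) = h x [^]\<^bsub>B\<^esub> m"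
proof -
  interpret kalgebra A by fact
  show ?thesis
    by (induction m) (auto simp: algebra_hom_one[OF assms(1)] algebra_hom_mult[OF assms(1)] assms(3))
qed

locale suzuki_gens = kalgebra A for A :: "('k::field, 'a, 'm) module_scheme" (structure) +
  fixes N n :: nat and mu lam :: 'k and x :: "idx \<Rightarrow> idx \<Rightarrow> 'a"
  assumes x_closed [simp, intro]: "x i j \<in> carrier A"
    and sq_diag: "x I1 I1 [^] (2::nat) = x I2 I2 [^] (2::nat)"
    and sq_off: "x I1 I2 [^] (2::nat) = x I2 I1 [^] (2::nat)"
    and chi_off: "chi A x I2 I1 (2 * n) = lam \<odot> chi A x I1 I2 (2 * n)"
    and chi_diag: "chi A x I1 I1 (2 * n) = chi A x I2 I2 (2 * n)"
    and pow_sum: "x I1 I1 [^] (2 * N) \<oplus> mu \<odot> (x I1 I2 [^] (2 * N)) = \<one>"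
    and mult_zero: "odd (idx_num i + idx_num j + idx_num k + idx_num l) \<Longrightarrow> x i j \<otimes> x k l = \<zero>"

lemma free_alg_simps [simp]:
  "carrier free_alg = UNIV" "\<zero>\<^bsub>free_alg\<^esub> = 0" "\<one>\<^bsub>free_alg\<^esub> = 1"
  "f \<oplus>\<^bsub>free_alg\<^esub> g = f + g" "f \<otimes>\<^bsub>free_alg\<^esub> g = f * g"
  "c \<odot>\<^bsub>free_alg\<^esub> f = Poly_Mapping.map ((*) c) f"
  by (simp_all add: free_alg_def free_mod_def)

lemma single_zero_commute:
  "Poly_Mapping.single 0 (c::'k::field) * f = f * Poly_Mapping.single (0::'x::monoid_add) c"
proof -
  have "Poly_Mapping.keys f \<subseteq> UNIV" by simp
  thus ?thesis
    by (induction f rule: poly_mapping_induct) (simp_all add: mult_single mult.commute algebra_simps)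
qed

lemma free_alg_kalgebra: "kalgebra free_alg"
proof (rule kalgebraI)
  show "vspace (free_alg :: ('k::field, word \<Rightarrow>\<^sub>0 'k) module)"
    by (rule vspace_cong[OF free_mod_vspace[of UNIV]]) (auto simp: fun_eq_iff)
  show "bilinear_on free_alg free_alg free_alg (\<otimes>\<^bsub>free_alg\<^esub>)"
    by (intro bilinear_onI linear_onI)
       (simp_all add: distrib_left distrib_right mult_map_scale_conv_mult mult.assoc,
        metis single_zero_commute mult.assoc)
qed (auto simp: mult.assoc)

lemma linear_on_free_alg: "linear_on free_alg U F \<longleftrightarrow> linear_on (free_mod UNIV) U F"
  by (simp add: linear_on_def)

context kalgebra
begin

definition monom_val :: "(idx \<Rightarrow> idx \<Rightarrow> 'a) \<Rightarrow> word \<Rightarrow> 'a" where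
  "monom_val gen w = foldr (\<lambda>(i, j) r. gen i j \<otimes> r) (letters w) \<one>"

context
  fixes gen :: "idx \<Rightarrow> idx \<Rightarrow> 'a"
  assumes gen: "\<And>i j. gen i j \<in> carrier A"
begin

lemma monom_val_closed [simp]: "monom_val gen w \<in> carrier A"
proof -
  have "foldr (\<lambda>(i, j) r. gen i j \<otimes> r) ls \<one> \<in> carrier A" for ls
    by (induction ls) (auto simp: gen)
  thus ?thesis by (simp add: monom_val_def)
qed

lemma monom_val_add: "monom_val gen (u + v) = monom_val gen u \<otimes> monom_val gen v"
proof -
  have c: "foldr (\<lambda>(i, j) r. gen i j \<otimes> r) ls \<one> \<in> carrier A" for ls
    by (induction ls) (auto simp: gen)
  have "foldr (\<lambda>(i, j) r. gen i j \<otimes> r) (ls @ ls') \<one>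
      = foldr (\<lambda>(i, j) r. gen i j \<otimes> r) ls \<one> \<otimes> foldr (\<lambda>(i, j) r. gen i j \<otimes> r) ls' \<one>" for ls ls'
  proof (induction ls)
    case Nil
    show ?case using c[of ls'] by simp
  next
    case (Cons a ls)
    show ?case using Cons c by (cases a) (simp add: gen m_assoc del: foldr_append)
  qed
  thus ?thesis by (simp add: monom_val_def plus_word_def del: foldr_append)
qed

lemma alg_ext_linear: "linear_on free_alg A (alg_ext A gen)"
  unfolding linear_on_free_alg alg_ext_def
  using monom_val_closed by (intro lin_ext_linear) (simp add: monom_val_def)

lemma alg_ext_single: "alg_ext A gen (Poly_Mapping.single w c) = c \<odot> monom_val gen w"
  unfolding alg_ext_def using monom_val_closed[of w]
  by (subst lin_ext_single) (simp_all add: monom_val_def)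

lemma alg_ext_letter: "alg_ext A gen (letter i j) = gen i j"
  by (simp add: letter_def alg_ext_single) (simp add: monom_val_def gen)

lemma alg_ext_closed [simp]: "alg_ext A gen f \<in> carrier A"
  using linear_on_closed[OF alg_ext_linear] by simp

lemma alg_ext_hom: "algebra_hom free_alg A (alg_ext A gen)"
  unfolding algebra_hom_def
proof (intro conjI ballI alg_ext_linear)
  have "monom_val gen 0 = \<one>" by (simp add: monom_val_def zero_word_def)
  thus "alg_ext A gen \<one>\<^bsub>free_alg\<^esub> = \<one>"
    using alg_ext_single[of 0 1] by simp
  note lin = alg_ext_linear
  note add = linear_on_add[OF lin, simplified]
  have zero: "alg_ext A gen 0 = \<zero>"
    using linear_on_zero[OF lin kalgebra.axioms(2)[OF free_alg_kalgebra] vspace_axioms] by simp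
  have *: "alg_ext A gen (f * Poly_Mapping.single w c) = alg_ext A gen f \<otimes> alg_ext A gen (Poly_Mapping.single w c)" for f w c
  proof -
    have "Poly_Mapping.keys f \<subseteq> UNIV" by simp
    thus ?thesis
      by (induction f rule: poly_mapping_induct)
         (simp_all add: zero mult_single alg_ext_single monom_val_add smult_mult_left smult_mult_right
           smult_smult smult_add_right mult.commute distrib_right add l_distr)
  qed
  fix f g :: "word \<Rightarrow>\<^sub>0 'k"
  have "Poly_Mapping.keys g \<subseteq> UNIV" by simp
  thus "alg_ext A gen (f \<otimes>\<^bsub>free_alg\<^esub> g) = alg_ext A gen f \<otimes> alg_ext A gen g"
    by (induction g rule: poly_mapping_induct) (simp_all add: * zero distrib_left add r_distr)
qed

end

end

lemma letters_induct:
  assumes "P 0" and "\<And>i j w. P w \<Longrightarrow> P (Word [(i, j)] + w)"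
  shows "P w"
proof -
  have "P (Word ls)" for ls
  proof (induction ls)
    case Nil
    show ?case using assms(1) by (simp add: zero_word_def)
  next
    case (Cons a ls)
    thus ?case using assms(2)[of "Word ls" "fst a" "snd a"] by (simp add: plus_word_def)
  qed
  thus ?thesis by (cases w) simp
qed

lemma (in kalgebra) idealI_of_vsubspace:
  assumes "vsubspace I A"
    and "\<And>a f. a \<in> I \<Longrightarrow> f \<in> carrier A \<Longrightarrow> f \<otimes> a \<in> I" "\<And>a f. a \<in> I \<Longrightarrow> f \<in> carrier A \<Longrightarrow> a \<otimes> f \<in> I"
  shows "ideal I A"
  using assms(1) by (intro idealI ring_axioms assms(2,3)) (auto simp: submodule_def)

lemma (in kalgebra) ideal_vsubspace:
  assumes "ideal I A"
  shows "vsubspace I A"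
proof -
  interpret I: ideal I A by fact
  show ?thesis
  proof (rule subspaceI)
    show "c \<odot> y \<in> I" if "y \<in> I" for c y
    proof -
      have "c \<odot> y = (c \<odot> \<one>) \<otimes> y" using that I.a_subset by (auto simp: smult_mult_left)
      thus ?thesis using that by (simp add: I.I_l_closed)
    qed
  qed (auto simp: I.a_subset[THEN subsetD])
qed

lemma (in kalgebra) quot_kalgebra:
  assumes "ideal I A"
  shows "kalgebra (quot_mod A I)" and "algebra_hom A (quot_mod A I) (\<lambda>y. I +> y)"
proof -
  interpret I: ideal I A by fact
  interpret S: subspace_of I A
    by (intro subspace_of.intro vspace_axioms subspace_of_axioms.intro ideal_vsubspace assms)
  have m: "(I +> y) \<otimes>\<^bsub>quot_mod A I\<^esub> (I +> z) = I +> (y \<otimes> z)" if "y \<in> carrier A" "z \<in> carrier A" for y z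
    using that by (intro S.quot_mult mult_bilinear) (auto simp: I.I_l_closed I.I_r_closed)
  note q = S.quot_carrier S.quot_add S.quot_smult S.quot_one m
  show "kalgebra (quot_mod A I)"
    by (intro kalgebraI S.quot_vspace bilinear_onI linear_onI)
       (auto simp: q m_assoc l_distr r_distr smult_mult_left smult_mult_right)
  show "algebra_hom A (quot_mod A I) (\<lambda>y. I +> y)"
    unfolding algebra_hom_def using S.quot_linear by (auto simp: q)
qed

lemma suzuki_ideal_ideal: "ideal (suzuki_ideal N n mu lam) free_alg"
proof -
  interpret kalgebra free_alg by (rule free_alg_kalgebra)
  show ?thesis unfolding suzuki_ideal_def by (rule genideal_ideal) simp
qed

lemma suzuki_ideal_subspace: "subspace_of (suzuki_ideal N n mu lam) free_alg"
  by (intro subspace_of.intro subspace_of_axioms.intro kalgebra.axioms(2)[OF free_alg_kalgebra]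
      kalgebra.ideal_vsubspace[OF free_alg_kalgebra] suzuki_ideal_ideal)

lemma suzuki_relators_ideal: "suzuki_relators N n mu lam \<subseteq> suzuki_ideal N n mu lam"
proof -
  interpret kalgebra free_alg by (rule free_alg_kalgebra)
  show ?thesis unfolding suzuki_ideal_def by (rule genideal_self) simp
qed

lemma suzuki_alg_kalgebra: "kalgebra (suzuki_alg N n mu lam)"
  unfolding suzuki_alg_def by (rule kalgebra.quot_kalgebra(1)[OF free_alg_kalgebra suzuki_ideal_ideal])

lemma suzuki_coset_hom:
  "algebra_hom free_alg (suzuki_alg N n mu lam) (\<lambda>y. suzuki_ideal N n mu lam +>\<^bsub>free_alg\<^esub> y)"
  unfolding suzuki_alg_def by (rule kalgebra.quot_kalgebra(2)[OF free_alg_kalgebra suzuki_ideal_ideal])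

lemma free_alg_minus: "f \<ominus>\<^bsub>free_alg\<^esub> g = f - (g :: word \<Rightarrow>\<^sub>0 'k::field)"
proof -
  interpret kalgebra "free_alg :: ('k, word \<Rightarrow>\<^sub>0 'k) module" by (rule free_alg_kalgebra)
  have "\<ominus>\<^bsub>free_alg\<^esub> g = - g" by (rule minus_equality) auto
  thus ?thesis by (simp add: minus_eq)
qed

lemma suzuki_coset_eqI:
  assumes "f \<ominus>\<^bsub>free_alg\<^esub> g \<in> suzuki_relators N n mu lam"
  shows "suzuki_ideal N n mu lam +>\<^bsub>free_alg\<^esub> f = suzuki_ideal N n mu lam +>\<^bsub>free_alg\<^esub> g"
proof -
  interpret kalgebra "free_alg :: ('a, word \<Rightarrow>\<^sub>0 'a) module" by (rule free_alg_kalgebra)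
  interpret S: subspace_of "suzuki_ideal N n mu lam" "free_alg :: ('a, word \<Rightarrow>\<^sub>0 'a) module"
    by (rule suzuki_ideal_subspace)
  show ?thesis using subsetD[OF suzuki_relators_ideal assms] by (subst S.coset_eq_iff) auto
qed

lemma suzuki_alg_gens: "suzuki_gens (suzuki_alg N n mu lam) N n mu lam (suzuki_x N n mu lam)"
proof -
  let ?I = "suzuki_ideal N n mu lam" and ?A = "suzuki_alg N n mu lam"
  interpret F: kalgebra "free_alg :: ('a, word \<Rightarrow>\<^sub>0 'a) module" by (rule free_alg_kalgebra)
  interpret A: kalgebra ?A by (rule suzuki_alg_kalgebra)
  note hom = suzuki_coset_hom[of N n mu lam]
  note lin = algebra_hom_linear[OF hom]
  have x: "suzuki_x N n mu lam = (\<lambda>i j. ?I +>\<^bsub>free_alg\<^esub> letter i j)" by (simp add: suzuki_x_def fun_eq_iff)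
  have pow: "(?I +>\<^bsub>free_alg\<^esub> f) [^]\<^bsub>?A\<^esub> (m::nat) = ?I +>\<^bsub>free_alg\<^esub> (f [^]\<^bsub>free_alg\<^esub> m)" for f m
    using algebra_hom_pow[OF hom free_alg_kalgebra, of f m] by simp
  have chi: "chi ?A (\<lambda>i j. ?I +>\<^bsub>free_alg\<^esub> letter i j) i j m = ?I +>\<^bsub>free_alg\<^esub> chi free_alg letter i j m" for i j m
    using algebra_hom_chi[OF hom free_alg_kalgebra, of letter i j m] by simp
  have sm: "c \<odot>\<^bsub>?A\<^esub> (?I +>\<^bsub>free_alg\<^esub> f) = ?I +>\<^bsub>free_alg\<^esub> (c \<odot>\<^bsub>free_alg\<^esub> f)" for c f
    using linear_on_smult[OF lin, of f c] by simp
  have ad: "(?I +>\<^bsub>free_alg\<^esub> f) \<oplus>\<^bsub>?A\<^esub> (?I +>\<^bsub>free_alg\<^esub> g) = ?I +>\<^bsub>free_alg\<^esub> (f \<oplus>\<^bsub>free_alg\<^esub> g)" for f g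
    using linear_on_add[OF lin, of f g] by simp
  have one: "\<one>\<^bsub>?A\<^esub> = ?I +>\<^bsub>free_alg\<^esub> \<one>\<^bsub>free_alg\<^esub>" using algebra_hom_one[OF hom] by simp
  have mu: "(?I +>\<^bsub>free_alg\<^esub> f) \<otimes>\<^bsub>?A\<^esub> (?I +>\<^bsub>free_alg\<^esub> g) = ?I +>\<^bsub>free_alg\<^esub> (f \<otimes>\<^bsub>free_alg\<^esub> g)" for f g
    using algebra_hom_mult[OF hom, of f g] by simp
  have zero: "\<zero>\<^bsub>?A\<^esub> = ?I +>\<^bsub>free_alg\<^esub> \<zero>\<^bsub>free_alg\<^esub>"
    using linear_on_zero[OF lin F.vspace_axioms A.vspace_axioms] by simp
  show ?thesis
    unfolding x
  proof (intro suzuki_gens.intro suzuki_gens_axioms.intro suzuki_alg_kalgebra)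
    show "?I +>\<^bsub>free_alg\<^esub> letter i j \<in> carrier ?A" for i j
      using linear_on_closed[OF lin] by simp
    show "(?I +>\<^bsub>free_alg\<^esub> letter i j) \<otimes>\<^bsub>?A\<^esub> (?I +>\<^bsub>free_alg\<^esub> letter k l) = \<zero>\<^bsub>?A\<^esub>"
      if "odd (idx_num i + idx_num j + idx_num k + idx_num l)" for i j k l
      unfolding mu zero using that
      by (intro suzuki_coset_eqI) (auto simp: suzuki_relators_def free_alg_minus)
  qed (unfold pow chi sm ad one,
       (rule suzuki_coset_eqI, simp add: suzuki_relators_def Let_def del: free_alg_simps)+)
qed

context suzuki_gens
begin

lemma alg_ext_suzuki_ideal:
  assumes "f \<in> suzuki_ideal N n mu lam"
  shows "alg_ext A x f = \<zero>"
proof -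
  interpret F: kalgebra "free_alg :: ('k, word \<Rightarrow>\<^sub>0 'k) module" by (rule free_alg_kalgebra)
  note hom = alg_ext_hom[of x, OF x_closed]
  note lin = algebra_hom_linear[OF hom]
  note mult = algebra_hom_mult[OF hom, simplified]
  let ?K = "{f \<in> carrier free_alg. alg_ext A x f = \<zero>}"
  have K: "ideal ?K free_alg"
    by (intro F.idealI_of_vsubspace F.kernel_vsubspace lin vspace_axioms)
       (auto simp: mult alg_ext_closed)
  have minus: "alg_ext A x (f \<ominus>\<^bsub>free_alg\<^esub> g) = alg_ext A x f \<ominus> alg_ext A x g" for f g
    using linear_on_add[OF lin, of f "\<ominus>\<^bsub>free_alg\<^esub> g"] linear_on_minus[OF lin F.vspace_axioms vspace_axioms, of g]
    by (simp add: F.minus_eq minus_eq)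
  have chi: "alg_ext A x (chi free_alg letter i j m) = chi A x i j m" for i j m
    using algebra_hom_chi[OF hom free_alg_kalgebra, of letter i j m] by (simp add: alg_ext_letter)
  have pow: "alg_ext A x (f [^]\<^bsub>free_alg\<^esub> (m::nat)) = alg_ext A x f [^] m" for f m
    using algebra_hom_pow[OF hom free_alg_kalgebra, of f m] by simp
  have "suzuki_relators N n mu lam \<subseteq> ?K"
    unfolding suzuki_relators_def Let_def
  proof (rule Un_least)
    show "{letter i j \<otimes>\<^bsub>free_alg\<^esub> letter k l | i j k l.
        odd (idx_num i + idx_num j + idx_num k + idx_num l)} \<subseteq> ?K"
    proof safe
      fix i j k l assume "odd (idx_num i + idx_num j + idx_num k + idx_num l)"
      from mult_zero[OF this] show "alg_ext A x (letter i j \<otimes>\<^bsub>free_alg\<^esub> letter k l) = \<zero>"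
        by (simp add: mult alg_ext_letter)
    qed simp
  qed (simp add: minus chi pow linear_on_add[OF lin] linear_on_smult[OF lin] algebra_hom_one[OF hom]
         alg_ext_letter sq_diag sq_off chi_off chi_diag pow_sum r_right_minus_eq
         del: free_alg_simps(2-))
  hence "suzuki_ideal N n mu lam \<subseteq> ?K"
    unfolding suzuki_ideal_def by (rule F.genideal_minimal[OF K])
  thus ?thesis using assms by auto
qed

lemma the_elem_alg_ext:
  "the_elem (alg_ext A x ` (suzuki_ideal N n mu lam +>\<^bsub>free_alg\<^esub> f)) = alg_ext A x f"
proof -
  interpret F: kalgebra "free_alg :: ('k, word \<Rightarrow>\<^sub>0 'k) module" by (rule free_alg_kalgebra)
  interpret S: subspace_of "suzuki_ideal N n mu lam" "free_alg :: ('k, word \<Rightarrow>\<^sub>0 'k) module"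
    by (rule suzuki_ideal_subspace)
  show ?thesis
    by (rule S.image_coset[OF alg_ext_linear[OF x_closed] vspace_axioms alg_ext_suzuki_ideal]) auto
qed

lemma suzuki_lift:
  "algebra_hom (suzuki_alg N n mu lam) A (\<lambda>h. the_elem (alg_ext A x ` h))"
  "the_elem (alg_ext A x ` suzuki_x N n mu lam i j) = x i j"
proof -
  let ?I = "suzuki_ideal N n mu lam" and ?A = "suzuki_alg N n mu lam"
  note hom = suzuki_coset_hom[of N n mu lam]
  note lin = algebra_hom_linear[OF hom]
  note hom' = alg_ext_hom[of x, OF x_closed]
  note lin' = algebra_hom_linear[OF hom']
  interpret S: subspace_of ?I "free_alg :: ('k, word \<Rightarrow>\<^sub>0 'k) module"
    by (rule suzuki_ideal_subspace)
  have car: "carrier ?A = (\<lambda>f. ?I +>\<^bsub>free_alg\<^esub> f) ` UNIV"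
    unfolding suzuki_alg_def using S.quot_carrier by simp
  note flips = linear_on_add[OF lin] linear_on_smult[OF lin] algebra_hom_mult[OF hom] algebra_hom_one[OF hom]
  note fw = linear_on_add[OF lin'] linear_on_smult[OF lin'] algebra_hom_mult[OF hom'] algebra_hom_one[OF hom']
  show "algebra_hom ?A A (\<lambda>h. the_elem (alg_ext A x ` h))"
    unfolding algebra_hom_def
    by (intro conjI linear_onI ballI; (elim imageE[OF subst[OF car, of "\<lambda>S. _ \<in> S"]])?)
       (simp_all add: the_elem_alg_ext fw alg_ext_closed del: free_alg_simps(2-) flip: flips)
  show "the_elem (alg_ext A x ` suzuki_x N n mu lam i j) = x i j"
    by (simp add: suzuki_x_def the_elem_alg_ext alg_ext_letter)
qed

end

lemma suzuki_alg_induct [consumes 1, case_names one mult add smult]: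
  assumes "h \<in> carrier (suzuki_alg N n mu lam)"
    and "P \<one>\<^bsub>suzuki_alg N n mu lam\<^esub>"
    and mult: "\<And>i j h. h \<in> carrier (suzuki_alg N n mu lam) \<Longrightarrow> P h \<Longrightarrow> P (suzuki_x N n mu lam i j \<otimes>\<^bsub>suzuki_alg N n mu lam\<^esub> h)"
    and add: "\<And>h h'. h \<in> carrier (suzuki_alg N n mu lam) \<Longrightarrow> h' \<in> carrier (suzuki_alg N n mu lam) \<Longrightarrow> P h \<Longrightarrow> P h'
      \<Longrightarrow> P (h \<oplus>\<^bsub>suzuki_alg N n mu lam\<^esub> h')"
    and smult: "\<And>c h. h \<in> carrier (suzuki_alg N n mu lam) \<Longrightarrow> P h \<Longrightarrow> P (c \<odot>\<^bsub>suzuki_alg N n mu lam\<^esub> h)"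
  shows "P h"
proof -
  let ?I = "suzuki_ideal N n mu lam" and ?A = "suzuki_alg N n mu lam"
  note hom = suzuki_coset_hom[of N n mu lam]
  note lin = algebra_hom_linear[OF hom]
  interpret S: subspace_of ?I "free_alg :: ('a, word \<Rightarrow>\<^sub>0 'a) module"
    by (rule suzuki_ideal_subspace)
  interpret A: kalgebra ?A by (rule suzuki_alg_kalgebra)
  have closed: "?I +>\<^bsub>free_alg\<^esub> f \<in> carrier ?A" for f using linear_on_closed[OF lin] by simp
  have word: "P (?I +>\<^bsub>free_alg\<^esub> Poly_Mapping.single w 1)" for w
  proof (induction w rule: letters_induct)
    case 1
    show ?case using assms(2) algebra_hom_one[OF hom] by simp
  next
    case (2 i j w)
    have "Poly_Mapping.single (Word [(i, j)] + w) 1 = letter i j * Poly_Mapping.single w (1::'a)"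
      by (simp add: letter_def mult_single)
    hence "?I +>\<^bsub>free_alg\<^esub> Poly_Mapping.single (Word [(i, j)] + w) 1
        = suzuki_x N n mu lam i j \<otimes>\<^bsub>?A\<^esub> (?I +>\<^bsub>free_alg\<^esub> Poly_Mapping.single w 1)"
      using algebra_hom_mult[OF hom, of "letter i j" "Poly_Mapping.single w 1"] by (simp add: suzuki_x_def)
    thus ?case using mult[OF closed 2] by simp
  qed
  have single: "P (?I +>\<^bsub>free_alg\<^esub> Poly_Mapping.single w c)" for w c
    using smult[OF closed word, of c w] linear_on_smult[OF lin, of "Poly_Mapping.single w 1" c] by simp
  have "P (?I +>\<^bsub>free_alg\<^esub> f)" for f
  proof -
    have "Poly_Mapping.keys f \<subseteq> UNIV" by simp
    thus ?thesis
    proof (induction f rule: poly_mapping_induct)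
      case zero
      show ?case using single[of 0 0] by simp
    next
      case (add f g)
      thus ?case using assms(4)[OF closed closed, of f g] linear_on_add[OF lin, of f g] by simp
    qed (rule single)
  qed
  thus ?thesis using assms(1) S.quot_carrier by (auto simp: suzuki_alg_def)
qed

lemma other_other [simp]: "other (other i) = i"
  by (cases i) auto

lemma other_eq_other_iff [simp]: "other i = other j \<longleftrightarrow> i = j"
  by (cases i; cases j) auto

lemma even_idx_num: "even (idx_num i + idx_num j + idx_num k + idx_num l) \<longleftrightarrow> (i = j) = (k = l)"
  by (cases i; cases j; cases k; cases l) auto

lemma (in kalgebra) chi_even:
  assumes "\<And>i j. x i j \<in> carrier A"
  shows "chi A x i j (2 * q) = (x i j \<otimes> x (other i) (other j)) [^] q"
proof (induction q)
  case (Suc q)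
  thus ?case
    using assms nat_pow_Suc2[of "x i j \<otimes> x (other i) (other j)" q] by (simp add: m_assoc)
qed simp

lemma (in kalgebra) chi_snoc:
  assumes "\<And>i j. x i j \<in> carrier A"
  shows "chi A x i j (Suc q) = chi A x i j q \<otimes> (if even q then x i j else x (other i) (other j))"
proof (induction q arbitrary: i j)
  case (Suc q)
  have "chi A x i j (Suc (Suc q)) = x i j \<otimes> chi A x (other i) (other j) (Suc q)" by simp
  also have "\<dots> = x i j \<otimes> (chi A x (other i) (other j) q \<otimes> (if even (Suc q) then x i j else x (other i) (other j)))"
    unfolding Suc.IH by simp
  finally show ?case using assms by (simp add: m_assoc)
qed (use assms in simp)

locale suzuki_pos = suzuki_gens A N n mu lam x
  for A :: "('k::field, 'a, 'm) module_scheme" (structure) and N n mu lam x +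
  assumes N_pos: "0 < N" and n_pos: "0 < n" and mu_sq: "mu * mu = 1"
begin

lemma mult_zero': "(i = j) \<noteq> (k = l) \<Longrightarrow> x i j \<otimes> x k l = \<zero>"
  using mult_zero even_idx_num by blast

lemma sq_other: "x (other i) (other j) [^] (2::nat) = x i j [^] (2::nat)"
  using sq_diag sq_off by (cases i; cases j) auto

lemma pow_even_other:
  assumes "even m"
  shows "x (other i) (other j) [^] m = x i j [^] (m::nat)"
proof -
  obtain k where k: "m = 2 * k" using assms by (rule evenE)
  have "x i j [^] m = (x i j [^] (2::nat)) [^] k" for i j
    unfolding k by (rule nat_pow_pow[OF x_closed, symmetric])
  thus ?thesis using sq_other by presburger
qed

lemma pow_even_commute:
  assumes "even m"
  shows "x i j [^] (m::nat) \<otimes> x (other i) (other j) = x (other i) (other j) \<otimes> x i j [^] m"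
  using pow_even_other[OF assms, of i j] nat_pow_Suc2[OF x_closed[of "other i" "other j"], of m] by simp

lemma pow_commute: "x i j [^] (m::nat) \<otimes> x i j = x i j \<otimes> x i j [^] m"
  by (metis nat_pow_Suc nat_pow_Suc2 x_closed)

lemma pow_even_chi:
  assumes "even m"
  shows "x i j [^] (m::nat) \<otimes> chi A x i j q = chi A x i j q \<otimes> x i j [^] m"
proof (induction q arbitrary: i j)
  case (Suc q)
  have "x i j [^] m \<otimes> chi A x i j (Suc q) = x i j \<otimes> (x i j [^] m \<otimes> chi A x (other i) (other j) q)"
    by (simp add: pow_commute flip: m_assoc)
  also have "x i j [^] m \<otimes> chi A x (other i) (other j) q = chi A x (other i) (other j) q \<otimes> x i j [^] m"
    using Suc[of "other i" "other j"] by (simp add: pow_even_other[OF assms])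
  finally show ?case by (simp add: m_assoc)
qed simp

text \<open>The unit is the sum of two orthogonal idempotents: \<open>A\<close> is the product of an algebra generated by
  \<open>x\<^sub>1\<^sub>1, x\<^sub>2\<^sub>2\<close> and one generated by \<open>x\<^sub>1\<^sub>2, x\<^sub>2\<^sub>1\<close>.\<close>

definition E :: "bool \<Rightarrow> 'a" where
  "E p = (if p then x I1 I1 [^] (2 * N) else mu \<odot> (x I1 I2 [^] (2 * N)))"

definition D :: "bool \<Rightarrow> 'a set" where
  "D p = {u \<in> carrier A. E p \<otimes> u = u \<and> u \<otimes> E p = u}"

lemma E_closed [simp, intro]: "E p \<in> carrier A"
  by (simp add: E_def)

lemma E_sum: "E p \<oplus> E (\<not> p) = \<one>"
  using pow_sum by (cases p) (simp_all add: E_def a_comm)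

lemma pow_mult_zero:
  assumes "(i = j) \<noteq> (k = l)" "0 < m"
  shows "x i j [^] (m::nat) \<otimes> x k l = \<zero>" "x k l \<otimes> x i j [^] m = \<zero>"
proof -
  obtain m' where "m = Suc m'" using assms gr0_conv_Suc by blast
  thus "x i j [^] m \<otimes> x k l = \<zero>" using mult_zero'[of i j k l] assms by (simp add: m_assoc)
  show "x k l \<otimes> x i j [^] m = \<zero>"
    using mult_zero'[of k l i j] assms \<open>m = Suc m'\<close>
    by (simp add: nat_pow_Suc2 del: nat_pow_Suc Group.nat_pow_Suc flip: m_assoc)
qed

lemma E_mult_zero: "p \<noteq> (i = j) \<Longrightarrow> E p \<otimes> x i j = \<zero> \<and> x i j \<otimes> E p = \<zero>"
  using pow_mult_zero[of I1 I1 i j "2 * N"] pow_mult_zero[of I1 I2 i j "2 * N"] N_pos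
  by (auto simp: E_def smult_mult_left smult_mult_right)

lemma E_mult: "E (i = j) \<otimes> x i j = x i j" "x i j \<otimes> E (i = j) = x i j"
proof -
  have "(E (i = j) \<oplus> E (i \<noteq> j)) \<otimes> x i j = x i j" "x i j \<otimes> (E (i = j) \<oplus> E (i \<noteq> j)) = x i j"
    by (simp_all add: E_sum)
  thus "E (i = j) \<otimes> x i j = x i j" "x i j \<otimes> E (i = j) = x i j"
    using E_mult_zero[of "i \<noteq> j" i j] by (simp_all add: l_distr r_distr)
qed

lemma x_D: "x i j \<in> D (i = j)"
  using E_mult by (simp add: D_def)

lemma D_closed [dest]: "u \<in> D p \<Longrightarrow> u \<in> carrier A"
  by (simp add: D_def)

lemma D_mult:
  assumes "u \<in> D p" "v \<in> D p"
  shows "u \<otimes> v \<in> D p"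
proof -
  have *: "u \<in> carrier A" "v \<in> carrier A" "E p \<otimes> u = u" "v \<otimes> E p = v"
    using assms by (auto simp: D_def)
  have "E p \<otimes> (u \<otimes> v) = u \<otimes> v" using m_assoc[of "E p" u v] * by simp
  moreover have "u \<otimes> v \<otimes> E p = u \<otimes> v" using m_assoc[of u v "E p"] * by simp
  ultimately show ?thesis using * by (simp add: D_def)
qed

lemma pow_D: "0 < m \<Longrightarrow> x i j [^] (m::nat) \<in> D (i = j)"
proof (induction m)
  case (Suc m)
  thus ?case using x_D[of i j] D_mult[of "x i j [^] m" "i = j" "x i j"] by (cases "m = 0") auto
qed simp

lemma chi_D: "0 < m \<Longrightarrow> chi A x i j m \<in> D (i = j)"
proof (induction m arbitrary: i j)
  case (Suc m)
  thus ?case using x_D[of i j] D_mult[of "x i j" "i = j" "chi A x (other i) (other j) m"]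
      Suc.IH[of "other i" "other j"]
    by (cases "m = 0") auto
qed simp

lemma E_mult_E_zero: "p \<noteq> q \<Longrightarrow> E p \<otimes> E q = \<zero>"
proof -
  assume "p \<noteq> q"
  have "x I1 I1 [^] (2 * N) \<otimes> x I1 I2 [^] (2 * N) = \<zero>" "x I1 I2 [^] (2 * N) \<otimes> x I1 I1 [^] (2 * N) = \<zero>"
    using pow_mult_zero[of I1 I1 I1 I2 "2 * N"] pow_mult_zero[of I1 I2 I1 I1 "2 * N"] N_pos
    by (cases "2 * N"; simp add: nat_pow_Suc2 del: nat_pow_Suc Group.nat_pow_Suc flip: m_assoc)+
  thus ?thesis using \<open>p \<noteq> q\<close> by (cases p; cases q; simp add: E_def smult_mult_left smult_mult_right)
qed

lemma D_mult_zero: "u \<in> D p \<Longrightarrow> v \<in> D q \<Longrightarrow> p \<noteq> q \<Longrightarrow> u \<otimes> v = \<zero>"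
proof -
  assume *: "u \<in> D p" "v \<in> D q" "p \<noteq> q"
  hence c: "u \<in> carrier A" "v \<in> carrier A" by auto
  have "u \<otimes> v = (u \<otimes> E p) \<otimes> (E q \<otimes> v)" using * by (simp add: D_def)
  also have "\<dots> = u \<otimes> (E p \<otimes> E q) \<otimes> v" using c by (simp add: m_assoc)
  finally show "u \<otimes> v = \<zero>" using *(3) c by (simp add: E_mult_E_zero)
qed

lemma pow_N: "x i j [^] (4 * N) = E (i = j)"
proof -
  have E2: "E p \<otimes> E p = E p" for p
  proof -
    have "E p \<otimes> (E p \<oplus> E (\<not> p)) = E p" by (simp add: E_sum)
    thus ?thesis by (simp add: r_distr E_mult_E_zero)
  qed
  have e: "x i j [^] (4 * N) = x i j [^] (2 * N) \<otimes> x i j [^] (2 * N)"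
    by (simp add: nat_pow_mult)
  have p: "x i j [^] (2 * N) = x I1 (if i = j then I1 else I2) [^] (2 * N)"
    using pow_even_other[of "2 * N" i j] by (cases i; cases j) auto
  show ?thesis
  proof (cases "i = j")
    case True
    thus ?thesis unfolding e p using E2[of True] by (simp add: E_def)
  next
    case False
    have "x I1 I2 [^] (2 * N) = mu \<odot> E False" by (simp add: E_def smult_smult mu_sq)
    thus ?thesis unfolding e p using E2[of False] False
      by (simp add: smult_mult_left smult_mult_right smult_smult mu_sq)
  qed
qed

lemma pow_reduce: "0 < m \<Longrightarrow> x i j [^] (4 * N * q + m) = x i j [^] (m::nat)"
proof (induction q)
  case (Suc q)
  have "x i j [^] (4 * N * Suc q + m) = x i j [^] (4 * N) \<otimes> x i j [^] (4 * N * q + m)"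
    by (simp add: nat_pow_mult add.assoc)
  also have "\<dots> = x i j [^] m" using Suc pow_D[of m i j] by (simp add: pow_N D_def)
  finally show ?case .
qed simp

section \<open>The antipode\<close>

definition Aop :: "('k, 'a, 'm) module_scheme" where
  "Aop = A\<lparr>monoid.mult := (\<lambda>a b. b \<otimes> a)\<rparr>"

lemma Aop_simps [simp]:
  "carrier Aop = carrier A" "\<one>\<^bsub>Aop\<^esub> = \<one>" "\<zero>\<^bsub>Aop\<^esub> = \<zero>" "a \<oplus>\<^bsub>Aop\<^esub> b = a \<oplus> b"
  "a \<otimes>\<^bsub>Aop\<^esub> b = b \<otimes> a" "c \<odot>\<^bsub>Aop\<^esub> a = c \<odot> a"
  by (simp_all add: Aop_def)

lemma Aop_kalgebra: "kalgebra Aop"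
proof (rule kalgebraI)
  have "abelian_group Aop"
    by (rule abelian_groupI) (auto simp: a_ac intro!: bexI[of _ "\<ominus> _"] l_neg)
  thus "vspace Aop"
    by (intro vspace.intro vspace_axioms.intro) (auto simp: smult_add_left smult_add_right smult_smult)
  show "bilinear_on Aop Aop Aop (monoid.mult Aop)"
    by (intro bilinear_onI linear_onI) (auto simp: l_distr r_distr smult_mult_left smult_mult_right)
qed (auto simp: m_assoc)

lemma Aop_pow [simp]: "a \<in> carrier A \<Longrightarrow> a [^]\<^bsub>Aop\<^esub> (m::nat) = a [^] m"
proof (induction m)
  case (Suc m)
  thus ?case by (simp add: nat_pow_def) (metis Suc.prems nat_pow_Suc nat_pow_Suc2 nat_pow_def)
qed (simp add: nat_pow_def)

abbreviation "u i j \<equiv> x j i [^] (4 * N - 1)"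

lemma chi_antipode:
  "chi Aop u i j (2 * q) = x j i [^] (2 * (4 * N - 2) * q) \<otimes> chi A x (other j) (other i) (2 * q)"
proof -
  interpret op: kalgebra Aop by (rule Aop_kalgebra)
  let ?z = "x j i [^] (2 * (4 * N - 2))" and ?y = "x (other j) (other i) \<otimes> x j i"
  have ev: "even (4 * N - 2)" by simp
  have S: "4 * N - 1 = Suc (4 * N - 2)" using N_pos by simp
  have "chi Aop u i j (2 * q) = (u (other i) (other j) \<otimes> u i j) [^] q"
    using op.chi_even[of u i j q] by (simp add: Aop_simps)
  also have "u (other i) (other j) \<otimes> u i j
      = (x j i [^] (4 * N - 2) \<otimes> x (other j) (other i)) \<otimes> (x j i \<otimes> x j i [^] (4 * N - 2))"
    unfolding S nat_pow_Suc by (simp add: pow_even_other pow_commute)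
  also have "\<dots> = x j i [^] (4 * N - 2) \<otimes> x (other j) (other i) \<otimes> x j i [^] (4 * N - 2) \<otimes> x j i"
    by (simp add: m_assoc pow_commute)
  also have "\<dots> = ?z \<otimes> ?y"
    by (simp add: m_assoc nat_pow_mult mult_2 flip: pow_even_commute[OF ev])
       (simp add: nat_pow_mult flip: m_assoc)
  also have "(?z \<otimes> ?y) [^] q = ?z [^] q \<otimes> ?y [^] q"
  proof (rule pow_mult_distrib)
    have "?z \<otimes> ?y = x (other j) (other i) \<otimes> (?z \<otimes> x j i)"
      by (simp add: pow_even_commute flip: m_assoc)
    thus "?z \<otimes> ?y = ?y \<otimes> ?z" by (simp add: m_assoc pow_commute)
  qed auto
  also have "?y [^] q = chi A x (other j) (other i) (2 * q)"
    using chi_even[of x "other j" "other i" q] by simp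
  finally show ?thesis by (simp add: nat_pow_pow)
qed

lemma antipode_gens: "suzuki_gens Aop N n mu lam u"
proof (intro suzuki_gens.intro suzuki_gens_axioms.intro Aop_kalgebra)
  have sq: "u i j [^]\<^bsub>Aop\<^esub> (2::nat) = u (other i) (other j) [^]\<^bsub>Aop\<^esub> (2::nat)" for i j
    by (simp add: nat_pow_pow pow_even_other)
  show "u I1 I1 [^]\<^bsub>Aop\<^esub> (2::nat) = u I2 I2 [^]\<^bsub>Aop\<^esub> (2::nat)" using sq[of I1 I1] by simp
  show "u I1 I2 [^]\<^bsub>Aop\<^esub> (2::nat) = u I2 I1 [^]\<^bsub>Aop\<^esub> (2::nat)" using sq[of I1 I2] by simp
  have ev: "even (2 * (4 * N - 2) * n)" by simp
  show "chi Aop u I2 I1 (2 * n) = lam \<odot>\<^bsub>Aop\<^esub> chi Aop u I1 I2 (2 * n)"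
    unfolding chi_antipode using pow_even_other[OF ev, of I1 I2] by (simp add: chi_off smult_mult_right)
  show "chi Aop u I1 I1 (2 * n) = chi Aop u I2 I2 (2 * n)"
    unfolding chi_antipode using pow_even_other[OF ev, of I1 I1] by (simp add: chi_diag)
  have p: "x i j [^] ((4 * N - 1) * (2 * N)) = x i j [^] (2 * N)" for i j
  proof -
    obtain M where "N = Suc M" using N_pos gr0_conv_Suc by blast
    hence "(4 * N - 1) * (2 * N) = 4 * N * (2 * N - 1) + 2 * N"
      by (simp add: algebra_simps)
    thus ?thesis using N_pos by (simp only: pow_reduce)
  qed
  show "u I1 I1 [^]\<^bsub>Aop\<^esub> (2 * N) \<oplus>\<^bsub>Aop\<^esub> mu \<odot>\<^bsub>Aop\<^esub> (u I1 I2 [^]\<^bsub>Aop\<^esub> (2 * N)) = \<one>\<^bsub>Aop\<^esub>"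
    using pow_sum pow_even_other[of "2 * N" I1 I2] by (simp add: nat_pow_pow p[unfolded One_nat_def])
  show "u i j \<otimes>\<^bsub>Aop\<^esub> u k l = \<zero>\<^bsub>Aop\<^esub>"
    if "odd (idx_num i + idx_num j + idx_num k + idx_num l)" for i j k l
  proof -
    have pos: "0 < 4 * N - 1" using N_pos by simp
    have "(l = k) \<noteq> (j = i)" using that even_idx_num[of i j k l] by blast
    from D_mult_zero[OF pow_D[OF pos] pow_D[OF pos] this] show ?thesis by simp
  qed
qed simp

section \<open>The comultiplication\<close>

interpretation TA: kalgebra_pair A A
  by unfold_locales

interpretation TT: kalgebra TA.T
  by (rule TA.tensor_kalgebra)

abbreviation "AA \<equiv> tensor A A"
abbreviation "tp \<equiv> pure_tensor A A"

definition comul :: "idx \<Rightarrow> idx \<Rightarrow> ('a \<times> 'a \<Rightarrow>\<^sub>0 'k) set" where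
  "comul i j = tp (x i I1) (x I1 j) \<oplus>\<^bsub>AA\<^esub> tp (x i I2) (x I2 j)"

text \<open>The shape \<open>\<Delta> g\<^sub>i\<^sub>j = \<Sum>\<^sub>a g\<^sub>i\<^sub>a \<otimes> g\<^sub>a\<^sub>j\<close> is preserved by entrywise products.\<close>

lemma comatrix_mult:
  assumes f: "\<And>i j. f i j \<in> D (i = j)" and g: "\<And>i j. g i j \<in> D (i = j)"
  shows "(tp (f i I1) (f I1 j) \<oplus>\<^bsub>AA\<^esub> tp (f i I2) (f I2 j)) \<otimes>\<^bsub>AA\<^esub> (tp (g k I1) (g I1 l) \<oplus>\<^bsub>AA\<^esub> tp (g k I2) (g I2 l))
    = (if (i = j) = (k = l)
       then tp (f i I1 \<otimes> g k (if i = k then I1 else I2)) (f I1 j \<otimes> g (if i = k then I1 else I2) l) \<oplus>\<^bsub>AA\<^esub>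
            tp (f i I2 \<otimes> g k (if i = k then I2 else I1)) (f I2 j \<otimes> g (if i = k then I2 else I1) l)
       else \<zero>\<^bsub>AA\<^esub>)"
proof -
  have c: "f i j \<in> carrier A" "g i j \<in> carrier A" for i j
    using D_closed[OF f[of i j]] D_closed[OF g[of i j]] .
  have z: "f i j \<otimes> g k l = \<zero>" if "(i = j) \<noteq> (k = l)" for i j k l
    using D_mult_zero[OF f g that] .
  show ?thesis
    by (cases i; cases j; cases k; cases l)
       (simp_all add: c z TT.l_distr TT.r_distr TA.pt_mult TA.T.a_ac)
qed

lemma comul_closed [simp, intro]: "comul i j \<in> carrier AA"
  by (simp add: comul_def)

lemma comul_chi:
  "0 < m \<Longrightarrow> chi AA comul i j m
    = tp (chi A x i I1 m) (chi A x I1 j m) \<oplus>\<^bsub>AA\<^esub> tp (chi A x i I2 m) (chi A x I2 j m)"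
proof (induction m arbitrary: i j)
  case (Suc m)
  show ?case
  proof (cases "m = 0")
    case False
    thus ?thesis using Suc.IH[of "other i" "other j"] comatrix_mult[where f = x and g = "\<lambda>i j. chi A x i j m", OF x_D chi_D,
        of i j "other i" "other j"]
      by (cases i; cases j) (simp_all add: comul_def)
  qed (simp add: comul_def)
qed simp

lemma comul_pow:
  fixes m :: nat
  assumes "0 < m"
  shows "comul i j [^]\<^bsub>AA\<^esub> (2 * m)
    = tp (x i I1 [^] (2 * m)) (x I1 j [^] (2 * m)) \<oplus>\<^bsub>AA\<^esub> tp (x i I2 [^] (2 * m)) (x I2 j [^] (2 * m))"
  using assms
proof (induction m)
  case (Suc m)
  have two: "comul i j [^]\<^bsub>AA\<^esub> (2::nat) = tp (x i I1 [^] (2::nat)) (x I1 j [^] (2::nat)) \<oplus>\<^bsub>AA\<^esub> tp (x i I2 [^] (2::nat)) (x I2 j [^] (2::nat))"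
    using comatrix_mult[where f = x and g = x, OF x_D x_D, of i j i j] by (simp add: numeral_2_eq_2) (simp add: comul_def)
  have e: "x i j [^] (2 * Suc m) = x i j [^] (2 * m) \<otimes> x i j [^] (2::nat)" for i j
    by (simp add: nat_pow_mult)
  have "comul i j [^]\<^bsub>AA\<^esub> (2 * Suc m) = comul i j [^]\<^bsub>AA\<^esub> (2 * m) \<otimes>\<^bsub>AA\<^esub> comul i j [^]\<^bsub>AA\<^esub> (2::nat)"
    by (simp add: TT.nat_pow_mult)
  thus ?case
    using Suc.IH two comatrix_mult[where f = "\<lambda>i j. x i j [^] (2 * m)" and g = "\<lambda>i j. x i j [^] (2::nat)",
        OF pow_D pow_D, of i j i j]
    by (cases "m = 0") (simp_all only: e, simp_all)
qed simp

lemma comul_gens: "suzuki_gens AA N n mu lam comul"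
proof (intro suzuki_gens.intro suzuki_gens_axioms.intro TA.tensor_kalgebra comul_closed)
  have p: "x I2 I2 [^] (2 * m) = x I1 I1 [^] (2 * m)" "x I2 I1 [^] (2 * m) = x I1 I2 [^] (2 * m)" for m :: nat
    using pow_even_other[of "2 * m" I1 I1] pow_even_other[of "2 * m" I1 I2] by auto
  show "comul I1 I1 [^]\<^bsub>AA\<^esub> (2::nat) = comul I2 I2 [^]\<^bsub>AA\<^esub> (2::nat)"
    using comul_pow[of 1 I1 I1] comul_pow[of 1 I2 I2] p[of 1] by (simp add: TA.T.a_comm)
  show "comul I1 I2 [^]\<^bsub>AA\<^esub> (2::nat) = comul I2 I1 [^]\<^bsub>AA\<^esub> (2::nat)"
    using comul_pow[of 1 I1 I2] comul_pow[of 1 I2 I1] p[of 1] by (simp add: TA.T.a_comm)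
  show "chi AA comul I2 I1 (2 * n) = lam \<odot>\<^bsub>AA\<^esub> chi AA comul I1 I2 (2 * n)"
    using n_pos by (simp add: comul_chi chi_off chi_diag TA.pt_smult_left TA.pt_smult_right TA.T.smult_add_right TA.T.a_comm)
  show "chi AA comul I1 I1 (2 * n) = chi AA comul I2 I2 (2 * n)"
    using n_pos by (simp add: comul_chi chi_off chi_diag TA.pt_smult_left TA.pt_smult_right TA.T.a_comm)
  have "comul I1 I1 [^]\<^bsub>AA\<^esub> (2 * N) \<oplus>\<^bsub>AA\<^esub> mu \<odot>\<^bsub>AA\<^esub> (comul I1 I2 [^]\<^bsub>AA\<^esub> (2 * N))
    = tp (x I1 I1 [^] (2 * N) \<oplus> mu \<odot> (x I1 I2 [^] (2 * N))) (x I1 I1 [^] (2 * N) \<oplus> mu \<odot> (x I1 I2 [^] (2 * N)))"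
    using N_pos
    by (simp add: comul_pow p TA.pt_add_left TA.pt_add_right TA.pt_smult_left TA.pt_smult_right
        TA.T.smult_add_right TA.T.smult_smult mu_sq TA.T.a_ac)
  thus "comul I1 I1 [^]\<^bsub>AA\<^esub> (2 * N) \<oplus>\<^bsub>AA\<^esub> mu \<odot>\<^bsub>AA\<^esub> (comul I1 I2 [^]\<^bsub>AA\<^esub> (2 * N)) = \<one>\<^bsub>AA\<^esub>"
    by (simp add: pow_sum TA.tensor_one)
  show "comul i j \<otimes>\<^bsub>AA\<^esub> comul k l = \<zero>\<^bsub>AA\<^esub>"
    if "odd (idx_num i + idx_num j + idx_num k + idx_num l)" for i j k l
    using that comatrix_mult[where f = x and g = x, OF x_D x_D, of i j k l] by (simp add: even_idx_num comul_def del: even_add)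
qed

context
  fixes s t :: nat assumes s_pos: "0 < s"
begin

definition G :: "idx \<Rightarrow> idx \<Rightarrow> 'a" where
  "G i j = x i j [^] (2 * s) \<otimes> chi A x i j (2 * t + 1)"

lemma G_D: "G i j \<in> D (i = j)"
  unfolding G_def using s_pos by (intro D_mult pow_D chi_D) auto

lemma G_closed [simp, intro]: "G i j \<in> carrier A"
  using G_D by auto

lemma comul_G:
  "comul i j [^]\<^bsub>AA\<^esub> (2 * s) \<otimes>\<^bsub>AA\<^esub> chi AA comul i j (2 * t + 1)
     = tp (G i I1) (G I1 j) \<oplus>\<^bsub>AA\<^esub> tp (G i I2) (G I2 j)"
  using comatrix_mult[where f = "\<lambda>i j. x i j [^] (2 * s)" and g = "\<lambda>i j. chi A x i j (2 * t + 1)",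
      OF pow_D chi_D, of i j i j] s_pos
  by (simp only: comul_pow comul_chi) (simp add: G_def)

lemma sandwich_other: "x i a \<otimes> G (other i) (other a) \<otimes> x (other i) (other a) [^] (4 * N - 1) = G i a"
proof -
  let ?i = "other i" and ?a = "other a"
  have S: "4 * N - 1 = Suc (4 * N - 2)" "Suc (Suc (4 * N - 2)) = 4 * N" using N_pos by auto
  have "x i a \<otimes> G ?i ?a = x i a [^] (2 * s) \<otimes> chi A x i a (Suc (2 * t + 1))"
    by (simp add: G_def pow_even_other pow_commute flip: m_assoc)
  also have "\<dots> = G i a \<otimes> x ?i ?a"
    unfolding chi_snoc[of x i a "2 * t + 1", OF x_closed] by (simp add: G_def m_assoc)
  finally have "x i a \<otimes> G ?i ?a \<otimes> x ?i ?a [^] (4 * N - 1) = G i a \<otimes> (x ?i ?a \<otimes> x ?i ?a [^] (4 * N - 1))"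
    by (simp add: m_assoc)
  also have "x ?i ?a \<otimes> x ?i ?a [^] (4 * N - 1) = E (i = a)"
    using pow_N[of ?i ?a] by (simp only: S(1) flip: nat_pow_Suc2[OF x_closed]) (simp add: S(2))
  finally show ?thesis using G_D[of i a] by (simp add: D_def)
qed

lemma sandwich_same: "x i a \<otimes> G i a \<otimes> x (other i) (other a) [^] (4 * N - 1) = G (other i) (other a)"
proof -
  let ?i = "other i" and ?a = "other a"
  let ?c = "chi A x ?i ?a"
  have S: "4 * N - 1 = Suc (4 * N - 2)" using N_pos by auto
  have "x i a \<otimes> G i a = x i a [^] (2 * s) \<otimes> (x i a \<otimes> x i a) \<otimes> ?c (2 * t)"
    by (simp add: G_def flip: m_assoc pow_commute)
  also have "x i a \<otimes> x i a = x ?i ?a [^] (2::nat)" by (simp add: sq_other) (simp add: numeral_2_eq_2)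
  also have "x i a [^] (2 * s) \<otimes> x ?i ?a [^] (2::nat) = x ?i ?a [^] (2 * s + 2)"
    by (subst pow_even_other[of "2 * s" i a, symmetric], simp, rule nat_pow_mult, rule x_closed)
  finally have "x i a \<otimes> G i a \<otimes> x ?i ?a [^] (4 * N - 1)
      = x ?i ?a [^] (2 * s + 2) \<otimes> (?c (2 * t) \<otimes> x ?i ?a) \<otimes> x ?i ?a [^] (4 * N - 2)"
    unfolding S by (simp add: nat_pow_Suc2 m_assoc del: nat_pow_Suc Group.nat_pow_Suc)
  also have "?c (2 * t) \<otimes> x ?i ?a = ?c (2 * t + 1)"
    using chi_snoc[of x ?i ?a "2 * t", OF x_closed] by simp
  also have "x ?i ?a [^] (2 * s + 2) \<otimes> ?c (2 * t + 1) \<otimes> x ?i ?a [^] (4 * N - 2)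
      = x ?i ?a [^] (2 * s + 2) \<otimes> x ?i ?a [^] (4 * N - 2) \<otimes> ?c (2 * t + 1)"
    using pow_even_chi[of "4 * N - 2" ?i ?a "2 * t + 1"] by (simp add: m_assoc del: chi.simps)
  also have "x ?i ?a [^] (2 * s + 2) \<otimes> x ?i ?a [^] (4 * N - 2) = x ?i ?a [^] (4 * N * 1 + 2 * s)"
  proof -
    have "2 * s + 2 + (4 * N - 2) = 4 * N * 1 + 2 * s" using N_pos by simp
    thus ?thesis using nat_pow_mult[of "x ?i ?a" "2 * s + 2" "4 * N - 2"] by (simp only: x_closed)
  qed
  also have "\<dots> = x ?i ?a [^] (2 * s)" using s_pos by (intro pow_reduce) simp
  finally show ?thesis by (simp add: G_def)
qed

end

end

lemma kalgebra_cong: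
  assumes "kalgebra A" "carrier B = carrier A" "\<zero>\<^bsub>B\<^esub> = \<zero>\<^bsub>A\<^esub>" "(\<oplus>\<^bsub>B\<^esub>) = (\<oplus>\<^bsub>A\<^esub>)" "(\<odot>\<^bsub>B\<^esub>) = (\<odot>\<^bsub>A\<^esub>)"
    "monoid.mult B = monoid.mult A" "\<one>\<^bsub>B\<^esub> = \<one>\<^bsub>A\<^esub>"
  shows "kalgebra B"
proof -
  interpret A: kalgebra A by fact
  show ?thesis
    by (intro kalgebraI vspace_cong[OF A.vspace_axioms] assms(2-5) bilinear_onI linear_onI)
       (simp_all add: assms(2-) A.l_distr A.r_distr A.smult_mult_left A.smult_mult_right A.m_assoc)
qed

lemma linear_on_cong:
  assumes "carrier V' = carrier V" "(\<oplus>\<^bsub>V'\<^esub>) = (\<oplus>\<^bsub>V\<^esub>)" "(\<odot>\<^bsub>V'\<^esub>) = (\<odot>\<^bsub>V\<^esub>)"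
    "carrier W' = carrier W" "(\<oplus>\<^bsub>W'\<^esub>) = (\<oplus>\<^bsub>W\<^esub>)" "(\<odot>\<^bsub>W'\<^esub>) = (\<odot>\<^bsub>W\<^esub>)"
  shows "linear_on V' W' F = linear_on V W F"
  by (simp add: linear_on_def assms)

lemma
  assumes "carrier V' = carrier V" "(\<oplus>\<^bsub>V'\<^esub>) = (\<oplus>\<^bsub>V\<^esub>)" "(\<odot>\<^bsub>V'\<^esub>) = (\<odot>\<^bsub>V\<^esub>)"
    "monoid.mult V' = monoid.mult V" "\<one>\<^bsub>V'\<^esub> = \<one>\<^bsub>V\<^esub>"
    "carrier W' = carrier W" "(\<oplus>\<^bsub>W'\<^esub>) = (\<oplus>\<^bsub>W\<^esub>)" "(\<odot>\<^bsub>W'\<^esub>) = (\<odot>\<^bsub>W\<^esub>)"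
    "monoid.mult W' = monoid.mult W" "\<one>\<^bsub>W'\<^esub> = \<one>\<^bsub>W\<^esub>"
  shows tensor_cong: "tensor V' W' = tensor V W"
    and pure_tensor_cong: "pure_tensor V' W' = pure_tensor V W"
proof -
  have f: "formal_tensors V' W' = formal_tensors V W" by (simp add: formal_tensors_def assms)
  have r: "tensor_relators V' W' = tensor_relators V W" by (simp add: tensor_relators_def assms)
  show "tensor V' W' = tensor V W" by (simp add: tensor_def tensor_null_def f r)
  show "pure_tensor V' W' = pure_tensor V W"
    by (intro ext) (simp add: pure_tensor_def tensor_null_def f r)
qed

lemma scalar_alg_simps [simp]:
  "carrier scalar_alg = UNIV" "\<zero>\<^bsub>scalar_alg\<^esub> = 0" "\<one>\<^bsub>scalar_alg\<^esub> = 1"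
  "a \<oplus>\<^bsub>scalar_alg\<^esub> b = a + b" "a \<otimes>\<^bsub>scalar_alg\<^esub> b = a * b" "c \<odot>\<^bsub>scalar_alg\<^esub> a = c * a"
  by (simp_all add: scalar_alg_def)

lemma scalar_alg_kalgebra: "kalgebra scalar_alg"
proof -
  have "abelian_group (scalar_alg :: ('k::field, 'k) module)"
    by (rule abelian_groupI) (auto simp: add_ac intro: exI[of _ "- _"])
  hence "vspace (scalar_alg :: ('k::field, 'k) module)"
    by (intro vspace.intro vspace_axioms.intro) (simp_all add: algebra_simps)
  thus ?thesis
    by (intro kalgebraI bilinear_onI linear_onI) (simp_all add: algebra_simps)
qed

section \<open>Braided planes of type \<open>V\<^sub>a\<^sub>b\<^sub>e\<close>\<close>

lemma V_abe_simps [simp]: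
  "carrier (V_abe a b e) = UNIV" "\<zero>\<^bsub>V_abe a b e\<^esub> = 0" "v \<oplus>\<^bsub>V_abe a b e\<^esub> w = v + w"
  "c \<odot>\<^bsub>V_abe a b e\<^esub> v = Poly_Mapping.map ((*) c) v"
  by (simp_all add: V_abe_def Let_def module.extend_def free_mod_def)

lemma V_abe_vspace: "vspace (V_abe a b e)"
  by (rule vspace_cong[OF free_mod_vspace[of UNIV]]) (auto simp: fun_eq_iff)

lemma (in vspace) lin_ext_param_linear:
  assumes "\<And>i. linear_on Y V (B i)" "vspace Y"
  shows "linear_on Y V (\<lambda>y. lin_ext V (\<lambda>i. B i y) f)"
proof -
  interpret Y: vspace Y by fact
  have c: "y \<in> carrier Y \<Longrightarrow> B i y \<in> carrier V" for i y using linear_on_closed[OF assms(1)] .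
  have lin: "linear_on (free_mod UNIV) V (lin_ext V (\<lambda>i. B i y))" if "y \<in> carrier Y" for y
    by (rule lin_ext_linear) (rule c[OF that])
  have "Poly_Mapping.keys f \<subseteq> UNIV" by simp
  thus ?thesis
  proof (induction f rule: poly_mapping_induct)
    case zero
    show ?case by (rule linear_onI) auto
  next
    case (single i d)
    show ?case
      by (rule linear_onI)
         (simp_all add: lin_ext_single c linear_on_add[OF assms(1)] linear_on_smult[OF assms(1)]
           smult_add_right smult_smult mult.commute)
  next
    case (add f g)
    have eq: "lin_ext V (\<lambda>i. B i y) (f + g) = lin_ext V (\<lambda>i. B i y) f \<oplus> lin_ext V (\<lambda>i. B i y) g"
      if "y \<in> carrier Y" for y using linear_on_add[OF lin[OF that], of f g] by simp
    have "linear_on Y V (\<lambda>y. lin_ext V (\<lambda>i. B i y) f \<oplus> lin_ext V (\<lambda>i. B i y) g)"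
      by (intro linear_on_addI add.IH vspace_axioms)
    thus ?case by (simp add: linear_on_def eq Pi_iff)
  qed
qed

definition V_abe_braid :: "'k::field \<Rightarrow> 'k \<Rightarrow> 'k \<Rightarrow> (idx \<Rightarrow>\<^sub>0 'k) \<Rightarrow> (idx \<Rightarrow>\<^sub>0 'k) \<Rightarrow> ((idx \<Rightarrow>\<^sub>0 'k) \<times> (idx \<Rightarrow>\<^sub>0 'k) \<Rightarrow>\<^sub>0 'k) set"
  where "V_abe_braid a b e x y = (let V = V_abe a b e; T = tensor V V;
       c = (\<lambda>i j. case (i, j) of
              (I1, I1) \<Rightarrow> a \<odot>\<^bsub>T\<^esub> pure_tensor V V (basis I2) (basis I2)
            | (I1, I2) \<Rightarrow> b \<odot>\<^bsub>T\<^esub> pure_tensor V V (basis I1) (basis I2)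
            | (I2, I1) \<Rightarrow> b \<odot>\<^bsub>T\<^esub> pure_tensor V V (basis I2) (basis I1)
            | (I2, I2) \<Rightarrow> e \<odot>\<^bsub>T\<^esub> pure_tensor V V (basis I1) (basis I1))
     in lin_ext T (\<lambda>i. lin_ext T (c i) y) x)"

lemma V_abe_fields:
  "carrier (V_abe a b e) = carrier (free_mod UNIV)" "(\<oplus>\<^bsub>V_abe a b e\<^esub>) = (\<oplus>\<^bsub>free_mod UNIV\<^esub>)"
  "(\<odot>\<^bsub>V_abe a b e\<^esub>) = (\<odot>\<^bsub>free_mod UNIV\<^esub>)" "monoid.mult (V_abe a b e) = monoid.mult (free_mod UNIV)"
  "\<one>\<^bsub>V_abe a b e\<^esub> = \<one>\<^bsub>free_mod UNIV\<^esub>"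
  by (simp_all add: V_abe_def Let_def module.extend_def)

lemma V_abe_braid_eq:
  "braid (V_abe a b e) = tensor_lift (tensor (V_abe a b e) (V_abe a b e)) (V_abe_braid a b e)"
proof -
  note cong = tensor_cong[OF V_abe_fields V_abe_fields] pure_tensor_cong[OF V_abe_fields V_abe_fields]
  show ?thesis
    unfolding V_abe_braid_def[abs_def] cong Let_def
    by (simp add: V_abe_def Let_def module.extend_def)
qed

locale braided_plane_target =
  fixes a b e :: "'k::field"
begin

abbreviation "W \<equiv> V_abe a b e"

sublocale W: vspace W by (rule V_abe_vspace)
sublocale WW: vspace_pair W W by unfold_locales

lemma V_abe_braid_bilinear: "bilinear_on W W WW.T (V_abe_braid a b e)"
proof -
  define c where "c = (\<lambda>i j. case (i, j) of
              (I1, I1) \<Rightarrow> a \<odot>\<^bsub>WW.T\<^esub> WW.pt (basis I2) (basis I2)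
            | (I1, I2) \<Rightarrow> b \<odot>\<^bsub>WW.T\<^esub> WW.pt (basis I1) (basis I2)
            | (I2, I1) \<Rightarrow> b \<odot>\<^bsub>WW.T\<^esub> WW.pt (basis I2) (basis I1)
            | (I2, I2) \<Rightarrow> e \<odot>\<^bsub>WW.T\<^esub> WW.pt (basis I1) (basis I1))"
  have eq: "V_abe_braid a b e = (\<lambda>x y. lin_ext WW.T (\<lambda>i. lin_ext WW.T (c i) y) x)"
    by (simp add: fun_eq_iff V_abe_braid_def c_def Let_def)
  have c: "c i j \<in> carrier WW.T" for i j by (cases i; cases j) (auto simp: c_def)
  have W: "linear_on W U = linear_on (free_mod UNIV) U" for U :: "('k, 'u, 'm) module_scheme"
    by (simp add: linear_on_def fun_eq_iff)
  have lin: "linear_on W WW.T (lin_ext WW.T (c i))" for i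
    unfolding W by (rule WW.T.lin_ext_linear[OF c])
  show ?thesis
    unfolding eq
  proof (rule bilinear_onI)
    fix x show "linear_on W WW.T (\<lambda>y. lin_ext WW.T (\<lambda>i. lin_ext WW.T (c i) y) x)"
      by (rule WW.T.lin_ext_param_linear[OF lin W.vspace_axioms])
  next
    fix y assume "y \<in> carrier W"
    show "linear_on W WW.T (lin_ext WW.T (\<lambda>i. lin_ext WW.T (c i) y))"
      unfolding W by (rule WW.T.lin_ext_linear) (use linear_on_closed[OF lin] in simp)
  qed
qed

lemma V_abe_braid_basis:
  "V_abe_braid a b e (basis I1) (basis I1) = a \<odot>\<^bsub>WW.T\<^esub> WW.pt (basis I2) (basis I2)"
  "V_abe_braid a b e (basis I1) (basis I2) = b \<odot>\<^bsub>WW.T\<^esub> WW.pt (basis I1) (basis I2)"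
  "V_abe_braid a b e (basis I2) (basis I1) = b \<odot>\<^bsub>WW.T\<^esub> WW.pt (basis I2) (basis I1)"
  "V_abe_braid a b e (basis I2) (basis I2) = e \<odot>\<^bsub>WW.T\<^esub> WW.pt (basis I1) (basis I1)"
  by (simp_all add: V_abe_braid_def Let_def)

end

locale vspace_plane = vspace V for V :: "('k::field, 'v, 'm) module_scheme" (structure) +
  fixes w1 w2 :: 'v
  assumes w_closed [simp, intro]: "w1 \<in> carrier V" "w2 \<in> carrier V"
begin

definition comb where "comb \<alpha> \<beta> = \<alpha> \<odot> w1 \<oplus> \<beta> \<odot> w2"

definition plane where "plane = {comb \<alpha> \<beta> | \<alpha> \<beta>. True}"

lemma comb_plane [simp, intro]: "comb \<alpha> \<beta> \<in> plane"
  by (auto simp: plane_def)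

lemma planeE: "u \<in> plane \<Longrightarrow> (\<And>\<alpha> \<beta>. u = comb \<alpha> \<beta> \<Longrightarrow> thesis) \<Longrightarrow> thesis"
  by (auto simp: plane_def)

lemma comb_add: "comb \<alpha> \<beta> \<oplus> comb \<alpha>' \<beta>' = comb (\<alpha> + \<alpha>') (\<beta> + \<beta>')"
  by (simp add: comb_def smult_add_left a_ac)

lemma comb_smult: "\<gamma> \<odot> comb \<alpha> \<beta> = comb (\<gamma> * \<alpha>) (\<gamma> * \<beta>)"
  by (simp add: comb_def smult_add_right smult_smult)

lemma w_plane [simp, intro]: "w1 \<in> plane" "w2 \<in> plane"
  using comb_plane[of 1 0] comb_plane[of 0 1] by (simp_all add: comb_def)

lemma plane_closed: "u \<in> plane \<Longrightarrow> u \<in> carrier V"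
  by (auto simp: plane_def comb_def)

lemma plane_add: "u \<in> plane \<Longrightarrow> v \<in> plane \<Longrightarrow> u \<oplus> v \<in> plane"
  by (elim planeE) (simp add: comb_add)

lemma plane_smult: "u \<in> plane \<Longrightarrow> \<gamma> \<odot> u \<in> plane"
  by (elim planeE) (simp add: comb_smult)

lemma plane_zero: "\<zero> \<in> plane"
  using plane_smult[OF w_plane(1), of 0] by simp

lemma plane_vsubspace: "vsubspace plane V"
  by (intro subspaceI plane_zero plane_add plane_smult) (auto simp: plane_closed)

end

text \<open>A plane \<open>\<langle>w\<^sub>1, w\<^sub>2\<rangle>\<close> in a Yetter-Drinfeld module; the functionals \<open>f\<^sub>1, f\<^sub>2\<close> give the
  retraction onto it that makes \<open>A \<otimes> U \<rightarrow> A \<otimes> M\<close> injective.\<close>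

locale yd_plane = braided_plane_target a b e + A: vspace A + M: vspace_plane M w1 w2
  for a b e :: "'k::field" and A :: "('k, 'a, 'm) hopf_scheme" and M :: "('k, 'a, 'v, 'n) yd_scheme" (structure) and w1 w2 +
  fixes f1 f2 :: "'v \<Rightarrow> 'k" and g11 g12 g21 g22 :: 'a and c d :: 'k
  assumes g_closed [simp, intro]: "g11 \<in> carrier A" "g12 \<in> carrier A" "g21 \<in> carrier A" "g22 \<in> carrier A"
    and f1: "linear_on M scalar_alg f1" and f2: "linear_on M scalar_alg f2"
    and f_w: "f1 w1 = 1" "f1 w2 = 0" "f2 w1 = 0" "f2 w2 = 1"
    and act_bilinear: "bilinear_on A M M (act M)"
    and coact_linear: "linear_on M (tensor A M) (coact M)"
    and coact_w: "coact M w1 = pure_tensor A M g22 w1 \<oplus>\<^bsub>tensor A M\<^esub> c \<odot>\<^bsub>tensor A M\<^esub> pure_tensor A M g21 w2"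
      "coact M w2 = pure_tensor A M g11 w2 \<oplus>\<^bsub>tensor A M\<^esub> d \<odot>\<^bsub>tensor A M\<^esub> pure_tensor A M g12 w1"
    and act_w_stable: "\<And>h w. h \<in> carrier A \<Longrightarrow> w \<in> {w1, w2} \<Longrightarrow> act M h w \<in> M.plane"
    and act_diag: "\<And>w. w \<in> {w1, w2} \<Longrightarrow> act M g11 w = \<zero> \<and> act M g22 w = \<zero>"
    and act_off: "c \<odot> act M g21 w1 = a \<odot> w2" "c \<odot> act M g21 w2 = b \<odot> w1"
      "d \<odot> act M g12 w1 = b \<odot> w2" "d \<odot> act M g12 w2 = e \<odot> w1"
begin

abbreviation "U \<equiv> M.plane"

definition H where "H = yd_sub A M U"

lemmas U_closed = M.plane_closed

lemma H_simps [simp]: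
  "carrier H = U" "\<zero>\<^bsub>H\<^esub> = \<zero>" "(\<oplus>\<^bsub>H\<^esub>) = (\<oplus>)" "(\<odot>\<^bsub>H\<^esub>) = (\<odot>)" "act H = act M"
  by (simp_all add: H_def yd_sub_def)

lemma H_vspace: "vspace H"
  by (rule vspace_cong[OF M.subspace_vspace[OF M.plane_vsubspace]]) simp_all

sublocale H: vspace H by (rule H_vspace)
sublocale HH: vspace_pair H H by unfold_locales
sublocale AH: vspace_pair A H by unfold_locales
sublocale AM: vspace_pair A M by unfold_locales

lemma tensor_AU:
  "tensor A (M\<lparr>carrier := U\<rparr>) = AH.T" "pure_tensor A (M\<lparr>carrier := U\<rparr>) = AH.pt"
  by (rule tensor_cong pure_tensor_cong; simp add: H_def yd_sub_def)+

lemma f_comb: "f1 (M.comb \<alpha> \<beta>) = \<alpha>" "f2 (M.comb \<alpha> \<beta>) = \<beta>"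
  by (simp_all add: M.comb_def linear_on_add[OF f1] linear_on_smult[OF f1] linear_on_add[OF f2] linear_on_smult[OF f2] f_w)

definition pr where "pr m = M.comb (f1 m) (f2 m)"

lemma pr_U: "u \<in> U \<Longrightarrow> pr u = u"
  unfolding pr_def by (auto simp: M.plane_def f_comb)

lemma pr_linear: "linear_on M H pr"
  by (rule linear_onI)
     (simp_all add: pr_def M.comb_add M.comb_smult linear_on_add[OF f1] linear_on_smult[OF f1]
        linear_on_add[OF f2] linear_on_smult[OF f2])

lemma H_M_linear: "linear_on H M (\<lambda>u. u)"
  by (rule linear_onI) (auto intro: U_closed)

lemma id_linear: "linear_on V V (\<lambda>x. x)"
  by (rule linear_onI) auto

abbreviation "incl \<equiv> tensor_lift AM.T AM.pt"
abbreviation "retr \<equiv> tensor_lift AH.T (\<lambda>g m. AH.pt g (pr m))"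

lemma incl_bil: "bilinear_on A H AM.T AM.pt"
  using bilinear_on_comp[OF AM.pt_bilinear id_linear H_M_linear] .

lemma retr_bil: "bilinear_on A M AH.T (\<lambda>g m. AH.pt g (pr m))"
  using bilinear_on_comp[OF AH.pt_bilinear id_linear pr_linear] .

lemmas incl_linear = AH.tensor_lift_linear[OF AM.tensor_vspace incl_bil]
  and incl_pure = AH.tensor_lift_pure[OF AM.tensor_vspace incl_bil]
  and retr_linear = AM.tensor_lift_linear[OF AH.tensor_vspace retr_bil]
  and retr_pure = AM.tensor_lift_pure[OF AH.tensor_vspace retr_bil]

lemma retr_incl: "t \<in> carrier AH.T \<Longrightarrow> retr (incl t) = t"
  by (rule AH.tensor_linear_unique[OF linear_on_comp[OF incl_linear retr_linear] id_linear])
     (simp_all add: incl_pure retr_pure pr_U U_closed)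

lemma AH_coact_w:
  "retr (coact M w1) = AH.pt g22 w1 \<oplus>\<^bsub>AH.T\<^esub> c \<odot>\<^bsub>AH.T\<^esub> AH.pt g21 w2"
  "retr (coact M w2) = AH.pt g11 w2 \<oplus>\<^bsub>AH.T\<^esub> d \<odot>\<^bsub>AH.T\<^esub> AH.pt g12 w1"
  by (simp_all add: coact_w linear_on_add[OF retr_linear] linear_on_smult[OF retr_linear] retr_pure pr_U)

lemma incl_retr_coact:
  assumes "u \<in> U"
  shows "incl (retr (coact M u)) = coact M u"
proof -
  note lin = linear_on_comp[OF coact_linear linear_on_comp[OF retr_linear incl_linear]]
  have w: "incl (retr (coact M w1)) = coact M w1" "incl (retr (coact M w2)) = coact M w2"
    unfolding AH_coact_w by (simp_all add: linear_on_add[OF incl_linear] linear_on_smult[OF incl_linear] incl_pure coact_w)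
  obtain \<alpha> \<beta> where "u = M.comb \<alpha> \<beta>" using assms by (rule M.planeE)
  moreover have "incl (retr (coact M (M.comb \<alpha> \<beta>))) = coact M (M.comb \<alpha> \<beta>)"
    using linear_on_add[OF lin, of "\<alpha> \<odot> w1" "\<beta> \<odot> w2"] linear_on_smult[OF lin, of w1 \<alpha>]
      linear_on_smult[OF lin, of w2 \<beta>] w
    by (simp add: M.comb_def linear_on_add[OF coact_linear] linear_on_smult[OF coact_linear])
  ultimately show ?thesis by simp
qed

lemma coact_H:
  assumes "u \<in> U"
  shows "coact H u = retr (coact M u)"
proof -
  have "coact (yd_sub A M U) u = (THE t. t \<in> carrier AH.T \<and> incl t = coact M u)"
    by (simp add: yd_sub_def tensor_AU)
  hence "coact H u = (THE t. t \<in> carrier AH.T \<and> incl t = coact M u)"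
    by (simp only: H_def[symmetric])
  also have "\<dots> = retr (coact M u)"
  proof (rule the_equality)
    show "retr (coact M u) \<in> carrier AH.T \<and> incl (retr (coact M u)) = coact M u"
      using incl_retr_coact[OF assms] linear_on_closed[OF linear_on_comp[OF coact_linear retr_linear]] U_closed[OF assms]
      by blast
    fix t assume "t \<in> carrier AH.T \<and> incl t = coact M u"
    thus "t = retr (coact M u)" using retr_incl[of t] by metis
  qed
  finally show ?thesis .
qed

lemma coact_H_linear: "linear_on H AH.T (coact H)"
proof -
  note lin = linear_on_comp[OF H_M_linear linear_on_comp[OF coact_linear retr_linear]]
  show ?thesis
    using lin H.a_closed H.smult_closed unfolding linear_on_def by (simp add: coact_H Pi_iff)
qed

lemma act_stable:
  assumes "h \<in> carrier A" "u \<in> U"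
  shows "act M h u \<in> U"
proof -
  note lin = bilinear_on_right[OF act_bilinear assms(1)]
  obtain \<alpha> \<beta> where u: "u = M.comb \<alpha> \<beta>" using assms(2) by (rule M.planeE)
  have "act M h w1 \<in> U" "act M h w2 \<in> U" using act_w_stable[OF assms(1)] by auto
  thus ?thesis
    by (simp add: u M.comb_def M.plane_add M.plane_smult linear_on_add[OF lin] linear_on_smult[OF lin])
qed

lemma act_H_bilinear: "bilinear_on A H H (act M)"
proof (intro bilinear_onI linear_onI)
  fix h u v assume "h \<in> carrier A" "u \<in> carrier H" "v \<in> carrier H"
  thus "act M h (u \<oplus>\<^bsub>H\<^esub> v) = act M h u \<oplus>\<^bsub>H\<^esub> act M h v"
    using linear_on_add[OF bilinear_on_right[OF act_bilinear]] U_closed by simp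
next
  fix h u \<gamma> assume "h \<in> carrier A" "u \<in> carrier H"
  thus "act M h (\<gamma> \<odot>\<^bsub>H\<^esub> u) = \<gamma> \<odot>\<^bsub>H\<^esub> act M h u"
    using linear_on_smult[OF bilinear_on_right[OF act_bilinear]] U_closed by simp
next
  fix u h h' assume "u \<in> carrier H" "h \<in> carrier A" "h' \<in> carrier A"
  thus "act M (h \<oplus>\<^bsub>A\<^esub> h') u = act M h u \<oplus>\<^bsub>H\<^esub> act M h' u"
    using linear_on_add[OF bilinear_on_left[OF act_bilinear]] U_closed by simp
next
  fix u h \<gamma> assume "u \<in> carrier H" "h \<in> carrier A"
  thus "act M (\<gamma> \<odot>\<^bsub>A\<^esub> h) u = \<gamma> \<odot>\<^bsub>H\<^esub> act M h u"
    using linear_on_smult[OF bilinear_on_left[OF act_bilinear]] U_closed by simp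
qed (auto intro: act_stable)

definition br where "br x y = tensor_lift HH.T (\<lambda>h x0. HH.pt (act M h y) x0) (coact H x)"

lemma br_inner_bilinear: "y \<in> U \<Longrightarrow> bilinear_on A H HH.T (\<lambda>h x0. HH.pt (act M h y) x0)"
  using bilinear_on_comp[OF HH.pt_bilinear bilinear_on_left[OF act_H_bilinear] id_linear] by simp

lemma br_bilinear: "bilinear_on H H HH.T br"
  unfolding br_def[abs_def]
proof (rule bilinear_onI)
  fix x assume "x \<in> carrier H"
  hence "coact H x \<in> carrier AH.T" by (rule linear_on_closed[OF coact_H_linear])
  thus "linear_on H HH.T (\<lambda>y. tensor_lift HH.T (\<lambda>h x0. HH.pt (act M h y) x0) (coact H x))"
    by (intro AH.tensor_lift_param_linear[OF HH.tensor_vspace] br_inner_bilinear H_vspace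
        linear_on_comp[OF bilinear_on_right[OF act_H_bilinear] bilinear_on_left[OF HH.pt_bilinear]]) auto
next
  fix y assume "y \<in> carrier H"
  thus "linear_on H HH.T (\<lambda>x. tensor_lift HH.T (\<lambda>h x0. HH.pt (act M h y) x0) (coact H x))"
    by (intro linear_on_comp[OF coact_H_linear AH.tensor_lift_linear[OF HH.tensor_vspace br_inner_bilinear]]) auto
qed

lemma br_w:
  "br w1 w1 = a \<odot>\<^bsub>HH.T\<^esub> HH.pt w2 w2" (is ?A) "br w1 w2 = b \<odot>\<^bsub>HH.T\<^esub> HH.pt w1 w2" (is ?B)
  "br w2 w1 = b \<odot>\<^bsub>HH.T\<^esub> HH.pt w2 w1" (is ?C) "br w2 w2 = e \<odot>\<^bsub>HH.T\<^esub> HH.pt w1 w1" (is ?D)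
proof -
  have *: "br w1 y = c \<odot>\<^bsub>HH.T\<^esub> HH.pt (act M g21 y) w2" "br w2 y = d \<odot>\<^bsub>HH.T\<^esub> HH.pt (act M g12 y) w1"
    if y: "y \<in> {w1, w2}" for y
  proof -
    have yU: "y \<in> U" using y by auto
    note bil = br_inner_bilinear[OF yU]
    note lin = AH.tensor_lift_linear[OF HH.tensor_vspace bil]
    note pure = AH.tensor_lift_pure[OF HH.tensor_vspace bil]
    have z: "HH.pt \<zero> w = \<zero>\<^bsub>HH.T\<^esub>" if "w \<in> U" for w using HH.pt_zero_left[of w] that by simp
    show "br w1 y = c \<odot>\<^bsub>HH.T\<^esub> HH.pt (act M g21 y) w2" "br w2 y = d \<odot>\<^bsub>HH.T\<^esub> HH.pt (act M g12 y) w1"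
      using act_diag[OF y] yU
      by (simp_all add: br_def coact_H AH_coact_w linear_on_add[OF lin] linear_on_smult[OF lin] pure z act_stable)
  qed
  have sm: "\<gamma> \<odot>\<^bsub>HH.T\<^esub> HH.pt u v = HH.pt (\<gamma> \<odot> u) v" if "u \<in> U" "v \<in> U" for \<gamma> u v
    using HH.pt_smult_left[of u v \<gamma>] that by simp
  show ?A ?B ?C ?D
    by (simp_all add: * sm act_stable act_off)
qed

definition \<phi> :: "'v \<Rightarrow> idx \<Rightarrow>\<^sub>0 'k" where
  "\<phi> m = Poly_Mapping.single I1 (f1 m) + Poly_Mapping.single I2 (f2 m)"

lemma \<phi>_linear: "linear_on H W \<phi>"
  using U_closed
  by (intro linear_onI)
     (simp_all add: \<phi>_def linear_on_add[OF f1] linear_on_smult[OF f1] linear_on_add[OF f2] linear_on_smult[OF f2]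
        single_add, intro poly_mapping_eqI, simp add: lookup_add lookup_map_times lookup_single algebra_simps when_def)

lemma \<phi>_w: "\<phi> w1 = basis I1" "\<phi> w2 = basis I2"
  by (simp_all add: \<phi>_def f_w)

lemma \<phi>_bij: "bij_betw \<phi> U UNIV"
proof (rule bij_betwI')
  fix u v assume "u \<in> U" "v \<in> U"
  show "\<phi> u = \<phi> v \<longleftrightarrow> u = v"
  proof
    assume eq: "\<phi> u = \<phi> v"
    have "f1 u = f1 v" "f2 u = f2 v"
      using arg_cong[OF eq, of "\<lambda>z. Poly_Mapping.lookup z I1"] arg_cong[OF eq, of "\<lambda>z. Poly_Mapping.lookup z I2"]
      by (simp_all add: \<phi>_def lookup_add lookup_single)
    hence "pr u = pr v" by (simp add: pr_def)
    thus "u = v" using pr_U \<open>u \<in> U\<close> \<open>v \<in> U\<close> by simp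
  qed simp
next
  fix z :: "idx \<Rightarrow>\<^sub>0 'k"
  let ?u = "M.comb (Poly_Mapping.lookup z I1) (Poly_Mapping.lookup z I2)"
  have "z = \<phi> ?u"
  proof (rule poly_mapping_eqI)
    fix i show "Poly_Mapping.lookup z i = Poly_Mapping.lookup (\<phi> ?u) i"
      by (cases i) (simp_all add: \<phi>_def f_comb lookup_add lookup_single)
  qed
  thus "\<exists>u\<in>U. z = \<phi> u" by blast
qed simp

lemma bilinear_unique:
  assumes B: "bilinear_on H H Z B" and B': "bilinear_on H H Z B'"
    and eq: "B w1 w1 = B' w1 w1" "B w1 w2 = B' w1 w2" "B w2 w1 = B' w2 w1" "B w2 w2 = B' w2 w2"
    and u: "u \<in> U" and v: "v \<in> U"
  shows "B u v = B' u v"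
proof -
  have sm: "\<gamma> \<odot> w1 \<in> U" "\<gamma> \<odot> w2 \<in> U" for \<gamma>
    using H.smult_closed[of w1 \<gamma>] H.smult_closed[of w2 \<gamma>] by simp_all
  have r: "G' (M.comb \<alpha> \<beta>) = \<alpha> \<odot>\<^bsub>Z\<^esub> G' w1 \<oplus>\<^bsub>Z\<^esub> \<beta> \<odot>\<^bsub>Z\<^esub> G' w2"
    if "linear_on H Z G'" for G' \<alpha> \<beta>
    using linear_on_add[OF that, of "\<alpha> \<odot> w1" "\<beta> \<odot> w2"] linear_on_smult[OF that, of w1 \<alpha>]
      linear_on_smult[OF that, of w2 \<beta>] sm by (simp add: M.comb_def)
  obtain \<alpha> \<beta> \<alpha>' \<beta>' where uv: "u = M.comb \<alpha> \<beta>" "v = M.comb \<alpha>' \<beta>'"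
    using u v by (auto simp: M.plane_def)
  have w: "B w v = B' w v" if "w \<in> {w1, w2}" for w
    using that r[OF bilinear_on_right[OF B, of w], of \<alpha>' \<beta>'] r[OF bilinear_on_right[OF B', of w], of \<alpha>' \<beta>'] eq
    by (auto simp: uv(2))
  show ?thesis
    using r[OF bilinear_on_left[OF B, of v], of \<alpha> \<beta>] r[OF bilinear_on_left[OF B', of v], of \<alpha> \<beta>] w v
    by (simp add: uv(1))
qed

lemma yd_braided_fields:
  "carrier (yd_braided H) = carrier H" "(\<oplus>\<^bsub>yd_braided H\<^esub>) = (\<oplus>\<^bsub>H\<^esub>)" "(\<odot>\<^bsub>yd_braided H\<^esub>) = (\<odot>\<^bsub>H\<^esub>)"
  "monoid.mult (yd_braided H) = monoid.mult H" "\<one>\<^bsub>yd_braided H\<^esub> = \<one>\<^bsub>H\<^esub>"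
  by (simp_all add: yd_braided_def module.extend_def module.truncate_def del: H_simps)

lemma yd_braided_braid: "braid (yd_braided H) = tensor_lift HH.T br"
  by (simp add: yd_braided_def module.extend_def module.truncate_def br_def[abs_def])

theorem nichols_of_type_V_H:
  assumes "a \<noteq> 0" "b \<noteq> 0" "e \<noteq> 0"
  shows "nichols_of_type_V H a b e"
proof -
  let ?Y = "yd_braided H"
  define \<phi>\<phi> where "\<phi>\<phi> = tensor_lift WW.T (\<lambda>x y. WW.pt (\<phi> x) (\<phi> y))"
  note bil = bilinear_on_comp[OF WW.pt_bilinear \<phi>_linear \<phi>_linear]
  have lin: "linear_on HH.T WW.T \<phi>\<phi>" unfolding \<phi>\<phi>_def by (rule HH.tensor_lift_linear[OF WW.tensor_vspace bil])
  have pure: "\<phi>\<phi> (HH.pt u v) = WW.pt (\<phi> u) (\<phi> v)" if "u \<in> U" "v \<in> U" for u v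
    unfolding \<phi>\<phi>_def using HH.tensor_lift_pure[OF WW.tensor_vspace bil] that by simp
  note br_lin = HH.tensor_lift_linear[OF HH.tensor_vspace br_bilinear]
    and br_pure = HH.tensor_lift_pure[OF HH.tensor_vspace br_bilinear]
    and W_lin = WW.tensor_lift_linear[OF WW.tensor_vspace V_abe_braid_bilinear]
    and W_pure = WW.tensor_lift_pure[OF WW.tensor_vspace V_abe_braid_bilinear]
  have key: "\<phi>\<phi> (br u v) = V_abe_braid a b e (\<phi> u) (\<phi> v)" if "u \<in> U" "v \<in> U" for u v
    by (rule bilinear_unique[OF bilinear_on_linear_comp[OF br_bilinear lin]
          bilinear_on_comp[OF V_abe_braid_bilinear \<phi>_linear \<phi>_linear] _ _ _ _ that])
       (simp_all add: br_w linear_on_smult[OF lin] pure \<phi>_w V_abe_braid_basis)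
  have "\<phi>\<phi> (braid ?Y t) = braid W (\<phi>\<phi> t)" if "t \<in> carrier HH.T" for t
    unfolding yd_braided_braid V_abe_braid_eq
    by (rule HH.tensor_linear_unique[OF linear_on_comp[OF br_lin lin] linear_on_comp[OF lin W_lin] _ that])
       (simp add: br_pure pure W_pure key)
  moreover have "\<phi> \<in> lin_iso ?Y W"
    using \<phi>_linear \<phi>_bij
    by (auto simp: lin_iso_def iso_def hom_def yd_braided_fields linear_on_def)
  ultimately have "braided_isomorphic ?Y W"
    unfolding braided_isomorphic_def Let_def tensor_cong[OF yd_braided_fields yd_braided_fields] \<phi>\<phi>_def
    by blast
  thus ?thesis using assms by (simp add: nichols_of_type_V_def)
qed

end

section \<open>The Yetter-Drinfeld module \<open>V \<boxtimes> A\<close>\<close>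

locale boxtimes_data = A: suzuki_pos A N n mu lam x + V: vspace V
  for A :: "('k::field, 'a, 'm) hopf_scheme" (structure) and N n mu lam x and V :: "('k, 'a, 'v, 'l) lmod_scheme" +
  assumes comult_hom: "algebra_hom A (tensor A A) (comult A)"
    and comult_x: "comult A (x i j) = A.comul i j"
    and antipode_hom: "algebra_hom A A.Aop (antipode A)"
    and antipode_x: "antipode A (x i j) = x j i [^] (4 * N - 1)"
    and act_bil: "bilinear_on A V V (act V)"
    and act_mult: "h \<in> carrier A \<Longrightarrow> h' \<in> carrier A \<Longrightarrow> v \<in> carrier V \<Longrightarrow> act V (h \<otimes> h') v = act V h (act V h' v)"
    and act_one: "v \<in> carrier V \<Longrightarrow> act V \<one> v = v"
    and generated: "vsubspace S A \<Longrightarrow> \<one> \<in> S \<Longrightarrow> (\<And>i j h. h \<in> S \<Longrightarrow> x i j \<otimes> h \<in> S) \<Longrightarrow> carrier A \<subseteq> S"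
begin

sublocale AA: kalgebra_pair A A by unfold_locales
sublocale VA: vspace_pair V A by unfold_locales

lemmas comult_linear = algebra_hom_linear[OF comult_hom]

lemma comult_closed [simp, intro]: "h \<in> carrier A \<Longrightarrow> comult A h \<in> carrier AA.T"
  by (rule linear_on_closed[OF comult_linear])

lemma antipode_linear: "linear_on A A (antipode A)"
  using algebra_hom_linear[OF antipode_hom] by (simp add: linear_on_def)

lemma antipode_closed [simp, intro]: "h \<in> carrier A \<Longrightarrow> antipode A h \<in> carrier A"
  by (rule linear_on_closed[OF antipode_linear])

lemma antipode_mult:
  "h \<in> carrier A \<Longrightarrow> h' \<in> carrier A \<Longrightarrow> antipode A (h \<otimes> h') = antipode A h' \<otimes> antipode A h"
  using algebra_hom_mult[OF antipode_hom] by simp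

lemma act_closed [simp, intro]: "h \<in> carrier A \<Longrightarrow> v \<in> carrier V \<Longrightarrow> act V h v \<in> carrier V"
  using linear_on_closed[OF bilinear_on_right[OF act_bil]] by blast

lemmas lm = bilinear_on_right[OF A.mult_bilinear] and rm = bilinear_on_left[OF A.mult_bilinear]
  and act_r = bilinear_on_right[OF act_bil] and act_l = bilinear_on_left[OF act_bil]
  and pt_r = bilinear_on_right[OF VA.pt_bilinear] and pt_l = bilinear_on_left[OF VA.pt_bilinear]

definition leg_term where "leg_term l g h3 h1 h2 = VA.pt (act V h2 l) (h1 \<otimes> g \<otimes> antipode A h3)"
definition leg_sum where "leg_sum l g h12 h3 = tensor_lift VA.T (leg_term l g h3) (comult A h12)"
definition sandwich_op where "sandwich_op p q r = tensor_lift VA.T (\<lambda>l g. VA.pt (act V q l) (p \<otimes> g \<otimes> r))"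

abbreviation "M \<equiv> boxtimes V A"

lemma M_simps [simp]:
  "carrier M = carrier VA.T" "\<zero>\<^bsub>M\<^esub> = \<zero>\<^bsub>VA.T\<^esub>" "(\<oplus>\<^bsub>M\<^esub>) = (\<oplus>\<^bsub>VA.T\<^esub>)" "(\<odot>\<^bsub>M\<^esub>) = (\<odot>\<^bsub>VA.T\<^esub>)"
  "monoid.mult M = monoid.mult VA.T" "\<one>\<^bsub>M\<^esub> = \<one>\<^bsub>VA.T\<^esub>"
  by (simp_all add: boxtimes_def Let_def module.extend_def)

lemma act_M: "act M h = tensor_lift VA.T (\<lambda>l g. tensor_lift VA.T (leg_sum l g) (comult A h))"
  by (simp add: boxtimes_def Let_def module.extend_def leg_sum_def[abs_def] leg_term_def[abs_def])

lemma M_vspace: "vspace M"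
  by (rule vspace_cong[OF VA.tensor_vspace]) simp_all

lemma leg_term_bilinear:
  assumes "l \<in> carrier V" "g \<in> carrier A" "h3 \<in> carrier A"
  shows "bilinear_on A A VA.T (leg_term l g h3)"
  unfolding leg_term_def[abs_def] using assms
  by (intro bilinear_onI linear_on_comp[OF act_l pt_l]
      linear_on_comp[OF linear_on_comp[OF rm rm] pt_r]) auto

lemma leg_term_linear_h3:
  assumes "l \<in> carrier V" "g \<in> carrier A" "h1 \<in> carrier A" "h2 \<in> carrier A"
  shows "linear_on A VA.T (\<lambda>h3. leg_term l g h3 h1 h2)"
  unfolding leg_term_def using assms
  by (intro linear_on_comp[OF linear_on_comp[OF antipode_linear lm] pt_r]) auto

lemma leg_term_linear_l:
  assumes "g \<in> carrier A" "h3 \<in> carrier A" "h1 \<in> carrier A" "h2 \<in> carrier A"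
  shows "linear_on V VA.T (\<lambda>l. leg_term l g h3 h1 h2)"
  unfolding leg_term_def using assms by (intro linear_on_comp[OF act_r pt_l]) auto

lemma leg_term_linear_g:
  assumes "l \<in> carrier V" "h3 \<in> carrier A" "h1 \<in> carrier A" "h2 \<in> carrier A"
  shows "linear_on A VA.T (\<lambda>g. leg_term l g h3 h1 h2)"
  unfolding leg_term_def using assms
  by (intro linear_on_comp[OF linear_on_comp[OF lm rm] pt_r]) auto

lemma leg_sum_bilinear:
  assumes "l \<in> carrier V" "g \<in> carrier A"
  shows "bilinear_on A A VA.T (leg_sum l g)"
  unfolding leg_sum_def[abs_def] using assms
  by (intro bilinear_onI AA.tensor_lift_param_linear[OF VA.tensor_vspace] leg_term_bilinear leg_term_linear_h3
      A.vspace_axioms linear_on_comp[OF comult_linear AA.tensor_lift_linear[OF VA.tensor_vspace]]) auto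

lemma leg_sum_linear_l:
  assumes "g \<in> carrier A" "h3 \<in> carrier A" "h12 \<in> carrier A"
  shows "linear_on V VA.T (\<lambda>l. leg_sum l g h12 h3)"
  unfolding leg_sum_def using assms
  by (intro AA.tensor_lift_param_linear[OF VA.tensor_vspace] leg_term_bilinear leg_term_linear_l V.vspace_axioms) auto

lemma leg_sum_linear_g:
  assumes "l \<in> carrier V" "h3 \<in> carrier A" "h12 \<in> carrier A"
  shows "linear_on A VA.T (\<lambda>g. leg_sum l g h12 h3)"
  unfolding leg_sum_def using assms
  by (intro AA.tensor_lift_param_linear[OF VA.tensor_vspace] leg_term_bilinear leg_term_linear_g A.vspace_axioms) auto

lemma act_bilinear:
  assumes "h \<in> carrier A"
  shows "bilinear_on V A VA.T (\<lambda>l g. tensor_lift VA.T (leg_sum l g) (comult A h))"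
  using assms
  by (intro bilinear_onI AA.tensor_lift_param_linear[OF VA.tensor_vspace] leg_sum_bilinear leg_sum_linear_l leg_sum_linear_g
      A.vspace_axioms V.vspace_axioms) auto

lemmas act_M_linear = VA.tensor_lift_linear[OF VA.tensor_vspace act_bilinear, folded act_M]
  and act_M_pure = VA.tensor_lift_pure[OF VA.tensor_vspace act_bilinear, folded act_M]

lemma act_M_bilinear: "bilinear_on A VA.T VA.T (act M)"
proof (rule bilinear_onI)
  fix m assume m: "m \<in> carrier VA.T"
  show "linear_on A VA.T (\<lambda>h. act M h m)"
    unfolding act_M using m
    by (intro VA.tensor_lift_param_linear[OF VA.tensor_vspace] act_bilinear A.vspace_axioms
        linear_on_comp[OF comult_linear AA.tensor_lift_linear[OF VA.tensor_vspace]] leg_sum_bilinear) auto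
qed (rule act_M_linear)

lemma act_M_bilinear': "bilinear_on A M M (act M)"
  using act_M_bilinear by (simp add: bilinear_on_def linear_on_def)

lemma sandwich_op_bilinear:
  assumes "p \<in> carrier A" "q \<in> carrier A" "r \<in> carrier A"
  shows "bilinear_on V A VA.T (\<lambda>l g. VA.pt (act V q l) (p \<otimes> g \<otimes> r))"
  using assms by (intro bilinear_on_comp[OF VA.pt_bilinear act_r linear_on_comp[OF lm rm]]) auto

lemmas sandwich_op_linear = VA.tensor_lift_linear[OF VA.tensor_vspace sandwich_op_bilinear, folded sandwich_op_def]
  and sandwich_op_pure = VA.tensor_lift_pure[OF VA.tensor_vspace sandwich_op_bilinear, folded sandwich_op_def]

lemma lift_left_mult:
  assumes U: "vspace U" and B: "bilinear_on A A U B" and ab: "a \<in> carrier A" "b \<in> carrier A" and t: "t \<in> carrier AA.T"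
  shows "tensor_lift U B (AA.pt a b \<otimes>\<^bsub>AA.T\<^esub> t) = tensor_lift U (\<lambda>c d. B (a \<otimes> c) (b \<otimes> d)) t"
proof -
  note bil = bilinear_on_comp[OF B lm[OF ab(1)] lm[OF ab(2)]]
  show ?thesis
    by (rule AA.tensor_linear_unique[OF linear_on_comp[OF bilinear_on_right[OF AA.tensor_mult_bilinear]
            AA.tensor_lift_linear[OF U B]] AA.tensor_lift_linear[OF U bil] _ t])
       (simp_all add: ab AA.pt_mult AA.tensor_lift_pure[OF U B] AA.tensor_lift_pure[OF U bil])
qed

lemma lift_comul:
  assumes U: "vspace U" and B: "bilinear_on A A U B" and h: "h \<in> carrier A"
  shows "tensor_lift U B (comult A (x i j \<otimes> h))
    = tensor_lift U (\<lambda>c d. B (x i I1 \<otimes> c) (x I1 j \<otimes> d)) (comult A h) \<oplus>\<^bsub>U\<^esub>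
      tensor_lift U (\<lambda>c d. B (x i I2 \<otimes> c) (x I2 j \<otimes> d)) (comult A h)"
proof -
  interpret TT: kalgebra AA.T by (rule AA.tensor_kalgebra)
  have "comult A (x i j \<otimes> h) = AA.pt (x i I1) (x I1 j) \<otimes>\<^bsub>AA.T\<^esub> comult A h \<oplus>\<^bsub>AA.T\<^esub> AA.pt (x i I2) (x I2 j) \<otimes>\<^bsub>AA.T\<^esub> comult A h"
    using h algebra_hom_mult[OF comult_hom, of "x i j" h] by (simp add: comult_x A.comul_def TT.l_distr)
  thus ?thesis
    using h by (simp add: linear_on_add[OF AA.tensor_lift_linear[OF U B]] lift_left_mult[OF U B])
qed

definition gen_summand where "gen_summand i j a b = sandwich_op (x i a) (x a b) (antipode A (x b j))"

lemma gen_summand_linear: "linear_on VA.T VA.T (gen_summand i j a b)"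
  unfolding gen_summand_def by (rule sandwich_op_linear) auto

lemma gen_summand_closed [simp, intro]: "m \<in> carrier VA.T \<Longrightarrow> gen_summand i j a b m \<in> carrier VA.T"
  by (rule linear_on_closed[OF gen_summand_linear])

definition gen_partial where "gen_partial i j b m = gen_summand i j I1 b m \<oplus>\<^bsub>VA.T\<^esub> gen_summand i j I2 b m"

lemma gen_partial_linear: "linear_on VA.T VA.T (gen_partial i j b)"
  unfolding gen_partial_def[abs_def] by (intro linear_on_addI gen_summand_linear VA.tensor_vspace)

definition gen_op where "gen_op i j m = gen_partial i j I1 m \<oplus>\<^bsub>VA.T\<^esub> gen_partial i j I2 m"

lemma gen_op_linear: "linear_on VA.T VA.T (gen_op i j)"
  unfolding gen_op_def[abs_def] by (intro linear_on_addI gen_partial_linear VA.tensor_vspace)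

lemma leg_sum_step:
  assumes "l \<in> carrier V" "g \<in> carrier A" "h12 \<in> carrier A" "h3 \<in> carrier A"
  shows "leg_sum l g (x i b \<otimes> h12) (x b j \<otimes> h3) = gen_partial i j b (leg_sum l g h12 h3)"
proof -
  have "tensor_lift VA.T (\<lambda>h1 h2. leg_term l g (x b j \<otimes> h3) (x i a \<otimes> h1) (x a b \<otimes> h2)) (comult A h12)
      = gen_summand i j a b (leg_sum l g h12 h3)" for a
  proof -
    have "tensor_lift VA.T (\<lambda>h1 h2. leg_term l g (x b j \<otimes> h3) (x i a \<otimes> h1) (x a b \<otimes> h2)) (comult A h12)
        = tensor_lift VA.T (\<lambda>h1 h2. gen_summand i j a b (leg_term l g h3 h1 h2)) (comult A h12)"
      using assms
      by (intro AA.tensor_lift_cong[OF VA.tensor_vspace] bilinear_on_linear_comp[OF leg_term_bilinear gen_summand_linear]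
          bilinear_on_comp[OF leg_term_bilinear lm lm])
         (auto simp: leg_term_def gen_summand_def sandwich_op_pure act_mult antipode_mult A.m_assoc)
    also have "\<dots> = gen_summand i j a b (tensor_lift VA.T (leg_term l g h3) (comult A h12))"
      using assms by (intro AA.tensor_lift_comp[symmetric] VA.tensor_vspace leg_term_bilinear gen_summand_linear) auto
    finally show ?thesis by (simp add: leg_sum_def)
  qed
  thus ?thesis
    using lift_comul[OF VA.tensor_vspace leg_term_bilinear[of l g "x b j \<otimes> h3"], of h12 i b] assms
    by (simp add: leg_sum_def gen_partial_def)
qed

lemma act_M_step:
  assumes h: "h \<in> carrier A" and m: "m \<in> carrier VA.T"
  shows "act M (x i j \<otimes> h) m = gen_op i j (act M h m)"
proof -
  have xh: "x i j \<otimes> h \<in> carrier A" using h by simp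
  show ?thesis
  proof (rule VA.tensor_linear_unique[OF act_M_linear[OF xh] linear_on_comp[OF act_M_linear[OF h] gen_op_linear] _ m])
    fix l g assume lg: "l \<in> carrier V" "g \<in> carrier A"
    note bil = leg_sum_bilinear[OF lg]
    have "tensor_lift VA.T (\<lambda>c d. leg_sum l g (x i b \<otimes> c) (x b j \<otimes> d)) (comult A h)
        = gen_partial i j b (tensor_lift VA.T (leg_sum l g) (comult A h))" for b
    proof -
      have "tensor_lift VA.T (\<lambda>c d. leg_sum l g (x i b \<otimes> c) (x b j \<otimes> d)) (comult A h)
          = tensor_lift VA.T (\<lambda>c d. gen_partial i j b (leg_sum l g c d)) (comult A h)"
        using h lg
        by (intro AA.tensor_lift_cong[OF VA.tensor_vspace] bilinear_on_linear_comp[OF bil gen_partial_linear]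
            bilinear_on_comp[OF bil lm lm]) (auto simp: leg_sum_step)
      also have "\<dots> = gen_partial i j b (tensor_lift VA.T (leg_sum l g) (comult A h))"
        using h by (intro AA.tensor_lift_comp[symmetric] VA.tensor_vspace bil gen_partial_linear) auto
      finally show ?thesis .
    qed
    thus "act M (x i j \<otimes> h) (VA.pt l g) = gen_op i j (act M h (VA.pt l g))"
      using lift_comul[OF VA.tensor_vspace bil h, of i j]
      by (simp add: act_M_pure[OF xh lg] act_M_pure[OF h lg] gen_op_def)
  qed
qed

lemma act_M_one:
  assumes m: "m \<in> carrier VA.T"
  shows "act M \<one> m = m"
proof (rule VA.tensor_linear_unique[OF act_M_linear[OF A.one_closed] linear_onI _ m])
  fix l g assume lg: "l \<in> carrier V" "g \<in> carrier A"
  have one: "comult A \<one> = AA.pt \<one> \<one>" "antipode A \<one> = \<one>"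
    using algebra_hom_one[OF comult_hom] algebra_hom_one[OF antipode_hom] by (simp_all add: AA.tensor_one)
  show "act M \<one> (VA.pt l g) = VA.pt l g"
    using lg
    by (simp add: act_M_pure one AA.tensor_lift_pure[OF VA.tensor_vspace leg_sum_bilinear])
       (simp add: leg_sum_def one AA.tensor_lift_pure[OF VA.tensor_vspace leg_term_bilinear], simp add: leg_term_def one act_one)
qed auto

sublocale AT: vspace_pair A VA.T by unfold_locales

lemma tensor_A_M: "tensor A M = AT.T" "pure_tensor A M = AT.pt"
  by (rule tensor_cong pure_tensor_cong; simp)+

lemma coact_M:
  "coact M = tensor_lift AT.T (\<lambda>l g. tensor_lift AT.T (\<lambda>g1 g2. AT.pt g1 (VA.pt l g2)) (comult A g))"
  by (simp add: boxtimes_def Let_def module.extend_def)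

lemma coact_inner_bilinear:
  assumes "l \<in> carrier V"
  shows "bilinear_on A A AT.T (\<lambda>g1 g2. AT.pt g1 (VA.pt l g2))"
  using bilinear_on_comp[OF AT.pt_bilinear _ pt_r[OF assms], of A "\<lambda>g. g"] by (simp add: linear_on_def)

lemma coact_outer_bilinear:
  "bilinear_on V A AT.T (\<lambda>l g. tensor_lift AT.T (\<lambda>g1 g2. AT.pt g1 (VA.pt l g2)) (comult A g))"
  by (intro bilinear_onI linear_on_comp[OF comult_linear AA.tensor_lift_linear[OF AT.tensor_vspace]]
      coact_inner_bilinear AA.tensor_lift_param_linear[OF AT.tensor_vspace] V.vspace_axioms
      linear_on_comp[OF pt_l bilinear_on_right[OF AT.pt_bilinear]]) auto

lemmas coact_M_linear = VA.tensor_lift_linear[OF AT.tensor_vspace coact_outer_bilinear, folded coact_M]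
  and coact_M_pure = VA.tensor_lift_pure[OF AT.tensor_vspace coact_outer_bilinear, folded coact_M]

lemma coact_M_comatrix:
  assumes "l \<in> carrier V" "g \<in> carrier A" "comult A g = AA.pt a b \<oplus>\<^bsub>AA.T\<^esub> AA.pt a' b'"
    and "a \<in> carrier A" "b \<in> carrier A" "a' \<in> carrier A" "b' \<in> carrier A"
  shows "coact M (VA.pt l g) = AT.pt a (VA.pt l b) \<oplus>\<^bsub>AT.T\<^esub> AT.pt a' (VA.pt l b')"
proof -
  note bil = coact_inner_bilinear[OF assms(1)]
  show ?thesis
    using assms
    by (simp add: coact_M_pure linear_on_add[OF AA.tensor_lift_linear[OF AT.tensor_vspace bil]]
        AA.tensor_lift_pure[OF AT.tensor_vspace bil])
qed

end

locale boxtimes_plane = boxtimes_data A N n mu lam x V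
  for A :: "('k::field, 'a, 'm) hopf_scheme" (structure) and N n mu lam x and V :: "('k, 'a, 'v, 'l) lmod_scheme" +
  fixes v1 v2 :: 'v and \<epsilon> :: "'a \<Rightarrow> 'k" and p1 p2 :: "'v \<Rightarrow> 'k" and Q q q' c d :: 'k and s t :: nat
  assumes v_closed [simp, intro]: "v1 \<in> carrier V" "v2 \<in> carrier V"
    and \<epsilon>: "algebra_hom A scalar_alg \<epsilon>" "\<epsilon> (x i j) = (if i = j then 1 else 0)"
    and p: "linear_on V scalar_alg p1" "linear_on V scalar_alg p2"
      "p1 v1 = 1" "p1 v2 = 0" "p2 v1 = 0" "p2 v2 = 1"
    and act_diag_v: "v \<in> carrier V \<Longrightarrow> act V (x i i) v = \<zero>\<^bsub>V\<^esub>"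
    and act_v: "act V (x I1 I2) v1 = v2" "act V (x I1 I2) v2 = Q \<odot>\<^bsub>V\<^esub> v1"
      "act V (x I2 I1) v1 = q \<odot>\<^bsub>V\<^esub> v2" "act V (x I2 I1) v2 = (Q * q') \<odot>\<^bsub>V\<^esub> v1"
    and q: "q * q' = 1" and d: "d = c * Q * q'" and cd: "c * d = 1" and s: "0 < s"
begin

abbreviation "g \<equiv> A.G s t"

lemmas g_closed [simp, intro] = A.G_closed[OF s]

definition w1 where "w1 = VA.pt v1 (g I2 I2) \<oplus>\<^bsub>VA.T\<^esub> c \<odot>\<^bsub>VA.T\<^esub> VA.pt v2 (g I2 I1)"
definition w2 where "w2 = VA.pt v2 (g I1 I1) \<oplus>\<^bsub>VA.T\<^esub> d \<odot>\<^bsub>VA.T\<^esub> VA.pt v1 (g I1 I2)"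

lemma w_closed [simp, intro]: "w1 \<in> carrier VA.T" "w2 \<in> carrier VA.T"
  by (simp_all add: w1_def w2_def)

lemma comult_g: "comult A (g i j) = AA.pt (g i I1) (g I1 j) \<oplus>\<^bsub>AA.T\<^esub> AA.pt (g i I2) (g I2 j)"
proof -
  interpret TT: kalgebra AA.T by (rule AA.tensor_kalgebra)
  have "comult A (g i j) = A.comul i j [^]\<^bsub>AA.T\<^esub> (2 * s) \<otimes>\<^bsub>AA.T\<^esub> chi AA.T A.comul i j (2 * t + 1)"
    unfolding A.G_def[OF s]
    using algebra_hom_pow[OF comult_hom A.kalgebra_axioms, of "x i j" "2 * s"]
      algebra_hom_chi[OF comult_hom A.kalgebra_axioms, of x i j "2 * t + 1"]
    by (simp only: algebra_hom_mult[OF comult_hom] A.nat_pow_closed A.x_closed A.chi_closed comult_x)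
  thus ?thesis by (simp only: A.comul_G[OF s])
qed

lemma coact_w:
  "coact M w1 = AT.pt (g I2 I2) w1 \<oplus>\<^bsub>AT.T\<^esub> c \<odot>\<^bsub>AT.T\<^esub> AT.pt (g I2 I1) w2" (is ?A)
  "coact M w2 = AT.pt (g I1 I1) w2 \<oplus>\<^bsub>AT.T\<^esub> d \<odot>\<^bsub>AT.T\<^esub> AT.pt (g I1 I2) w1" (is ?B)
proof -
  have pure: "coact M (VA.pt l (g i j)) = AT.pt (g i I1) (VA.pt l (g I1 j)) \<oplus>\<^bsub>AT.T\<^esub> AT.pt (g i I2) (VA.pt l (g I2 j))"
    if "l \<in> carrier V" for l i j
    using that by (intro coact_M_comatrix comult_g) auto
  have dc: "d * c = 1" using cd by (simp add: mult.commute)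
  show ?A ?B
    by (simp_all add: w1_def w2_def linear_on_add[OF coact_M_linear] linear_on_smult[OF coact_M_linear] pure
        AT.pt_add_right AT.pt_smult_right AT.T.smult_add_right AT.T.smult_smult cd dc AT.T.a_ac)
qed

lemma gen_summand_pure:
  "l \<in> carrier V \<Longrightarrow> gen_summand i j a b (VA.pt l (g k m)) = VA.pt (act V (x a b) l) (x i a \<otimes> g k m \<otimes> x j b [^] (4 * N - 1))"
  unfolding gen_summand_def by (subst sandwich_op_pure) (simp_all add: antipode_x)

lemma gen_summand_zero:
  assumes l: "l \<in> carrier V" and *: "a = b \<or> (i = a) \<noteq> (k = m) \<or> (k = m) \<noteq> (j = b)"
  shows "gen_summand i j a b (VA.pt l (g k m)) = \<zero>\<^bsub>VA.T\<^esub>"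
proof -
  have pos: "0 < 4 * N - 1" using A.N_pos by simp
  have 1: "x i a \<otimes> g k m = \<zero>" if "(i = a) \<noteq> (k = m)"
    by (rule A.D_mult_zero[OF A.x_D A.G_D[OF s] that])
  have 2: "g k m \<otimes> x j b [^] (4 * N - 1) = \<zero>" if "(k = m) \<noteq> (j = b)"
    by (rule A.D_mult_zero[OF A.G_D[OF s] A.pow_D[OF pos] that])
  have "a = b \<or> x i a \<otimes> g k m \<otimes> x j b [^] (4 * N - 1) = \<zero>"
    using * 1 2 A.m_assoc[of "x i a" "g k m" "x j b [^] (4 * N - 1)"] by fastforce
  thus ?thesis unfolding gen_summand_pure[OF l] using act_diag_v[OF l] l by auto
qed

lemma gen_op_pure_diag:
  assumes l: "l \<in> carrier V"
  shows "gen_op i i (VA.pt l (g k m)) = \<zero>\<^bsub>VA.T\<^esub>"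
proof -
  have "gen_summand i i a b (VA.pt l (g k m)) = \<zero>\<^bsub>VA.T\<^esub>" for a b
    by (rule gen_summand_zero[OF l]) (cases i; cases a; cases b; auto)
  thus ?thesis by (simp add: gen_op_def gen_partial_def)
qed

lemma gen_summand_pure_other:
  assumes l: "l \<in> carrier V" and a: "a = (if k = m then i else other i)"
  shows "gen_summand i (other i) a (other a) (VA.pt l (g k m)) = VA.pt (act V (x a (other a)) l) (g (other k) (other m))"
proof -
  have "k = i \<and> m = a \<or> k = other i \<and> m = other a"
    using a by (cases i; cases k; cases m) auto
  thus ?thesis
    unfolding gen_summand_pure[OF l] using A.sandwich_same[OF s, of i a t] A.sandwich_other[OF s, of i a t] by auto
qed

lemma gen_op_pure:
  assumes l: "l \<in> carrier V"
  shows "gen_op i (other i) (VA.pt l (g k m))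
     = VA.pt (act V (if k = m then x i (other i) else x (other i) i) l) (g (other k) (other m))"
proof -
  define a where "a = (if k = m then i else other i)"
  have z: "gen_summand i (other i) a' b' (VA.pt l (g k m)) = \<zero>\<^bsub>VA.T\<^esub>" if "a' \<noteq> a \<or> b' \<noteq> other a" for a' b'
    by (rule gen_summand_zero[OF l]) (use that in \<open>cases i; cases a'; cases b'; auto simp: a_def split: if_splits\<close>)
  have y: "gen_summand i (other i) a (other a) (VA.pt l (g k m)) = VA.pt (act V (x a (other a)) l) (g (other k) (other m))"
    by (rule gen_summand_pure_other[OF l a_def])
  have "gen_op i (other i) (VA.pt l (g k m)) = VA.pt (act V (x a (other a)) l) (g (other k) (other m))"
    unfolding gen_op_def gen_partial_def using y z l by (cases a) simp_all
  thus ?thesis by (auto simp: a_def)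
qed

lemma gen_op_w_diag: "gen_op i i w1 = \<zero>\<^bsub>VA.T\<^esub>" "gen_op i i w2 = \<zero>\<^bsub>VA.T\<^esub>"
  by (simp_all add: w1_def w2_def linear_on_add[OF gen_op_linear] linear_on_smult[OF gen_op_linear] gen_op_pure_diag)

lemma gen_op_w:
  "gen_op I1 I2 w1 = w2" (is ?A) "gen_op I1 I2 w2 = Q \<odot>\<^bsub>VA.T\<^esub> w1" (is ?B)
  "gen_op I2 I1 w1 = q \<odot>\<^bsub>VA.T\<^esub> w2" (is ?C) "gen_op I2 I1 w2 = (Q * q') \<odot>\<^bsub>VA.T\<^esub> w1" (is ?D)
proof -
  have dq: "d * q = Q * c" "q * d = c * Q" "Q * q' * c = d" "c * (Q * q') = d"
    using q by (simp_all add: d algebra_simps)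
  note X = gen_op_pure[of _ I1, simplified] gen_op_pure[of _ I2, simplified]
  show ?A ?B ?C ?D
    by (simp_all add: w1_def w2_def linear_on_add[OF gen_op_linear] linear_on_smult[OF gen_op_linear] X act_v
        VA.pt_smult_left VA.T.smult_add_right VA.T.smult_smult dq)
qed

sublocale pl: vspace_plane VA.T w1 w2 by unfold_locales auto

lemma gen_op_plane: "u \<in> pl.plane \<Longrightarrow> gen_op i j u \<in> pl.plane"
proof (elim pl.planeE)
  fix \<alpha> \<beta> assume u: "u = pl.comb \<alpha> \<beta>"
  have "gen_op i j w1 \<in> pl.plane" "gen_op i j w2 \<in> pl.plane"
    by (cases i; cases j; simp add: gen_op_w gen_op_w_diag pl.plane_smult pl.plane_zero)+
  thus "gen_op i j u \<in> pl.plane"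
    by (simp add: u pl.comb_def linear_on_add[OF gen_op_linear] linear_on_smult[OF gen_op_linear] pl.plane_add pl.plane_smult)
qed

lemma act_plane:
  assumes h: "h \<in> carrier A" and w: "w \<in> {w1, w2}"
  shows "act M h w \<in> pl.plane"
proof -
  have wT: "w \<in> carrier VA.T" using w by auto
  note lin = bilinear_on_left[OF act_M_bilinear wT]
  let ?S = "{h \<in> carrier A. act M h w \<in> pl.plane}"
  have "vsubspace ?S A"
    by (rule A.subspaceI)
       (auto simp: linear_on_add[OF lin] linear_on_smult[OF lin]
         linear_on_zero[OF lin A.vspace_axioms VA.tensor_vspace] pl.plane_zero pl.plane_add pl.plane_smult)
  moreover have "\<one> \<in> ?S" using w by (auto simp: act_M_one)
  moreover have "x i j \<otimes> h \<in> ?S" if "h \<in> ?S" for i j h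
    using that wT by (simp add: act_M_step gen_op_plane)
  ultimately have "carrier A \<subseteq> ?S" by (rule generated)
  thus ?thesis using h by auto
qed

lemma act_g_diag:
  assumes w: "w \<in> {w1, w2}"
  shows "act M (g i i) w = \<zero>\<^bsub>VA.T\<^esub>"
proof -
  have wT: "w \<in> carrier VA.T" using w by auto
  obtain s' where s': "2 * s = Suc s'" using s by (cases "2 * s") auto
  let ?h = "x i i [^] s' \<otimes> chi A x i i (2 * t + 1)"
  have "g i i = x i i \<otimes> ?h"
    unfolding A.G_def[OF s] s' A.nat_pow_Suc2[OF A.x_closed] by (rule A.m_assoc) auto
  hence "act M (g i i) w = gen_op i i (act M ?h w)"
    by (simp only: act_M_step[OF _ wT] A.m_closed A.nat_pow_closed A.x_closed A.chi_closed)
  also have "act M ?h w \<in> pl.plane" by (rule act_plane[OF _ w]) auto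
  hence "gen_op i i (act M ?h w) = \<zero>\<^bsub>VA.T\<^esub>"
    by (elim pl.planeE) (simp only: pl.comb_def linear_on_add[OF gen_op_linear] linear_on_smult[OF gen_op_linear] gen_op_w_diag
        VA.T.smult_closed w_closed VA.T.smult_zero_right VA.T.l_zero VA.T.zero_closed)
  finally show ?thesis .
qed

lemma gen_op_smult: "u \<in> carrier VA.T \<Longrightarrow> gen_op i j (\<gamma> \<odot>\<^bsub>VA.T\<^esub> u) = \<gamma> \<odot>\<^bsub>VA.T\<^esub> gen_op i j u"
  by (rule linear_on_smult[OF gen_op_linear])

lemma act_pow_off:
  assumes ij: "i \<noteq> j" and h: "h \<in> carrier A" and w: "w \<in> carrier VA.T" and w': "w' \<in> {w1, w2}"
    and eq: "act M h w = \<gamma> \<odot>\<^bsub>VA.T\<^esub> w'"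
  shows "act M (x i j [^] (2 * m :: nat) \<otimes> h) w = (Q ^ m * \<gamma>) \<odot>\<^bsub>VA.T\<^esub> w'"
proof (induction m)
  case 0
  show ?case using h eq by simp
next
  case (Suc m)
  have w'T: "w' \<in> carrier VA.T" using w' by auto
  have gen_End: "gen_op i j (gen_op i j w') = Q \<odot>\<^bsub>VA.T\<^esub> w'"
    using w' ij q by (cases i; cases j; auto simp: gen_op_w gen_op_smult VA.T.smult_smult mult_ac)
  have "x i j [^] (2 * Suc m) \<otimes> h = x i j \<otimes> (x i j \<otimes> (x i j [^] (2 * m) \<otimes> h))"
    using h by (simp add: A.nat_pow_Suc2 A.m_assoc del: A.nat_pow_Suc Group.nat_pow_Suc)
  hence "act M (x i j [^] (2 * Suc m) \<otimes> h) w = gen_op i j (gen_op i j ((Q ^ m * \<gamma>) \<odot>\<^bsub>VA.T\<^esub> w'))"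
    using Suc h w by (simp only: act_M_step A.m_closed A.nat_pow_closed A.x_closed)
  also have "\<dots> = (Q ^ m * \<gamma>) \<odot>\<^bsub>VA.T\<^esub> (Q \<odot>\<^bsub>VA.T\<^esub> w')"
    using w'T linear_on_closed[OF gen_op_linear] by (simp add: gen_op_smult gen_End)
  finally show ?case using w'T by (simp add: VA.T.smult_smult mult_ac)
qed

lemma act_chi_off:
  "act M (chi A x I1 I2 (2 * m)) w1 = (Q * q) ^ m \<odot>\<^bsub>VA.T\<^esub> w1"
  "act M (chi A x I1 I2 (2 * m)) w2 = (Q * q') ^ m \<odot>\<^bsub>VA.T\<^esub> w2"
  "act M (chi A x I2 I1 (2 * m)) w1 = (Q * q') ^ m \<odot>\<^bsub>VA.T\<^esub> w1"
  "act M (chi A x I2 I1 (2 * m)) w2 = (Q * q) ^ m \<odot>\<^bsub>VA.T\<^esub> w2"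
  by (induction m) (simp_all add: act_M_one act_M_step gen_op_smult gen_op_w VA.T.smult_smult mult_ac)

lemma act_g_off:
  "act M (g I2 I1) w1 = (Q ^ s * ((Q * q) ^ t * q)) \<odot>\<^bsub>VA.T\<^esub> w2"
  "act M (g I2 I1) w2 = (Q ^ s * ((Q * q') ^ t * (Q * q'))) \<odot>\<^bsub>VA.T\<^esub> w1"
  "act M (g I1 I2) w1 = (Q ^ s * (Q * q') ^ t) \<odot>\<^bsub>VA.T\<^esub> w2"
  "act M (g I1 I2) w2 = (Q ^ s * ((Q * q) ^ t * Q)) \<odot>\<^bsub>VA.T\<^esub> w1"
  unfolding A.G_def[OF s]
  by (rule act_pow_off; simp add: act_M_step act_chi_off gen_op_smult gen_op_w VA.T.smult_smult)+

definition f1 where "f1 = tensor_lift scalar_alg (\<lambda>l h. p1 l * \<epsilon> h)"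
definition f2 where "f2 = tensor_lift scalar_alg (\<lambda>l h. p2 l * \<epsilon> h)"

lemma \<epsilon>_g: "\<epsilon> (g i j) = (if i = j then 1 else 0)"
proof -
  have pow: "y [^]\<^bsub>scalar_alg\<^esub> (m::nat) = y ^ m" for y :: 'k and m
    by (induction m) (simp_all add: mult.commute)
  have chi: "chi scalar_alg (\<lambda>i j. if i = j then 1 else 0) i i m = (1 :: 'k)" for i m
    by (induction m arbitrary: i) auto
  have "\<epsilon> (g i j) = \<epsilon> (x i j) [^]\<^bsub>scalar_alg\<^esub> (2 * s) * chi scalar_alg (\<lambda>i j. \<epsilon> (x i j)) i j (2 * t + 1)"
    unfolding A.G_def[OF s]
    using algebra_hom_pow[OF \<epsilon>(1) A.kalgebra_axioms, of "x i j" "2 * s"]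
      algebra_hom_chi[OF \<epsilon>(1) A.kalgebra_axioms, of x i j "2 * t + 1"]
    by (simp only: algebra_hom_mult[OF \<epsilon>(1)] A.nat_pow_closed A.x_closed A.chi_closed scalar_alg_simps)
  thus ?thesis using s chi by (simp add: \<epsilon>(2) pow del: chi.simps(2))
qed

lemma scalar_vspace: "vspace (scalar_alg :: ('k, 'k) module)"
  using scalar_alg_kalgebra kalgebra.axioms(2) by blast

lemma f_bilinear:
  assumes "linear_on V scalar_alg p"
  shows "bilinear_on V A scalar_alg (\<lambda>l h. p l * \<epsilon> h)"
  using assms algebra_hom_linear[OF \<epsilon>(1)]
  by (auto simp: bilinear_on_def linear_on_def algebra_simps)

lemma f_linear: "linear_on M scalar_alg f1" "linear_on M scalar_alg f2"
  unfolding f1_def f2_def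
  using VA.tensor_lift_linear[OF scalar_vspace f_bilinear[OF p(1)]]
    VA.tensor_lift_linear[OF scalar_vspace f_bilinear[OF p(2)]]
  by (simp_all add: linear_on_def)

lemma f_w: "f1 w1 = 1" (is ?A) "f1 w2 = 0" (is ?B) "f2 w1 = 0" (is ?C) "f2 w2 = 1" (is ?D)
proof -
  note lin = f_linear[unfolded linear_on_cong[of M VA.T, OF M_simps(1,3,4) refl refl refl]]
  have pure: "f1 (VA.pt l h) = p1 l * \<epsilon> h" "f2 (VA.pt l h) = p2 l * \<epsilon> h"
    if "l \<in> carrier V" "h \<in> carrier A" for l h
    unfolding f1_def f2_def
    using VA.tensor_lift_pure[OF scalar_vspace f_bilinear[OF p(1)] that]
      VA.tensor_lift_pure[OF scalar_vspace f_bilinear[OF p(2)] that] by auto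
  show ?A ?B ?C ?D
    by (simp_all add: w1_def w2_def linear_on_add[OF lin(1)] linear_on_add[OF lin(2)]
        linear_on_smult[OF lin(1)] linear_on_smult[OF lin(2)] pure p \<epsilon>_g)
qed

lemma vspace_plane_M: "vspace_plane M w1 w2"
  by (intro vspace_plane.intro vspace_plane_axioms.intro M_vspace) simp_all

lemma yd_plane_M:
  "yd_plane (c * Q ^ (s + t) * q ^ (t + 1)) (c * Q ^ (s + t + 1) * q' ^ (t + 1)) (d * Q ^ (s + t + 1) * q ^ t)
    A M w1 w2 f1 f2 (g I1 I1) (g I1 I2) (g I2 I1) (g I2 I2) c d"
proof (intro yd_plane.intro yd_plane_axioms.intro A.vspace_axioms vspace_plane_M f_linear f_w act_M_bilinear')
  show "linear_on M (tensor A M) (coact M)"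
    unfolding tensor_A_M using coact_M_linear by (simp add: linear_on_def)
  show "act M h w \<in> vspace_plane.plane M w1 w2" if "h \<in> carrier A" "w \<in> {w1, w2}" for h w
    using act_plane[OF that]
    by (simp add: pl.plane_def pl.comb_def vspace_plane.plane_def[OF vspace_plane_M] vspace_plane.comb_def[OF vspace_plane_M])
  show "act M (g I1 I1) w = \<zero>\<^bsub>M\<^esub> \<and> act M (g I2 I2) w = \<zero>\<^bsub>M\<^esub>" if "w \<in> {w1, w2}" for w
    using act_g_diag[OF that] by simp
  show "d \<odot>\<^bsub>M\<^esub> act M (g I1 I2) w1 = (c * Q ^ (s + t + 1) * q' ^ (t + 1)) \<odot>\<^bsub>M\<^esub> w2"
  proof -
    have "d * (Q ^ s * (Q * q') ^ t) = c * Q ^ (s + t + 1) * q' ^ (t + 1)"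
      by (simp add: d power_add power_mult_distrib mult_ac)
    thus ?thesis unfolding M_simps act_g_off VA.T.smult_smult[OF w_closed(2)] by simp
  qed
qed (simp_all add: tensor_A_M coact_w act_g_off VA.T.smult_smult power_add power_mult_distrib mult_ac)

end

lemma
  assumes "monoid.mult A' = monoid.mult A" "\<one>\<^bsub>A'\<^esub> = \<one>\<^bsub>A\<^esub>"
  shows nat_pow_cong: "y [^]\<^bsub>A'\<^esub> (m::nat) = y [^]\<^bsub>A\<^esub> m"
    and chi_cong: "chi A' x i j m = chi A x i j m"
proof -
  show "y [^]\<^bsub>A'\<^esub> m = y [^]\<^bsub>A\<^esub> m" by (simp add: nat_pow_def assms)
  show "chi A' x i j m = chi A x i j m" by (induction m arbitrary: i j) (simp_all add: assms)
qed

lemma suzuki_gens_cong: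
  assumes "suzuki_gens A N n mu lam x" "carrier B = carrier A" "\<zero>\<^bsub>B\<^esub> = \<zero>\<^bsub>A\<^esub>"
    "(\<oplus>\<^bsub>B\<^esub>) = (\<oplus>\<^bsub>A\<^esub>)" "(\<odot>\<^bsub>B\<^esub>) = (\<odot>\<^bsub>A\<^esub>)" "monoid.mult B = monoid.mult A" "\<one>\<^bsub>B\<^esub> = \<one>\<^bsub>A\<^esub>"
  shows "suzuki_gens B N n mu lam x"
proof -
  interpret suzuki_gens A N n mu lam x by fact
  note c = nat_pow_cong[OF assms(6,7)] chi_cong[OF assms(6,7)]
  show ?thesis
    using sq_diag sq_off chi_off chi_diag pow_sum mult_zero
    by (intro suzuki_gens.intro suzuki_gens_axioms.intro kalgebra_cong[OF kalgebra_axioms assms(2-7)])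
       (simp_all add: assms(2-) c del: even_add)
qed

definition End_alg :: "('k::field, 'v, 'm) module_scheme \<Rightarrow> ('k, 'v \<Rightarrow> 'v) module" where
  "End_alg V = \<lparr>carrier = {F. linear_on V V F}, monoid.mult = (\<lambda>F G v. F (G v)), monoid.one = (\<lambda>v. v),
     ring.zero = (\<lambda>_. \<zero>\<^bsub>V\<^esub>), ring.add = (\<lambda>F G v. F v \<oplus>\<^bsub>V\<^esub> G v), module.smult = (\<lambda>c F v. c \<odot>\<^bsub>V\<^esub> F v)\<rparr>"

lemma End_alg_simps [simp]:
  "carrier (End_alg V) = {F. linear_on V V F}" "\<one>\<^bsub>End_alg V\<^esub> = (\<lambda>v. v)" "\<zero>\<^bsub>End_alg V\<^esub> = (\<lambda>_. \<zero>\<^bsub>V\<^esub>)"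
  "F \<otimes>\<^bsub>End_alg V\<^esub> G = (\<lambda>v. F (G v))" "F \<oplus>\<^bsub>End_alg V\<^esub> G = (\<lambda>v. F v \<oplus>\<^bsub>V\<^esub> G v)"
  "c \<odot>\<^bsub>End_alg V\<^esub> F = (\<lambda>v. c \<odot>\<^bsub>V\<^esub> F v)"
  by (simp_all add: End_alg_def)

lemma End_alg_kalgebra:
  assumes "vspace V" and UNIV: "carrier V = UNIV"
  shows "kalgebra (End_alg V)"
proof -
  interpret V: vspace V by fact
  have [simp]: "v \<in> carrier V" for v using UNIV by simp
  note lin = linear_on_add linear_on_smult
  have zero: "linear_on V V (\<lambda>_. \<zero>\<^bsub>V\<^esub>)" by (rule linear_onI) auto
  have "abelian_group (End_alg V)"
  proof (rule abelian_groupI)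
    fix F assume "F \<in> carrier (End_alg V)"
    hence "linear_on V V (\<lambda>v. (-1) \<odot>\<^bsub>V\<^esub> F v)" by (intro linear_on_smultI V.vspace_axioms) auto
    thus "\<exists>G\<in>carrier (End_alg V). G \<oplus>\<^bsub>End_alg V\<^esub> F = \<zero>\<^bsub>End_alg V\<^esub>"
      by (intro bexI[of _ "\<lambda>v. (-1) \<odot>\<^bsub>V\<^esub> F v"]) (auto simp: V.smult_minus_one V.l_neg)
  qed (auto intro: linear_on_addI V.vspace_axioms zero simp: V.a_ac)
  hence "vspace (End_alg V)"
    by (intro vspace.intro vspace_axioms.intro)
       (auto intro: linear_on_smultI V.vspace_axioms simp: V.smult_add_left V.smult_add_right V.smult_smult)
  moreover have "linear_on V V (\<lambda>v. v)" by (rule linear_onI) auto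
  ultimately show ?thesis
    by (intro kalgebraI bilinear_onI linear_onI) (auto intro: linear_on_comp simp: lin)
qed

section \<open>The module \<open>V'\<^sub>j\<^sub>k\<close>\<close>

definition vec :: "'k::field \<Rightarrow> 'k \<Rightarrow> (idx \<Rightarrow>\<^sub>0 'k)" where
  "vec a b = Poly_Mapping.single I1 a + Poly_Mapping.single I2 b"

lemma vec_cases: obtains a b where "v = vec a b"
proof
  show "v = vec (Poly_Mapping.lookup v I1) (Poly_Mapping.lookup v I2)"
  proof (rule poly_mapping_eqI)
    fix i show "Poly_Mapping.lookup v i = Poly_Mapping.lookup (vec (Poly_Mapping.lookup v I1) (Poly_Mapping.lookup v I2)) i"
      by (cases i) (simp_all add: vec_def lookup_add lookup_single)
  qed
qed

lemma map_times_zero [simp]: "Poly_Mapping.map ((*) (c::'k::field)) 0 = 0"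
  by (intro poly_mapping_eqI) (simp add: lookup_map_times)

lemma map_times_add: "Poly_Mapping.map ((*) (c::'k::field)) (f + g) = Poly_Mapping.map ((*) c) f + Poly_Mapping.map ((*) c) g"
  by (intro poly_mapping_eqI) (simp add: lookup_map_times lookup_add algebra_simps)

lemma vec_smult: "Poly_Mapping.map ((*) c) (vec a b) = vec (c * a) (c * b)"
  by (simp add: vec_def map_times_add)

lemma lin_ext_vec:
  fixes \<phi> :: "idx \<Rightarrow> ('x \<Rightarrow>\<^sub>0 'k::field)"
  shows "lin_ext (free_mod UNIV) \<phi> (vec a b) = Poly_Mapping.map ((*) a) (\<phi> I1) + Poly_Mapping.map ((*) b) (\<phi> I2)"
proof -
  interpret V: vspace "free_mod UNIV :: ('k, 'x \<Rightarrow>\<^sub>0 'k) module" by (rule free_mod_vspace)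
  have "linear_on (free_mod UNIV) (free_mod UNIV) (lin_ext (free_mod UNIV) \<phi>)"
    by (rule V.lin_ext_linear) simp
  from linear_on_add[OF this, of "Poly_Mapping.single I1 a" "Poly_Mapping.single I2 b"]
  show ?thesis by (simp add: vec_def)
qed

locale suzuki_setup =
  fixes mu lam \<omega> r :: "'k::{alg_closed_field, field_char_0}"
    and N n j k p s t :: nat
  assumes N: "N \<ge> 1" and n: "n \<ge> 1"
    and mu: "mu \<in> {1, -1}" and lam: "lam = (-1) ^ j"
    and \<omega>: "primitive_root (8 * n * N) \<omega>"
    and r: "r ^ 2 = mubar n mu \<omega>"
    and s: "1 \<le> s"
begin

definition "Q = mubar n mu \<omega> * \<omega> ^ (8 * k * n)"
definition "q = \<omega> ^ (2 * j * N)"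
definition "q' = \<omega> powi (- (2 * int j * int N))"
definition "c = (-1) ^ p * \<omega> powi (int j * int N - 4 * int k * int n) / r"
definition "d = (-1) ^ p * r * \<omega> powi (4 * int k * int n - int j * int N)"

lemma \<omega>_nonzero [simp]: "\<omega> \<noteq> 0"
  using \<omega> by (auto simp: primitive_root_def power_0_left split: if_splits)

lemma \<omega>_half: "\<omega> ^ (4 * n * N) = -1"
proof -
  have "(\<omega> ^ (4 * n * N)) ^ 2 = 1"
    using \<omega> by (simp add: primitive_root_def mult_ac flip: power_mult)
  moreover have "\<omega> ^ (4 * n * N) \<noteq> 1" using \<omega> N n by (auto simp: primitive_root_def)
  ultimately show ?thesis by (simp add: power2_eq_1_iff)
qed

lemma \<omega>_full: "\<omega> ^ (8 * n * N) = 1"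
  using \<omega> by (simp add: primitive_root_def)

lemma mubar_nonzero [simp]: "mubar n mu \<omega> \<noteq> 0"
  by (simp add: mubar_def)

lemma r_nonzero [simp]: "r \<noteq> 0"
  using r mubar_nonzero by auto

lemma Q_nonzero: "Q \<noteq> 0" and q_nonzero: "q \<noteq> 0"
  by (simp_all add: Q_def q_def)

lemma powi_int: "\<omega> ^ m = \<omega> powi int m"
  by (simp add: power_int_def)

lemma qq': "q * q' = 1"
  unfolding q_def q'_def powi_int by (simp flip: power_int_add)

lemma Qq': "mubar n mu \<omega> * \<omega> powi (2 * (4 * int k * int n - int j * int N)) = Q * q'"
proof -
  have "2 * (4 * int k * int n - int j * int N) = int (8 * k * n) + - (2 * int j * int N)" by simp
  thus ?thesis unfolding Q_def q'_def powi_int by (simp only: power_int_add \<omega>_nonzero mult.assoc simp_thms)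
qed

lemma d_eq: "d = c * Q * q'"
proof -
  have "4 * int k * int n - int j * int N = (int j * int N - 4 * int k * int n) + int (8 * k * n) + - (2 * int j * int N)"
    by simp
  hence "\<omega> powi (4 * int k * int n - int j * int N)
      = \<omega> powi (int j * int N - 4 * int k * int n) * \<omega> ^ (8 * k * n) * \<omega> powi (- (2 * int j * int N))"
    unfolding powi_int by (simp only: power_int_add \<omega>_nonzero simp_thms)
  thus ?thesis by (simp add: c_def d_def Q_def q'_def flip: r) (simp add: power2_eq_square)
qed

lemma cd: "c * d = 1"
proof -
  let ?A = "\<omega> powi (int j * int N - 4 * int k * int n)" and ?B = "\<omega> powi (4 * int k * int n - int j * int N)"
  have "c * d = ((-1) ^ p * (-1) ^ p) * (?A * ?B)"
    unfolding c_def d_def by (simp add: field_simps)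
  also have "?A * ?B = 1"
    by (simp flip: power_int_add)
  finally show ?thesis by (simp flip: power_mult_distrib)
qed

lemma mu_Q: "mu * Q ^ N = 1"
proof -
  have "\<omega> ^ (8 * k * n * N) = 1"
    using \<omega>_full by (metis mult.assoc mult.commute power_mult power_one)
  moreover have "mu * mubar n mu \<omega> ^ N = 1"
    using mu \<omega>_half by (auto simp: mubar_def simp flip: power_mult)
  ultimately show ?thesis by (simp add: Q_def power_mult_distrib flip: power_mult)
qed

lemma q_n: "q' ^ n = lam * q ^ n" "q ^ n = lam * q' ^ n"
proof -
  have "q ^ n * q ^ n = (\<omega> ^ (4 * n * N)) ^ j"
    by (simp add: q_def flip: power_mult power_add) (simp add: algebra_simps)
  hence *: "q ^ n * q ^ n = lam" by (simp add: \<omega>_half lam)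
  have "q ^ n * q' ^ n = 1" using qq' by (simp flip: power_mult_distrib)
  thus "q ^ n = lam * q' ^ n" using * by (metis mult.assoc mult.right_neutral)
  have "lam * lam = 1" using lam by (simp flip: power_mult_distrib)
  thus "q' ^ n = lam * q ^ n" using \<open>q ^ n = lam * q' ^ n\<close> by (simp flip: mult.assoc)
qed

abbreviation "VV \<equiv> free_mod UNIV :: ('k, idx \<Rightarrow>\<^sub>0 'k) module"

definition "gen_End i l = lin_ext VV (V'_gen N n mu \<omega> j k i l)"

lemma gen_End_linear: "linear_on VV VV (gen_End i l)"
  unfolding gen_End_def by (rule vspace.lin_ext_linear[OF free_mod_vspace]) simp

lemma gen_End_diag: "gen_End i i = (\<lambda>_. 0)"
proof
  fix v :: "idx \<Rightarrow>\<^sub>0 'k"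
  obtain a b where "v = vec a b" by (rule vec_cases)
  thus "gen_End i i v = 0" by (cases i) (simp_all add: gen_End_def lin_ext_vec)
qed

lemma gen_End_off: "gen_End I1 I2 (vec a b) = vec (Q * b) a" "gen_End I2 I1 (vec a b) = vec (Q * q' * b) (q * a)"
  unfolding gen_End_def lin_ext_vec V'_gen.simps Qq'
  by (simp_all add: vec_def Q_def q_def mult_ac add.commute)

interpretation End: kalgebra "End_alg VV"
  by (rule End_alg_kalgebra[OF free_mod_vspace]) simp

lemma gen_End_zero: "gen_End i l 0 = 0"
  using linear_on_zero[OF gen_End_linear free_mod_vspace free_mod_vspace] by simp

lemma End_pow_vec:
  assumes "\<And>a b. F (vec a b) = vec (\<alpha> * a) (\<beta> * b)"
  shows "(F [^]\<^bsub>End_alg VV\<^esub> (m::nat)) (vec a b) = vec (\<alpha> ^ m * a) (\<beta> ^ m * b)"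
  by (induction m arbitrary: a b) (simp_all add: assms mult_ac)

lemma End_eqI: "(\<And>a b. F (vec a b) = G (vec a b)) \<Longrightarrow> F = G"
  by (metis vec_cases ext)

lemma gen_End_gens: "suzuki_gens (End_alg VV) N n mu lam gen_End"
proof (intro suzuki_gens.intro suzuki_gens_axioms.intro End.kalgebra_axioms)
  show cl: "gen_End i l \<in> carrier (End_alg VV)" for i l using gen_End_linear by simp
  note even = End.chi_even[OF cl]
  have zero_pow: "((\<lambda>_. 0) [^]\<^bsub>End_alg VV\<^esub> m) = (\<lambda>_. 0)" if "0 < m" for m :: nat
    using that
  proof (induction m)
    case (Suc m)
    thus ?case by (cases "m = 0") simp_all
  qed simp
  have pow2: "F [^]\<^bsub>End_alg VV\<^esub> (2::nat) = (\<lambda>v. F (F v))" for F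
    by (simp add: numeral_2_eq_2)
  show "gen_End I1 I1 [^]\<^bsub>End_alg VV\<^esub> (2::nat) = gen_End I2 I2 [^]\<^bsub>End_alg VV\<^esub> (2::nat)"
    by (simp add: gen_End_diag)
  show "gen_End I1 I2 [^]\<^bsub>End_alg VV\<^esub> (2::nat) = gen_End I2 I1 [^]\<^bsub>End_alg VV\<^esub> (2::nat)"
  proof -
    have 1: "Q * q' * (q * a) = Q * a" for a using qq' by (metis mult.commute mult.left_commute mult_1)
    have 2: "q * (Q * q' * a) = Q * a" for a using qq' by (metis mult.commute mult.left_commute mult_1)
    show ?thesis unfolding pow2 by (intro End_eqI) (simp only: gen_End_off 1 2)
  qed
  show "chi (End_alg VV) gen_End I2 I1 (2 * n) = lam \<odot>\<^bsub>End_alg VV\<^esub> chi (End_alg VV) gen_End I1 I2 (2 * n)"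
  proof (rule End_eqI)
    fix a b
    have 1: "(\<lambda>v. gen_End I2 I1 (gen_End I1 I2 v)) (vec a b) = vec ((Q * q') * a) ((Q * q) * b)" for a b
      by (simp add: gen_End_off mult_ac)
    have 2: "(\<lambda>v. gen_End I1 I2 (gen_End I2 I1 v)) (vec a b) = vec ((Q * q) * a) ((Q * q') * b)" for a b
      by (simp add: gen_End_off mult_ac)
    have e: "(Q * q') ^ n = lam * (Q * q) ^ n" "(Q * q) ^ n = lam * (Q * q') ^ n"
      unfolding power_mult_distrib by (subst q_n, rule mult.left_commute)+
    have f: "lam * ((Q * q) ^ n * a) = (Q * q') ^ n * a" "lam * ((Q * q') ^ n * b) = (Q * q) ^ n * b"
      using arg_cong[OF e(1), of "\<lambda>z. z * a"] arg_cong[OF e(2), of "\<lambda>z. z * b"] by (simp_all only: mult.assoc)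
    show "chi (End_alg VV) gen_End I2 I1 (2 * n) (vec a b)
        = (lam \<odot>\<^bsub>End_alg VV\<^esub> chi (End_alg VV) gen_End I1 I2 (2 * n)) (vec a b)"
      unfolding even
      by (simp only: other.simps End_alg_simps free_mod_simps vec_smult f End_pow_vec[OF 1] End_pow_vec[OF 2])
  qed
  show "chi (End_alg VV) gen_End I1 I1 (2 * n) = chi (End_alg VV) gen_End I2 I2 (2 * n)"
    unfolding even using n by (simp add: gen_End_diag zero_pow)
  show "gen_End I1 I1 [^]\<^bsub>End_alg VV\<^esub> (2 * N) \<oplus>\<^bsub>End_alg VV\<^esub> mu \<odot>\<^bsub>End_alg VV\<^esub> (gen_End I1 I2 [^]\<^bsub>End_alg VV\<^esub> (2 * N)) = \<one>\<^bsub>End_alg VV\<^esub>"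
  proof (rule End_eqI)
    fix a b
    have 1: "(\<lambda>v. gen_End I1 I2 (gen_End I1 I2 v)) (vec a b) = vec (Q * a) (Q * b)" for a b by (simp add: gen_End_off)
    have "gen_End I1 I2 [^]\<^bsub>End_alg VV\<^esub> (2 * N) = (gen_End I1 I2 [^]\<^bsub>End_alg VV\<^esub> (2::nat)) [^]\<^bsub>End_alg VV\<^esub> N"
      by (rule End.nat_pow_pow[OF cl, symmetric])
    hence "(gen_End I1 I2 [^]\<^bsub>End_alg VV\<^esub> (2 * N)) (vec a b) = vec (Q ^ N * a) (Q ^ N * b)"
      unfolding pow2 using End_pow_vec[OF 1, of N a b] by simp
    thus "(gen_End I1 I1 [^]\<^bsub>End_alg VV\<^esub> (2 * N) \<oplus>\<^bsub>End_alg VV\<^esub> mu \<odot>\<^bsub>End_alg VV\<^esub> (gen_End I1 I2 [^]\<^bsub>End_alg VV\<^esub> (2 * N))) (vec a b)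
        = \<one>\<^bsub>End_alg VV\<^esub> (vec a b)"
      using N mu_Q by (simp add: gen_End_diag zero_pow vec_smult flip: mult.assoc)
  qed
  show "gen_End i l \<otimes>\<^bsub>End_alg VV\<^esub> gen_End i' l' = \<zero>\<^bsub>End_alg VV\<^esub>"
    if "odd (idx_num i + idx_num l + idx_num i' + idx_num l')" for i l i' l'
  proof -
    have "i = l \<or> i' = l'" using that by (cases i; cases l; cases i'; cases l') auto
    thus ?thesis by (auto simp: gen_End_diag gen_End_zero)
  qed
qed

abbreviation "A0 \<equiv> suzuki_alg N n mu lam"
abbreviation "AS \<equiv> suzuki N n mu lam"
abbreviation "xs \<equiv> suzuki_x N n mu lam"
abbreviation "VM \<equiv> V'_module N n mu \<omega> j k"

lemma VM_simps [simp]: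
  "carrier VM = UNIV" "\<zero>\<^bsub>VM\<^esub> = 0" "v \<oplus>\<^bsub>VM\<^esub> w = v + w" "a \<odot>\<^bsub>VM\<^esub> v = Poly_Mapping.map ((*) a) v"
  by (simp_all add: V'_module_def Let_def module.extend_def free_mod_def)

lemma VM_vspace: "vspace VM"
  by (rule vspace_cong[OF free_mod_vspace[of UNIV]]) (auto simp: fun_eq_iff)

definition "rep h = the_elem (alg_ext (End_alg VV) gen_End ` h)"

lemmas rep_hom = suzuki_gens.suzuki_lift(1)[OF gen_End_gens, folded rep_def]
  and rep_x = suzuki_gens.suzuki_lift(2)[OF gen_End_gens, folded rep_def]

lemma act_VM:
  assumes "h \<in> carrier A0"
  shows "act VM h v = rep h v"
proof -
  let ?I = "suzuki_ideal N n mu lam"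
  interpret F: kalgebra "free_alg :: ('k, word \<Rightarrow>\<^sub>0 'k) module" by (rule free_alg_kalgebra)
  interpret S: subspace_of ?I "free_alg :: ('k, word \<Rightarrow>\<^sub>0 'k) module"
    by (rule suzuki_ideal_subspace)
  interpret G: suzuki_gens "End_alg VV" N n mu lam gen_End by (rule gen_End_gens)
  interpret V: vspace VV by (rule free_mod_vspace)
  obtain f where f: "h = ?I +>\<^bsub>free_alg\<^esub> f"
    using assms S.quot_carrier by (auto simp: suzuki_alg_def)
  note lin = End.alg_ext_linear[of gen_End, OF G.x_closed]
  have lin_v: "linear_on free_alg VV (\<lambda>f. alg_ext (End_alg VV) gen_End f v)"
    using linear_on_add[OF lin] linear_on_smult[OF lin] by (intro linear_onI) (simp_all add: fun_eq_iff)
  have mono: "foldr (\<lambda>(i, l). gen_End i l) ls v = foldr (\<lambda>(i, l) r. gen_End i l \<otimes>\<^bsub>End_alg VV\<^esub> r) ls \<one>\<^bsub>End_alg VV\<^esub> v" for ls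
    by (induction ls) auto
  have eq: "lin_ext VV (\<lambda>w. foldr (\<lambda>(i, l). gen_End i l) (letters w) v) f = alg_ext (End_alg VV) gen_End f v" for f
  proof (rule V.linear_free_unique[where S = UNIV and G = "\<lambda>f. alg_ext (End_alg VV) gen_End f v"])
    show "linear_on (free_mod UNIV) VV (lin_ext VV (\<lambda>w. foldr (\<lambda>(i, l). gen_End i l) (letters w) v))"
      by (rule V.lin_ext_linear) simp
    show "linear_on (free_mod UNIV) VV (\<lambda>f. alg_ext (End_alg VV) gen_End f v)"
      using lin_v unfolding linear_on_free_alg .
    show "lin_ext VV (\<lambda>w. foldr (\<lambda>(i, l). gen_End i l) (letters w) v) (Poly_Mapping.single w 1)
        = alg_ext (End_alg VV) gen_End (Poly_Mapping.single w 1) v" for w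
      using End.alg_ext_single[of gen_End w 1, OF G.x_closed]
      by (subst V.lin_ext_single) (simp_all add: End.monom_val_def mono)
  qed simp
  have "act VM h v = the_elem ((\<lambda>f. alg_ext (End_alg VV) gen_End f v) ` h)"
    by (simp add: V'_module_def Let_def module.extend_def case_prod_unfold flip: eq gen_End_def)
  also have "\<dots> = alg_ext (End_alg VV) gen_End f v"
    unfolding f using G.alg_ext_suzuki_ideal by (intro S.image_coset[OF lin_v V.vspace_axioms]) auto
  also have "\<dots> = rep h v" by (simp add: rep_def f G.the_elem_alg_ext)
  finally show ?thesis .
qed

lemma AS_fields:
  "carrier AS = carrier A0" "\<zero>\<^bsub>AS\<^esub> = \<zero>\<^bsub>A0\<^esub>" "(\<oplus>\<^bsub>AS\<^esub>) = (\<oplus>\<^bsub>A0\<^esub>)" "(\<odot>\<^bsub>AS\<^esub>) = (\<odot>\<^bsub>A0\<^esub>)"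
  "monoid.mult AS = monoid.mult A0" "\<one>\<^bsub>AS\<^esub> = \<one>\<^bsub>A0\<^esub>"
  by (simp_all add: suzuki_def Let_def module.extend_def)

lemma mu_sq: "mu * mu = 1"
  using mu by auto

interpretation A0: suzuki_pos A0 N n mu lam xs
  using N n by (intro suzuki_pos.intro suzuki_pos_axioms.intro suzuki_alg_gens mu_sq) auto

interpretation AS: suzuki_pos AS N n mu lam xs
  using N n by (intro suzuki_pos.intro suzuki_pos_axioms.intro mu_sq
      suzuki_gens_cong[OF suzuki_alg_gens AS_fields]) auto

lemma tensor_AS: "tensor AS AS = tensor A0 A0" "pure_tensor AS AS = pure_tensor A0 A0"
  by (rule tensor_cong pure_tensor_cong; rule AS_fields)+

lemma AS_comul: "AS.comul = A0.comul"
  by (simp add: fun_eq_iff AS.comul_def A0.comul_def tensor_AS)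

lemma comult_AS: "comult AS = (\<lambda>h. the_elem (alg_ext (tensor A0 A0) A0.comul ` h))"
  by (simp add: suzuki_def Let_def module.extend_def A0.comul_def[abs_def])

lemma antipode_AS:
  "antipode AS = (\<lambda>h. the_elem (alg_ext A0.Aop (\<lambda>i l. xs l i [^]\<^bsub>A0\<^esub> (4 * N - 1)) ` h))"
  by (simp add: suzuki_def Let_def module.extend_def A0.Aop_def)

sublocale boxtimes_data AS N n mu lam xs VM
proof (intro boxtimes_data.intro boxtimes_data_axioms.intro AS.suzuki_pos_axioms VM_vspace)
  show "algebra_hom AS (tensor AS AS) (comult AS)"
    using suzuki_gens.suzuki_lift(1)[OF A0.comul_gens]
    by (simp add: comult_AS tensor_AS algebra_hom_def linear_on_def AS_fields)
  show "comult AS (xs i l) = AS.comul i l" for i l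
    using suzuki_gens.suzuki_lift(2)[OF A0.comul_gens] by (simp add: comult_AS AS_comul)
  show "algebra_hom AS AS.Aop (antipode AS)"
    using suzuki_gens.suzuki_lift(1)[OF A0.antipode_gens]
    by (simp add: antipode_AS algebra_hom_def linear_on_def AS_fields)
  show "antipode AS (xs i l) = xs l i [^]\<^bsub>AS\<^esub> (4 * N - 1)" for i l
    unfolding antipode_AS suzuki_gens.suzuki_lift(2)[OF A0.antipode_gens]
    by (simp add: nat_pow_cong[OF AS_fields(5,6)])
  note rep_lin = algebra_hom_linear[OF rep_hom]
  note rep_add = linear_on_add[OF rep_lin] and rep_smult = linear_on_smult[OF rep_lin]
  have rl: "linear_on VV VV (rep h)" if "h \<in> carrier A0" for h
    using linear_on_closed[OF rep_lin that] by simp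
  show "bilinear_on AS VM VM (act VM)"
    using linear_on_add[OF rl] linear_on_smult[OF rl] A0.a_closed A0.smult_closed
    by (intro bilinear_onI linear_onI) (simp_all add: AS_fields act_VM rep_add rep_smult)
  show "act VM (h \<otimes>\<^bsub>AS\<^esub> h') v = act VM h (act VM h' v)" if "h \<in> carrier AS" "h' \<in> carrier AS" for h h' v
    using that algebra_hom_mult[OF rep_hom, of h h'] by (simp add: AS_fields act_VM)
  show "act VM \<one>\<^bsub>AS\<^esub> v = v" for v
    using algebra_hom_one[OF rep_hom] by (simp add: AS_fields act_VM)
  show "carrier AS \<subseteq> S" if "vsubspace S AS" "\<one>\<^bsub>AS\<^esub> \<in> S" "\<And>i l h. h \<in> S \<Longrightarrow> xs i l \<otimes>\<^bsub>AS\<^esub> h \<in> S" for S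
  proof
    interpret S: subspace_of S AS
      by (intro subspace_of.intro subspace_of_axioms.intro AS.vspace_axioms that(1))
    fix h assume "h \<in> carrier AS"
    hence "h \<in> carrier A0" by (simp add: AS_fields)
    thus "h \<in> S"
      by (induction h rule: suzuki_alg_induct)
         (use that(2,3) S.U_add S.U_smult in \<open>simp_all add: AS_fields\<close>)
  qed
qed

definition "\<epsilon> h = the_elem (alg_ext scalar_alg (\<lambda>i l. if i = l then 1 else (0::'k)) ` h)"

lemma counit_gens: "suzuki_gens scalar_alg N n mu lam (\<lambda>i l. if i = l then 1 else 0)"
proof (intro suzuki_gens.intro suzuki_gens_axioms.intro scalar_alg_kalgebra)
  interpret K: kalgebra "scalar_alg :: ('k, 'k) module" by (rule scalar_alg_kalgebra)
  let ?x = "\<lambda>i l. if i = l then 1 else (0::'k)"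
  have pow: "y [^]\<^bsub>scalar_alg\<^esub> (m::nat) = y ^ m" for y :: 'k and m
    by (induction m) (simp_all add: mult.commute)
  have chi: "chi scalar_alg ?x i l (2 * n) = (if i = l then 1 else 0)" for i l
    using n by (subst K.chi_even) (simp_all add: pow)
  show "chi scalar_alg ?x I2 I1 (2 * n) = lam \<odot>\<^bsub>scalar_alg\<^esub> chi scalar_alg ?x I1 I2 (2 * n)"
    "chi scalar_alg ?x I1 I1 (2 * n) = chi scalar_alg ?x I2 I2 (2 * n)"
    by (simp_all add: chi)
  show "?x I1 I1 [^]\<^bsub>scalar_alg\<^esub> (2 * N) \<oplus>\<^bsub>scalar_alg\<^esub> mu \<odot>\<^bsub>scalar_alg\<^esub> (?x I1 I2 [^]\<^bsub>scalar_alg\<^esub> (2 * N)) = \<one>\<^bsub>scalar_alg\<^esub>"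
    using N by (simp add: pow)
  show "?x i l \<otimes>\<^bsub>scalar_alg\<^esub> ?x i' l' = \<zero>\<^bsub>scalar_alg\<^esub>"
    if "odd (idx_num i + idx_num l + idx_num i' + idx_num l')" for i l i' l'
    using that by (cases i; cases l; cases i'; cases l') auto
qed (simp_all add: nat_pow_def)

sublocale boxtimes_plane AS N n mu lam xs VM "basis I1" "basis I2" \<epsilon>
  "\<lambda>v. Poly_Mapping.lookup v I1" "\<lambda>v. Poly_Mapping.lookup v I2" Q q q' c d s t
proof (unfold_locales)
  show "algebra_hom AS scalar_alg \<epsilon>"
    using suzuki_gens.suzuki_lift(1)[OF counit_gens]
    by (simp add: algebra_hom_def linear_on_def AS_fields \<epsilon>_def)
  show "\<epsilon> (xs i l) = (if i = l then 1 else 0)" for i l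
    using suzuki_gens.suzuki_lift(2)[OF counit_gens] by (simp add: \<epsilon>_def)
  have act: "act VM (xs i l) v = gen_End i l v" for i l v
    using act_VM[of "xs i l" v] by (simp add: rep_x)
  show "act VM (xs i i) v = \<zero>\<^bsub>VM\<^esub>" for i v by (simp add: act gen_End_diag)
  have b: "basis I1 = vec 1 0" "basis I2 = vec 0 (1 :: 'k)" by (simp_all add: vec_def)
  show "act VM (xs I1 I2) (basis I1) = basis I2" "act VM (xs I1 I2) (basis I2) = Q \<odot>\<^bsub>VM\<^esub> basis I1"
    "act VM (xs I2 I1) (basis I1) = q \<odot>\<^bsub>VM\<^esub> basis I2" "act VM (xs I2 I1) (basis I2) = (Q * q') \<odot>\<^bsub>VM\<^esub> basis I1"
    unfolding b act gen_End_off by (simp_all add: vec_smult)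
qed (use qq' d_eq cd s in \<open>simp_all add: linear_on_def lookup_add lookup_map_times lookup_single\<close>)

lemma xs_pow_even: "xs I2 I2 [^]\<^bsub>AS\<^esub> (2 * m::nat) = xs I1 I1 [^]\<^bsub>AS\<^esub> (2 * m)"
  "xs I2 I1 [^]\<^bsub>AS\<^esub> (2 * m::nat) = xs I1 I2 [^]\<^bsub>AS\<^esub> (2 * m)"
  using AS.pow_even_other[of "2 * m" I1 I1] AS.pow_even_other[of "2 * m" I1 I2] by simp_all

lemma H_w1_eq: "H_w1 N n mu lam \<omega> r j k p s t = w1"
  unfolding w1_def
  unfolding H_w1_def AS.G_def[OF boxtimes_plane.s[OF boxtimes_plane_axioms]] Let_def xs_pow_even c_def M_simps ..

lemma H_w2_eq: "H_w2 N n mu lam \<omega> r j k p s t = w2"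
proof -
  have "xs I1 l [^]\<^bsub>AS\<^esub> (2 * s + 1) \<otimes>\<^bsub>AS\<^esub> chi AS xs I2 (other l) (2 * t) = g I1 l" for l
    unfolding AS.G_def[OF boxtimes_plane.s[OF boxtimes_plane_axioms]] by (simp add: AS.m_assoc)
  from this[of I1] this[of I2] show ?thesis
    unfolding w2_def unfolding H_w2_def Let_def d_def M_simps by simp
qed

lemma H_module_nichols:
  "nichols_of_type_V (H_module N n mu lam \<omega> r j k p s t)
     (c * Q ^ (s + t) * q ^ (t + 1)) (c * Q ^ (s + t + 1) * q' ^ (t + 1)) (d * Q ^ (s + t + 1) * q ^ t)"
proof -
  interpret P: yd_plane "c * Q ^ (s + t) * q ^ (t + 1)" "c * Q ^ (s + t + 1) * q' ^ (t + 1)" "d * Q ^ (s + t + 1) * q ^ t"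
    AS M w1 w2 f1 f2 "g I1 I1" "g I1 I2" "g I2 I1" "g I2 I2" c d
    by (rule yd_plane_M)
  have "H_module N n mu lam \<omega> r j k p s t = P.H"
    unfolding H_module_def P.H_def P.M.plane_def P.M.comb_def Let_def H_w1_eq H_w2_eq ..
  moreover have "c \<noteq> 0" "d \<noteq> 0" "q' \<noteq> 0" using cd qq' by auto
  ultimately show ?thesis
    using P.nichols_of_type_V_H Q_nonzero q_nonzero by simp
qed

lemma ae_eq:
  "(c * Q ^ (s + t) * q ^ (t + 1)) * (d * Q ^ (s + t + 1) * q ^ t)
    = mubar n mu \<omega> ^ (2 * s + 2 * t + 1) * \<omega> ^ (4 * k * n * (4 * t + 4 * s + 2) + j * N * (4 * t + 2))"
proof -
  have "(c * Q ^ (s + t) * q ^ (t + 1)) * (d * Q ^ (s + t + 1) * q ^ t)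
      = (c * d) * (Q ^ (s + t) * Q ^ (s + t + 1)) * (q ^ (t + 1) * q ^ t)"
    by (simp only: mult_ac)
  also have "\<dots> = Q ^ (2 * s + 2 * t + 1) * q ^ (2 * t + 1)"
    by (simp only: cd power_add[symmetric] mult_1) (simp add: mult_2 add_ac)
  also have "\<dots> = mubar n mu \<omega> ^ (2 * s + 2 * t + 1)
      * (\<omega> ^ (8 * k * n * (2 * s + 2 * t + 1)) * \<omega> ^ (2 * j * N * (2 * t + 1)))"
    by (simp only: Q_def q_def power_mult_distrib power_mult[symmetric] mult.assoc)
  also have "\<omega> ^ (8 * k * n * (2 * s + 2 * t + 1)) * \<omega> ^ (2 * j * N * (2 * t + 1))
      = \<omega> ^ (4 * k * n * (4 * t + 4 * s + 2) + j * N * (4 * t + 2))"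
    unfolding power_add[symmetric] by (rule arg_cong[of _ _ "\<lambda>m. \<omega> ^ m"]) (simp add: algebra_simps)
  finally show ?thesis .
qed

lemma b_eq:
  "c * Q ^ (s + t + 1) * q' ^ (t + 1) = (-1) ^ p * (mubar n mu \<omega> ^ (s + t) * r)
     * \<omega> powi (4 * int k * int n * (2 * int t + 2 * int s + 1) + int j * int N * (-1 - 2 * int t))"
proof -
  have "c * Q ^ (s + t + 1) * q' ^ (t + 1) = d * Q ^ (s + t) * q' ^ t"
    by (simp add: d_eq mult_ac)
  also have "\<dots> = (-1) ^ p * (mubar n mu \<omega> ^ (s + t) * r) * (\<omega> powi (4 * int k * int n - int j * int N)
      * \<omega> powi (int (8 * k * n * (s + t))) * \<omega> powi (- (2 * int j * int N) * int t))"
  proof -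
    have "Q ^ (s + t) = mubar n mu \<omega> ^ (s + t) * \<omega> powi (int (8 * k * n * (s + t)))"
      unfolding Q_def power_mult_distrib powi_int[symmetric] power_mult[of \<omega> "8 * k * n"] ..
    moreover have "q' ^ t = \<omega> powi (- (2 * int j * int N) * int t)"
      unfolding q'_def power_int_mult power_int_of_nat ..
    ultimately show ?thesis by (simp only: d_def mult_ac)
  qed
  also have "\<omega> powi (4 * int k * int n - int j * int N) * \<omega> powi (int (8 * k * n * (s + t))) * \<omega> powi (- (2 * int j * int N) * int t)
      = \<omega> powi (4 * int k * int n * (2 * int t + 2 * int s + 1) + int j * int N * (-1 - 2 * int t))"
    unfolding power_int_add[OF disjI1[OF \<omega>_nonzero], symmetric]
    by (rule arg_cong[of _ _ "\<lambda>m. \<omega> powi m"]) (simp add: algebra_simps)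
  finally show ?thesis .
qed

end

theorem lemma4p17:
  fixes mu lam \<omega> r :: "'k::{alg_closed_field, field_char_0}"
    and N n j k p s t :: nat
  assumes "N \<ge> 1" and "n \<ge> 1"
    and "mu \<in> {1, -1}" and "lam \<in> {1, -1}"
    and "primitive_root (8 * n * N) \<omega>"
    and "r ^ 2 = mubar n mu \<omega>"
    and "1 \<le> s" and "s \<le> N" and "t \<le> n - 1" and "k \<le> N - 1" and "p \<in> {0, 1}"
    and "lam = 1 \<Longrightarrow> even j \<and> j div 2 \<in> {1..n - 1}"
    and "lam = -1 \<Longrightarrow> odd j \<and> (j + 1) div 2 \<in> {1..n}"
  shows "\<exists>a b e. nichols_of_type_V (H_module N n mu lam \<omega> r j k p s t) a b e \<and>
    a * e = mubar n mu \<omega> ^ (2 * s + 2 * t + 1)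
              * \<omega> ^ (4 * k * n * (4 * t + 4 * s + 2) + j * N * (4 * t + 2)) \<and>
    b = (-1) ^ p * (mubar n mu \<omega> ^ (s + t) * r)
          * \<omega> powi (4 * int k * int n * (2 * int t + 2 * int s + 1)
                      + int j * int N * (-1 - 2 * int t))"
proof -
  have "lam = (-1) ^ j" using assms(4,12,13) by auto
  then interpret suzuki_setup mu lam \<omega> r N n j k p s t
    using assms(1-7) by unfold_locales
  show ?thesis using H_module_nichols ae_eq b_eq by blast
qed

end
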